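(* Let $(\gamma_t)$ be a closed, convex, embedded ancient solution to the curve shortening flow on the unit sphere $S^2$. Then $(\gamma_t)$ is either a fixed equator for all $t\in(-\infty,\infty)$, or a family of shrinking geodesic circles existing on $(-\infty,0)$, converging to an equator as $t\to-\infty$ and shrinking to a point as $t\to 0$.
   Context: $S^2$ is the round unit sphere. A closed embedded smooth curve $\gamma\subset S^2$ divides $S^2$ into two open regions. If one has area strictly less than $2\pi$ it is called the interior of $\gamma$; if both have area $2\pi$, a smooth unit normal field is chosen (continuously in $t$ along a family) and designated interior pointing. Let $\nu$ be the interior pointing unit normal, $\tau$ the unit tangent, and $\kappa$ the geodesic curvature, defined by $\nabla_\tau\tau=\kappa\nu$ with $\nabla$ the Levi-Civita connection of $S^2$. A (closed, embedded) solution to the curve shortening flow is a smooth family of smooth embeddings $F_t:S^1\to S^2$ with $\gamma_t=F_t(S^1)$ and $\partial_t F_t=\kappa\nu$ (the curvature vector). It is ancient if its maximal interval of existence is $(-\infty,T)$; if $T\neq\infty$, time is translated so that $T=0$. It is convex if $\kappa\ge 0$ on every $\gamma_t$. An equator is a great circle of $S^2$. A geodesic circle is a set $\{x\in S^2: d(x,p)=r\}$ with $p\in S^2$ and $0<r<\pi$. *)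

theory Defs
  imports "HOL-Analysis.Analysis"
begin

section \<open>Smoothness\<close>

text \<open>Only meant for open \<open>S\<close>: \<open>C\<^sup>k\<close> means that all iterated directional derivatives up to
  order \<open>k\<close> exist on \<open>S\<close> and are continuous there.\<close>

primrec Ck_on ::
  "nat \<Rightarrow> 'a::euclidean_space set \<Rightarrow> ('a \<Rightarrow> 'b::real_normed_vector) \<Rightarrow> bool" where
  "Ck_on 0 S f \<longleftrightarrow> continuous_on S f"
| "Ck_on (Suc k) S f \<longleftrightarrow>
     (\<forall>x\<in>S. f differentiable (at x)) \<and> (\<forall>v. Ck_on k S (\<lambda>x. frechet_derivative f (at x) v))"

definition smooth_on :: "'a::euclidean_space set \<Rightarrow> ('a \<Rightarrow> 'b::real_normed_vector) \<Rightarrow> bool" where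
  "smooth_on S f \<longleftrightarrow> (\<forall>k. Ck_on k S f)"

section \<open>The round unit sphere\<close>

abbreviation S2 :: "(real^3) set" where
  "S2 \<equiv> sphere 0 1"

text \<open>Riemannian distance of the round metric.\<close>

definition sphere_dist :: "real^3 \<Rightarrow> real^3 \<Rightarrow> real" where
  "sphere_dist x y = arccos (x \<bullet> y)"

text \<open>By polar coordinates, the cone over \<open>A\<close> with apex at the origin has volume
  \<open>\<integral>\<^sub>0\<^sup>1 \<rho>\<^sup>2 area(A) d\<rho>\<close>, a third of the Riemannian area of \<open>A\<close>.\<close>

definition sphere_area :: "(real^3) set \<Rightarrow> real" where
  "sphere_area A = 3 * measure lebesgue {\<rho> *\<^sub>R x | \<rho> x. 0 \<le> \<rho> \<and> \<rho> \<le> 1 \<and> x \<in> A}"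

definition is_equator :: "(real^3) set \<Rightarrow> bool" where
  "is_equator E \<longleftrightarrow> (\<exists>n\<in>S2. E = {x\<in>S2. n \<bullet> x = 0})"

definition geodesic_circle :: "real^3 \<Rightarrow> real \<Rightarrow> (real^3) set" where
  "geodesic_circle p r = {x\<in>S2. sphere_dist x p = r}"

text \<open>Convergence of a family of subsets of the sphere in Hausdorff distance.\<close>

definition sets_converge :: "('t \<Rightarrow> (real^3) set) \<Rightarrow> (real^3) set \<Rightarrow> 't filter \<Rightarrow> bool" where
  "sets_converge A E \<F> \<longleftrightarrow> (\<forall>\<epsilon>>0. \<forall>\<^sub>F t in \<F>.
     (\<forall>x\<in>A t. \<exists>y\<in>E. sphere_dist x y < \<epsilon>) \<and> (\<forall>y\<in>E. \<exists>x\<in>A t. sphere_dist x y < \<epsilon>))"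

section \<open>Embedded closed curves and their curvature\<close>

abbreviation S1 :: "complex set" where
  "S1 \<equiv> sphere 0 1"

text \<open>Maps on the circle are differentiated in the angular coordinate.\<close>

abbreviation ang :: "(complex \<Rightarrow> 'b) \<Rightarrow> real \<Rightarrow> 'b" where
  "ang g \<equiv> \<lambda>s. g (cis s)"

text \<open>As the circle is compact, an embedding is the same as an injective immersion.\<close>

definition smooth_embedding :: "(complex \<Rightarrow> real^3) \<Rightarrow> bool" where
  "smooth_embedding g \<longleftrightarrow> g ` S1 \<subseteq> S2 \<and> smooth_on UNIV (ang g) \<and> inj_on g S1 \<and>
     (\<forall>s. vector_derivative (ang g) (at s) \<noteq> 0)"

definition unit_tangent :: "(real \<Rightarrow> real^3) \<Rightarrow> real \<Rightarrow> real^3" where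
  "unit_tangent c s = vector_derivative c (at s) /\<^sub>R norm (vector_derivative c (at s))"

text \<open>The Levi-Civita covariant derivative, along a curve \<open>c\<close> in the sphere, of a tangent field \<open>V\<close>:
  the tangential part of the Euclidean derivative.\<close>

definition cov_deriv :: "(real \<Rightarrow> real^3) \<Rightarrow> (real \<Rightarrow> real^3) \<Rightarrow> real \<Rightarrow> real^3" where
  "cov_deriv c V s =
     vector_derivative V (at s) - (c s \<bullet> vector_derivative V (at s)) *\<^sub>R c s"

text \<open>\<open>\<nabla>\<^sub>\<tau> \<tau>\<close>; the factor converts the derivative in the parameter into one in arc length.\<close>

definition curvature_vector :: "(real \<Rightarrow> real^3) \<Rightarrow> real \<Rightarrow> real^3" where
  "curvature_vector c s = cov_deriv c (unit_tangent c) s /\<^sub>R norm (vector_derivative c (at s))"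

definition geodesic_curvature :: "(real \<Rightarrow> real^3) \<Rightarrow> (real \<Rightarrow> real^3) \<Rightarrow> real \<Rightarrow> real" where
  "geodesic_curvature c \<nu> s = (THE k. curvature_vector c s = k *\<^sub>R \<nu> s)"

definition unit_normal_field :: "(complex \<Rightarrow> real^3) \<Rightarrow> (complex \<Rightarrow> real^3) \<Rightarrow> bool" where
  "unit_normal_field g \<nu> \<longleftrightarrow> smooth_on UNIV (ang \<nu>) \<and>
     (\<forall>s. norm (ang \<nu> s) = 1 \<and> ang \<nu> s \<bullet> ang g s = 0 \<and>
          ang \<nu> s \<bullet> vector_derivative (ang g) (at s) = 0)"

section \<open>Interior\<close>

definition is_interior :: "(real^3) set \<Rightarrow> (real^3) set \<Rightarrow> bool" where
  "is_interior \<gamma> R \<longleftrightarrow> R \<in> components (S2 - \<gamma>) \<and> sphere_area R < 2 * pi"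

definition bisects_area :: "(real^3) set \<Rightarrow> bool" where
  "bisects_area \<gamma> \<longleftrightarrow> (\<forall>R\<in>components (S2 - \<gamma>). sphere_area R = 2 * pi)"

text \<open>The geodesic issuing from \<open>x\<close> with unit tangent \<open>v\<close> initially runs inside \<open>R\<close>.\<close>

definition points_into :: "real^3 \<Rightarrow> real^3 \<Rightarrow> (real^3) set \<Rightarrow> bool" where
  "points_into v x R \<longleftrightarrow> (\<forall>\<^sub>F \<epsilon> in at_right 0. cos \<epsilon> *\<^sub>R x + sin \<epsilon> *\<^sub>R v \<in> R)"

text \<open>At area-bisecting times the sign of the normal is a free choice, subject only to continuity
  in time; at all other times it is dictated by the interior.\<close>

definition interior_normal_family ::
  "real set \<Rightarrow> (real \<Rightarrow> complex \<Rightarrow> real^3) \<Rightarrow> (real \<Rightarrow> complex \<Rightarrow> real^3) \<Rightarrow> bool" where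
  "interior_normal_family I F \<nu> \<longleftrightarrow>
     (\<forall>t\<in>I. unit_normal_field (F t) (\<nu> t)) \<and>
     (\<forall>t\<in>I. \<forall>R. is_interior (F t ` S1) R \<longrightarrow> (\<forall>z\<in>S1. points_into (\<nu> t z) (F t z) R)) \<and>
     continuous_on ({t\<in>I. bisects_area (F t ` S1)} \<times> S1) (\<lambda>(t, z). \<nu> t z)"

section \<open>Curve shortening flow\<close>

text \<open>The flow on an open time interval \<open>I\<close>. Values \<open>F t z\<close> with \<open>t \<notin> I\<close> or \<open>z \<notin> S1\<close> are
  irrelevant. Note that \<open>\<kappa> \<nu> = \<nabla>\<^sub>\<tau> \<tau>\<close> does not depend on the choice of \<open>\<nu>\<close>
  (see \<open>curvature_vector_eq\<close> below).\<close>

definition curve_shortening_flow :: "real set \<Rightarrow> (real \<Rightarrow> complex \<Rightarrow> real^3) \<Rightarrow> bool" where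
  "curve_shortening_flow I F \<longleftrightarrow>
     smooth_on (I \<times> UNIV) (\<lambda>(t, s). F t (cis s)) \<and>
     (\<forall>t\<in>I. smooth_embedding (F t)) \<and>
     (\<forall>t\<in>I. \<forall>s. ((\<lambda>t. F t (cis s)) has_vector_derivative curvature_vector (ang (F t)) s) (at t))"

abbreviation before :: "ereal \<Rightarrow> real set" where
  "before T \<equiv> {t. ereal t < T}"

text \<open>The maximal interval of existence is \<open>(-\<infinity>, T)\<close>, normalised so that \<open>T = 0\<close> if finite.\<close>

definition ancient_solution :: "ereal \<Rightarrow> (real \<Rightarrow> complex \<Rightarrow> real^3) \<Rightarrow> bool" where
  "ancient_solution T F \<longleftrightarrow>
     (T = 0 \<or> T = \<infinity>) \<and>
     curve_shortening_flow (before T) F \<and>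
     \<not> (\<exists>T'>T. \<exists>G. curve_shortening_flow (before T') G \<and>
           (\<forall>t\<in>before T. \<forall>z\<in>S1. G t z = F t z))"

definition convex_flow :: "real set \<Rightarrow> (real \<Rightarrow> complex \<Rightarrow> real^3) \<Rightarrow> bool" where
  "convex_flow I F \<longleftrightarrow> (\<exists>\<nu>. interior_normal_family I F \<nu> \<and>
     (\<forall>t\<in>I. \<forall>s. geodesic_curvature (ang (F t)) (ang (\<nu> t)) s \<ge> 0))"

section \<open>Consistency of the definitions\<close>

lemma sphere_area_S2: "sphere_area S2 = 4 * pi"
proof -
  have "{\<rho> *\<^sub>R x | \<rho> x. 0 \<le> \<rho> \<and> \<rho> \<le> 1 \<and> x \<in> S2} = cball (0::real^3) 1" (is "?L = ?R")
  proof
    show "?L \<subseteq> ?R" by auto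
    show "?R \<subseteq> ?L"
    proof
      fix y :: "real^3" assume y: "y \<in> ?R"
      show "y \<in> ?L"
      proof (cases "y = 0")
        case True
        have "(axis 1 1 :: real^3) \<in> S2" by (simp add: norm_axis_1)
        then show ?thesis using True
          by (intro CollectI exI[of _ 0] exI[of _ "axis 1 1"]) auto
      next
        case False
        then have "y = norm y *\<^sub>R (y /\<^sub>R norm y)" "y /\<^sub>R norm y \<in> S2" by auto
        then show ?thesis using y by (intro CollectI exI[of _ "norm y"] exI[of _ "y /\<^sub>R norm y"]) auto
      qed
    qed
  qed
  then show ?thesis
    unfolding sphere_area_def by (simp add: content_cball unit_ball_vol_3)
qed

lemma curvature_vector_eq:
  assumes g: "smooth_embedding g" and n: "unit_normal_field g \<nu>"
  shows "curvature_vector (ang g) s = geodesic_curvature (ang g) (ang \<nu>) s *\<^sub>R ang \<nu> s"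
proof -
  define c where "c = ang g"
  define d where "d = (\<lambda>s. vector_derivative c (at s))"
  define k where "k = curvature_vector c s"
  define a where "a = unit_tangent c s"
  have ck: "Ck_on (Suc (Suc 0)) UNIV c"
    using g unfolding smooth_embedding_def smooth_on_def c_def by blast
  have diff: "c differentiable (at x)" for x
    using ck by auto
  have fd: "frechet_derivative c (at x) 1 = d x" for x
    using diff[of x] unfolding d_def
    by (metis (no_types, lifting) frechet_derivative_at has_vector_derivative_def scaleR_one
        vector_derivative_works)
  have ddiff: "d differentiable (at x)" for x
  proof -
    have "(\<lambda>y. frechet_derivative c (at y) 1) differentiable (at x)"
      using ck unfolding Ck_on.simps by blast
    then show ?thesis by (simp add: fd)
  qed
  have dnz: "d x \<noteq> 0" for x
    using g unfolding smooth_embedding_def d_def c_def by blast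
  have cunit: "c x \<bullet> c x = 1" for x
    using g unfolding smooth_embedding_def c_def by (auto simp: dot_square_norm image_subset_iff)
  have hc: "(c has_vector_derivative d x) (at x)" for x
    using diff[of x] unfolding d_def by (simp add: vector_derivative_works)
  have cd: "c x \<bullet> d x = 0" for x
  proof -
    have "((\<lambda>x. c x \<bullet> c x) has_vector_derivative (c x \<bullet> d x + d x \<bullet> c x)) (at x)"
      by (rule bounded_bilinear.has_vector_derivative[OF bounded_bilinear_inner hc hc])
    then have "((\<lambda>x. 1::real) has_vector_derivative (c x \<bullet> d x + d x \<bullet> c x)) (at x)"
      by (simp add: cunit)
    then have "c x \<bullet> d x + d x \<bullet> c x = 0"
      using vector_derivative_unique_at has_vector_derivative_const by blast
    then show ?thesis by (simp add: inner_commute)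
  qed
  have tau: "unit_tangent c = (\<lambda>x. d x /\<^sub>R norm (d x))"
    by (rule ext) (simp add: unit_tangent_def d_def)
  have "norm differentiable (at (d s))"
    using dnz by (rule differentiable_norm_at)
  then have "(\<lambda>x. norm (d x)) differentiable (at s)"
    using differentiable_compose[OF _ ddiff[of s], of norm] by simp
  then have "unit_tangent c differentiable (at s)"
    unfolding tau using dnz ddiff by (intro derivative_intros) auto
  then obtain w where w: "(unit_tangent c has_vector_derivative w) (at s)"
    by (meson vector_derivative_works)
  have tunit: "unit_tangent c x \<bullet> unit_tangent c x = 1" for x
    using dnz[of x] by (simp add: tau dot_square_norm field_simps power2_eq_square)
  have "a \<bullet> w = 0"
  proof -
    have "((\<lambda>x. unit_tangent c x \<bullet> unit_tangent c x) has_vector_derivative (a \<bullet> w + w \<bullet> a)) (at s)"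
      unfolding a_def by (rule bounded_bilinear.has_vector_derivative[OF bounded_bilinear_inner w w])
    then have "((\<lambda>x. 1::real) has_vector_derivative (a \<bullet> w + w \<bullet> a)) (at s)"
      by (simp add: tunit)
    then have "a \<bullet> w + w \<bullet> a = 0"
      using vector_derivative_unique_at has_vector_derivative_const by blast
    then show ?thesis by (simp add: inner_commute)
  qed
  moreover have ca: "c s \<bullet> a = 0" by (simp add: a_def tau cd)
  moreover have kw: "k = (w - (c s \<bullet> w) *\<^sub>R c s) /\<^sub>R norm (d s)"
    using vector_derivative_at[OF w] by (simp add: k_def curvature_vector_def cov_deriv_def d_def)
  ultimately have ka: "k \<bullet> a = 0"
    by (simp add: inner_diff_right inner_commute)
  have kc: "k \<bullet> c s = 0"
    by (simp add: kw inner_diff_left cunit) (simp add: inner_commute)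
  define m where "m = ang \<nu> s"
  have m: "m \<bullet> m = 1" "m \<bullet> c s = 0" "m \<bullet> a = 0"
    using n unfolding unit_normal_field_def m_def c_def a_def unit_tangent_def
    by (auto simp: dot_square_norm)
  define u where "u = k - (k \<bullet> m) *\<^sub>R m"
  have u: "u \<bullet> m = 0" "u \<bullet> c s = 0" "u \<bullet> a = 0"
    by (simp_all add: u_def inner_diff_left m kc ka)
  have aa: "a \<bullet> a = 1" using tunit by (simp add: a_def)
  have "u = 0"
  proof (rule ccontr)
    assume "u \<noteq> 0"
    let ?B = "{u, m, c s, a}"
    have nz: "m \<noteq> 0" "c s \<noteq> 0" "a \<noteq> 0" using m(1) cunit[of s] aa by auto
    have dis: "u \<noteq> m" "u \<noteq> c s" "u \<noteq> a" "m \<noteq> c s" "m \<noteq> a" "c s \<noteq> a"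
      using u m ca aa cunit[of s] \<open>u \<noteq> 0\<close> nz by auto
    have "pairwise orthogonal ?B"
      using u m ca by (auto simp: pairwise_def orthogonal_def inner_commute)
    then have "independent ?B"
      using nz \<open>u \<noteq> 0\<close> by (intro pairwise_orthogonal_independent) auto
    then have "card ?B \<le> DIM(real^3)" using independent_bound by blast
    then show False using dis by simp
  qed
  then have km: "k = (k \<bullet> m) *\<^sub>R m" by (simp add: u_def)
  moreover have "j = k \<bullet> m" if "k = j *\<^sub>R m" for j
    using that m(1) by simp
  ultimately have "(THE j. k = j *\<^sub>R m) = k \<bullet> m" by (intro the_equality) auto
  then show ?thesis
    using km unfolding geodesic_curvature_def k_def m_def c_def by simp
qed

end

theory Submission
  imports Defs "HOL-Complex_Analysis.Winding_Numbers"
begin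

text \<open>
  Let \<open>\<kappa>\<close> be the curvature of a curve \<open>\<gamma>\<close> with respect to the normal \<open>\<nu> = \<gamma> \<times> \<tau>\<close>, \<open>L\<close> the
  length and \<open>K = \<integral> \<kappa> ds\<close>. Along the flow \<open>L' = - \<integral> \<kappa>\<^sup>2 ds\<close> and \<open>K' = K\<close>. So \<open>K\<close> decays like
  \<open>e\<^sup>t\<close> as \<open>t\<close> goes to \<open>-\<infinity>\<close>, and \<open>(L\<^sup>2 + K\<^sup>2)' = - 2 Q\<close>, where \<open>Q = L \<integral> \<kappa>\<^sup>2 ds - K\<^sup>2 \<ge> 0\<close> is the
  defect in the Cauchy-Schwarz inequality, which vanishes exactly when \<open>\<kappa>\<close> is constant on the
  curve. The proof shows \<open>Q = 0\<close> at all times.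

  Convexity enters through the fact that \<open>\<kappa>\<close> has one sign on each curve, so that the curve
  of the normals \<open>\<nu>\<close> has length \<open>\<bar>K\<bar>\<close>. When this is small, \<open>\<nu>\<close> stays close to a fixed vector
  \<open>n\<close>, the curve winds monotonically around the axis \<open>n\<close>, and as it is embedded it does so
  exactly once. This yields \<open>L (1 - K\<^sup>2/2) \<le> 2 \<pi>\<close> (\<open>length_bound_of_convex\<close>). Consequently
  \<open>L\<^sup>2 + K\<^sup>2\<close> is bounded towards \<open>-\<infinity>\<close>, and \<open>Q\<close> comes arbitrarily close to \<open>0\<close> there.

  The defect satisfies
  \<open>Q' = 2 Q - 2 L \<integral> \<kappa>\<^sub>s\<^sup>2 ds + (L \<integral> \<kappa>\<^sup>4 ds - (\<integral> \<kappa>\<^sup>2 ds)\<^sup>2)\<close>. By the Wirtinger inequality and the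
  bound on \<open>L\<close>, the diffusion term cancels \<open>2 Q\<close> up to a multiple of \<open>K\<^sup>2 Q\<close>, and it also
  controls the quartic term as long as \<open>Q \<le> 1\<close>. What remains is
  \<open>Q' \<le> (2 Q + 2 a K\<^sup>2) Q\<close>, so that \<open>Q exp (L\<^sup>2 + K\<^sup>2 - a K\<^sup>2)\<close> is nonincreasing; the
  exponent is bounded. Starting from times where \<open>Q\<close> is tiny gives \<open>Q = 0\<close> for all early times
  (\<open>defect_zero_early\<close>), and a Gronwall argument gives it for all later ones
  (\<open>defect_zero_forward\<close>).

  Once \<open>\<kappa>\<close> is constant on each curve, the unit vector \<open>p = (\<nu> + \<kappa> \<gamma>) / sqrt (1 + \<kappa>\<^sup>2)\<close> depends
  neither on the point nor on the time, \<open>\<gamma> \<bullet> p = C e\<^sup>t\<close> for a constant \<open>C\<close>, and each point moves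
  on a meridian through \<open>p\<close>. These explicit circles solve the flow as long as \<open>\<bar>C\<bar> e\<^sup>t < 1\<close>
  (\<open>shrinking_circle_flow\<close>). A maximal solution with \<open>T = \<infinity>\<close> therefore has \<open>C = 0\<close>, an equator,
  and one with \<open>T = 0\<close> has \<open>\<bar>C\<bar> = 1\<close>.
\<close>

section \<open>Calculus of smooth maps\<close>

lemma frechet_derivative_eq:
  "(f has_derivative f') (at x) \<Longrightarrow> frechet_derivative f (at x) v = f' v"
  by (simp add: frechet_derivative_at[symmetric])

text \<open>\<open>Ck_on\<close> uses derivatives at the points of \<open>S\<close>, so on an open set it depends only on the
  values of the map there.\<close>

lemma Ck_on_cong:
  assumes "open S" "\<And>x. x \<in> S \<Longrightarrow> f x = g x" "Ck_on k S f"
  shows "Ck_on k S g"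
  using assms(2,3)
proof (induction k arbitrary: f g)
  case 0
  then show ?case by (simp cong: continuous_on_cong)
next
  case (Suc k)
  have der: "(g has_derivative frechet_derivative f (at x)) (at x)" if x: "x \<in> S" for x
    using has_derivative_transform_within_open[OF _ assms(1) x, of f _ UNIV g] Suc.prems x
      frechet_derivative_works[of f "at x"] by auto
  have "Ck_on k S (\<lambda>x. frechet_derivative g (at x) v)" for v
    using Suc.IH[of "\<lambda>x. frechet_derivative f (at x) v" "\<lambda>x. frechet_derivative g (at x) v"]
      Suc.prems(2) frechet_derivative_eq[OF der] by simp
  then show ?case using der by (auto simp: differentiable_def)
qed

lemma Ck_on_lower: "Ck_on (Suc k) S f \<Longrightarrow> Ck_on k S f"
proof (induction k arbitrary: f)
  case 0
  then show ?case
    by (auto intro!: continuous_at_imp_continuous_on differentiable_imp_continuous_within)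
next
  case (Suc k)
  then show ?case by (metis Ck_on.simps(2))
qed

text \<open>The derivative of a map built from smooth ones need only be recognised on \<open>S\<close>; this is the
  induction step of all closure properties below.\<close>

lemma Ck_on_SucI:
  assumes "open S" "\<And>x. x \<in> S \<Longrightarrow> (f has_derivative f' x) (at x)" "\<And>v. Ck_on k S (\<lambda>x. f' x v)"
  shows "Ck_on (Suc k) S f"
  unfolding Ck_on.simps
proof (intro conjI allI ballI)
  show "f differentiable at x" if "x \<in> S" for x
    using assms(2)[OF that] by (auto simp: differentiable_def)
  show "Ck_on k S (\<lambda>x. frechet_derivative f (at x) v)" for v
    by (rule Ck_on_cong[OF assms(1) _ assms(3)[of v]]) (simp add: frechet_derivative_eq[OF assms(2)])
qed

lemma Ck_on_SucD: "Ck_on (Suc k) S f \<Longrightarrow> x \<in> S \<Longrightarrow> (f has_derivative frechet_derivative f (at x)) (at x)"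
  by (simp add: frechet_derivative_works)

lemma Ck_on_const: "open S \<Longrightarrow> Ck_on k S (\<lambda>x. c)"
proof (induction k arbitrary: c)
  case (Suc k)
  then show ?case by (intro Ck_on_SucI[where f'="\<lambda>x v. 0"]) auto
qed auto

lemma Ck_on_add: "open S \<Longrightarrow> Ck_on k S f \<Longrightarrow> Ck_on k S g \<Longrightarrow> Ck_on k S (\<lambda>x. f x + g x)"
proof (induction k arbitrary: f g)
  case (Suc k)
  show ?case
    by (rule Ck_on_SucI[where f'="\<lambda>x v. frechet_derivative f (at x) v + frechet_derivative g (at x) v"])
      (use Suc in \<open>auto intro!: has_derivative_add Ck_on_SucD[OF Suc.prems(2)] Ck_on_SucD[OF Suc.prems(3)]\<close>)
qed (auto intro: continuous_on_add)

lemma Ck_on_bilinear: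
  assumes "bounded_bilinear h" "open S"
  shows "Ck_on k S f \<Longrightarrow> Ck_on k S g \<Longrightarrow> Ck_on k S (\<lambda>x. h (f x) (g x))"
proof (induction k arbitrary: f g)
  case 0
  then show ?case using bounded_bilinear.continuous_on[OF assms(1)] by auto
next
  case (Suc k)
  show ?case
  proof (rule Ck_on_SucI[OF assms(2)])
    show "((\<lambda>x. h (f x) (g x)) has_derivative
        (\<lambda>v. h (f x) (frechet_derivative g (at x) v) + h (frechet_derivative f (at x) v) (g x))) (at x)"
      if "x \<in> S" for x
      using bounded_bilinear.FDERIV[OF assms(1) Ck_on_SucD[OF Suc.prems(1) that]
          Ck_on_SucD[OF Suc.prems(2) that]] .
    show "Ck_on k S (\<lambda>x. h (f x) (frechet_derivative g (at x) v) + h (frechet_derivative f (at x) v) (g x))" for v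
      using Suc.prems Ck_on_lower[OF Suc.prems(1)] Ck_on_lower[OF Suc.prems(2)]
      by (intro Ck_on_add assms Suc.IH) auto
  qed
qed

text \<open>The exponent is arbitrary because the derivative of \<open>f powr q\<close> involves \<open>f powr (q - 1)\<close>.
  Reciprocals and square roots are the cases \<open>q = -1\<close> and \<open>q = 1/2\<close>.\<close>

lemma Ck_on_powr:
  assumes "open S" "\<And>x. x \<in> S \<Longrightarrow> f x > (0::real)"
  shows "Ck_on k S f \<Longrightarrow> Ck_on k S (\<lambda>x. f x powr q)"
proof (induction k arbitrary: q)
  case 0
  then show ?case using assms(2) by (auto intro!: continuous_on_powr) force
next
  case (Suc k)
  show ?case
  proof (rule Ck_on_SucI[OF assms(1)])
    show "((\<lambda>x. f x powr q) has_derivative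
        (\<lambda>v. (q * f x powr (q - 1)) * frechet_derivative f (at x) v)) (at x)" if x: "x \<in> S" for x
    proof -
      have "((\<lambda>y. y powr q) has_real_derivative q * f x powr (q - 1)) (at (f x))"
        using assms(2)[OF x] by (auto intro!: derivative_eq_intros)
      from has_derivative_compose[OF Ck_on_SucD[OF Suc.prems x] this[unfolded has_field_derivative_def]]
      show ?thesis .
    qed
    show "Ck_on k S (\<lambda>x. (q * f x powr (q - 1)) * frechet_derivative f (at x) v)" for v
      using Suc.prems Ck_on_lower[OF Suc.prems]
      by (intro Ck_on_bilinear[OF bounded_bilinear_mult] assms(1) Ck_on_const Suc.IH) auto
  qed
qed

lemma Ck_on_compose_linear:
  assumes l: "bounded_linear l" and "open S" and T: "\<And>x. x \<in> S \<Longrightarrow> l x \<in> T"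
  shows "Ck_on k T f \<Longrightarrow> Ck_on k S (\<lambda>x. f (l x))"
proof (induction k arbitrary: f)
  case 0
  then show ?case
    using T continuous_on_compose2[of T f S l] linear_continuous_on[OF l] by auto
next
  case (Suc k)
  show ?case
  proof (rule Ck_on_SucI[OF \<open>open S\<close>])
    show "((\<lambda>x. f (l x)) has_derivative (\<lambda>v. frechet_derivative f (at (l x)) (l v))) (at x)"
      if x: "x \<in> S" for x
      using diff_chain_at[OF bounded_linear_imp_has_derivative[OF l] Ck_on_SucD[OF Suc.prems T[OF x]]]
      by (simp add: o_def)
    show "Ck_on k S (\<lambda>x. frechet_derivative f (at (l x)) (l v))" for v
      using Suc.prems by (intro Suc.IH) auto
  qed
qed

lemma smooth_on_const: "open S \<Longrightarrow> smooth_on S (\<lambda>x. c)"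
  by (simp add: smooth_on_def Ck_on_const)

lemma smooth_on_add:
  "open S \<Longrightarrow> smooth_on S f \<Longrightarrow> smooth_on S g \<Longrightarrow> smooth_on S (\<lambda>x. f x + g x)"
  by (simp add: smooth_on_def Ck_on_add)

lemma smooth_on_cong:
  "open S \<Longrightarrow> (\<And>x. x \<in> S \<Longrightarrow> f x = g x) \<Longrightarrow> smooth_on S f \<Longrightarrow> smooth_on S g"
  unfolding smooth_on_def using Ck_on_cong[of S f g] by simp

lemma smooth_on_bilinear:
  "bounded_bilinear h \<Longrightarrow> open S \<Longrightarrow> smooth_on S f \<Longrightarrow> smooth_on S g \<Longrightarrow>
    smooth_on S (\<lambda>x. h (f x) (g x))"
  by (simp add: smooth_on_def Ck_on_bilinear)

lemma smooth_on_powr: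
  "open S \<Longrightarrow> (\<And>x. x \<in> S \<Longrightarrow> 0 < (f x :: real)) \<Longrightarrow> smooth_on S f \<Longrightarrow> smooth_on S (\<lambda>x. f x powr q)"
  using Ck_on_powr[of S f] by (simp add: smooth_on_def)

lemma smooth_on_compose_linear:
  "bounded_linear l \<Longrightarrow> open S \<Longrightarrow> (\<And>x. x \<in> S \<Longrightarrow> l x \<in> T) \<Longrightarrow> smooth_on T f \<Longrightarrow>
    smooth_on S (\<lambda>x. f (l x))"
  using Ck_on_compose_linear[of l S T _ f] by (simp add: smooth_on_def)

lemma smooth_on_derivative: "smooth_on S f \<Longrightarrow> smooth_on S (\<lambda>x. frechet_derivative f (at x) v)"
  unfolding smooth_on_def by (metis Ck_on.simps(2))

lemma smooth_on_has_derivative: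
  "smooth_on S f \<Longrightarrow> x \<in> S \<Longrightarrow> (f has_derivative frechet_derivative f (at x)) (at x)"
  unfolding smooth_on_def by (metis Ck_on_SucD)

lemma smooth_on_continuous_on: "smooth_on S f \<Longrightarrow> continuous_on S f"
  unfolding smooth_on_def by (metis Ck_on.simps(1))

lemma smooth_on_exp: "smooth_on UNIV (\<lambda>t::real. C * exp t)"
proof -
  have "Ck_on k UNIV (\<lambda>t::real. C * exp t)" for k
  proof (induction k arbitrary: C)
    case (Suc k)
    have *: "((\<lambda>t. C * exp t) has_derivative (\<lambda>v. (C * v) * exp t)) (at t)" for t :: real
      by (auto intro!: derivative_eq_intros)
    show ?case
      by (rule Ck_on_SucI[OF open_UNIV *]) (rule Suc)
  qed (auto intro!: continuous_intros)
  then show ?thesis by (simp add: smooth_on_def)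
qed

lemmas smooth_on_scaleR = smooth_on_bilinear[OF bounded_bilinear_scaleR]
lemmas smooth_on_mult = smooth_on_bilinear[OF bounded_bilinear_mult]
lemmas smooth_on_inner = smooth_on_bilinear[OF bounded_bilinear_inner]

lemma bounded_bilinear_cross3: "bounded_bilinear cross3"
  using bilinear_cross bilinear_conv_bounded_bilinear by blast

lemmas smooth_on_cross = smooth_on_bilinear[OF bounded_bilinear_cross3]

lemma smooth_on_diff:
  assumes "open S" "smooth_on S f" "smooth_on S (g :: _ \<Rightarrow> _::real_normed_vector)"
  shows "smooth_on S (\<lambda>x. f x - g x)"
  using smooth_on_add[OF assms(1,2) smooth_on_scaleR[OF assms(1) smooth_on_const[OF assms(1), of "-1"] assms(3)]]
  by simp

lemma frechet_derivative_bilinear: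
  assumes "bounded_bilinear h" "smooth_on S f" "smooth_on S g" "x \<in> S"
  shows "frechet_derivative (\<lambda>x. h (f x) (g x)) (at x) v =
    h (f x) (frechet_derivative g (at x) v) + h (frechet_derivative f (at x) v) (g x)"
  by (rule frechet_derivative_eq[OF bounded_bilinear.FDERIV[OF assms(1)
      smooth_on_has_derivative[OF assms(2,4)] smooth_on_has_derivative[OF assms(3,4)]]])

lemma frechet_derivative_cong:
  assumes "open S" "smooth_on S f" "x \<in> S" "\<And>y. y \<in> S \<Longrightarrow> f y = g y"
  shows "frechet_derivative g (at x) v = frechet_derivative f (at x) v"
  using has_derivative_transform_within_open[OF smooth_on_has_derivative[OF assms(2,3)] assms(1,3,4)]
  by (rule frechet_derivative_eq)

section \<open>Partial derivatives in time and space\<close>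

definition dt :: "(real \<times> real \<Rightarrow> 'a::real_normed_vector) \<Rightarrow> real \<times> real \<Rightarrow> 'a" where
  "dt f x = frechet_derivative f (at x) (1, 0)"

definition ds :: "(real \<times> real \<Rightarrow> 'a::real_normed_vector) \<Rightarrow> real \<times> real \<Rightarrow> 'a" where
  "ds f x = frechet_derivative f (at x) (0, 1)"

lemma smooth_on_dt: "smooth_on S f \<Longrightarrow> smooth_on S (dt f)"
  and smooth_on_ds: "smooth_on S f \<Longrightarrow> smooth_on S (ds f)"
  unfolding dt_def[abs_def] ds_def[abs_def] by (rule smooth_on_derivative; simp)+

lemma has_vector_derivative_dt:
  assumes "smooth_on S f" "(t, s) \<in> S"
  shows "((\<lambda>t. f (t, s)) has_vector_derivative dt f (t, s)) (at t within A)"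
proof -
  have "((\<lambda>t. f (t, s)) has_derivative (\<lambda>h. frechet_derivative f (at (t, s)) (h, 0))) (at t)"
    by (rule has_derivative_compose[where g=f])
      (auto intro!: derivative_eq_intros smooth_on_has_derivative[OF assms])
  moreover have "frechet_derivative f (at (t, s)) (h, 0) = h *\<^sub>R dt f (t, s)" for h
    using linear_scale[OF has_derivative_linear[OF smooth_on_has_derivative[OF assms]], of h "(1,0)"]
    by (simp add: dt_def)
  ultimately show ?thesis
    by (simp add: has_vector_derivative_def has_derivative_at_withinI)
qed

lemma has_vector_derivative_ds:
  assumes "smooth_on S f" "(t, s) \<in> S"
  shows "((\<lambda>s. f (t, s)) has_vector_derivative ds f (t, s)) (at s within A)"
proof -
  have "((\<lambda>s. f (t, s)) has_derivative (\<lambda>h. frechet_derivative f (at (t, s)) (0, h))) (at s)"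
    by (rule has_derivative_compose[where g=f])
      (auto intro!: derivative_eq_intros smooth_on_has_derivative[OF assms])
  moreover have "frechet_derivative f (at (t, s)) (0, h) = h *\<^sub>R ds f (t, s)" for h
    using linear_scale[OF has_derivative_linear[OF smooth_on_has_derivative[OF assms]], of h "(0,1)"]
    by (simp add: ds_def)
  ultimately show ?thesis
    by (simp add: has_vector_derivative_def has_derivative_at_withinI)
qed

lemma continuous_on_slice:
  assumes "smooth_on (I \<times> UNIV) f" "t \<in> I"
  shows "continuous_on A (\<lambda>s. f (t, s))"
  using assms by (intro continuous_on_compose2[OF smooth_on_continuous_on[OF assms(1)]] continuous_intros) auto

lemma has_vector_derivative_integral:
  fixes f :: "real \<times> real \<Rightarrow> 'a::banach"
  assumes f: "smooth_on (I \<times> UNIV) f" and I: "open I" "convex I" "t \<in> I"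
  shows "((\<lambda>t. integral {a..b} (\<lambda>s. f (t, s))) has_vector_derivative
           integral {a..b} (\<lambda>s. dt f (t, s))) (at t)"
proof -
  have "((\<lambda>t. integral (cbox a b) (\<lambda>s. f (t, s))) has_vector_derivative
           integral (cbox a b) (\<lambda>s. dt f (t, s))) (at t within I)"
    using I smooth_on_continuous_on[OF smooth_on_dt[OF f]]
    by (intro leibniz_rule_vector_derivative[where fx="\<lambda>t s. dt f (t, s)"] has_vector_derivative_dt[OF f]
        integrable_continuous continuous_on_slice[OF f])
      (auto simp: split_beta intro: continuous_on_subset)
  then show ?thesis using I at_within_open by fastforce
qed

text \<open>Symmetry of the mixed derivatives. Integrating \<open>\<partial>\<^sub>s f\<close> in \<open>s\<close> and differentiating under
  the integral expresses \<open>\<partial>\<^sub>t f(t, s) - \<partial>\<^sub>t f(t, a)\<close> as the integral of \<open>\<partial>\<^sub>t \<partial>\<^sub>s f\<close>.\<close>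

lemma dt_ds_commute:
  fixes f :: "real \<times> real \<Rightarrow> 'a::banach"
  assumes f: "smooth_on (I \<times> UNIV) f" and I: "open I" "convex I" "t \<in> I"
  shows "dt (ds f) (t, s) = ds (dt f) (t, s)"
proof -
  define a b where "a = s - 1" and "b = s + 1"
  have ab: "a < s" "s < b" by (auto simp: a_def b_def)
  have FTC: "integral {a..x} (\<lambda>s. ds f (t, s)) = f (t, x) - f (t, a)" if "t \<in> I" "a \<le> x" for t x
    using that by (intro integral_unique fundamental_theorem_of_calculus has_vector_derivative_ds[OF f]) auto
  have *: "integral {a..x} (\<lambda>s. dt (ds f) (t, s)) = dt f (t, x) - dt f (t, a)" if x: "a \<le> x" for x
  proof (rule vector_derivative_unique_at)
    show "((\<lambda>t. integral {a..x} (\<lambda>s. ds f (t, s))) has_vector_derivative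
        integral {a..x} (\<lambda>s. dt (ds f) (t, s))) (at t)"
      by (rule has_vector_derivative_integral[OF smooth_on_ds[OF f] I])
    have "((\<lambda>t. f (t, x) - f (t, a)) has_vector_derivative dt f (t, x) - dt f (t, a)) (at t)"
      using I by (intro derivative_intros has_vector_derivative_dt[OF f]) auto
    then show "((\<lambda>t. integral {a..x} (\<lambda>s. ds f (t, s))) has_vector_derivative
        dt f (t, x) - dt f (t, a)) (at t)"
      by (rule has_vector_derivative_transform_within_open[OF _ I(1,3)]) (simp add: FTC x)
  qed
  have "((\<lambda>x. integral {a..x} (\<lambda>s. dt (ds f) (t, s))) has_vector_derivative dt (ds f) (t, s)) (at s within {a..b})"
    using ab I by (intro integral_has_vector_derivative continuous_on_slice[OF smooth_on_dt[OF smooth_on_ds[OF f]]]) auto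
  then have "((\<lambda>x. dt f (t, x) - dt f (t, a)) has_vector_derivative dt (ds f) (t, s)) (at s within {a..b})"
    by (rule has_vector_derivative_transform[rotated 2]) (use ab * in auto)
  then have "((\<lambda>x. dt f (t, x) - dt f (t, a)) has_vector_derivative dt (ds f) (t, s)) (at s)"
    using ab by (simp add: at_within_Icc_at)
  moreover have "((\<lambda>x. dt f (t, x) - dt f (t, a)) has_vector_derivative ds (dt f) (t, s) - 0) (at s)"
    using I by (intro derivative_intros has_vector_derivative_ds[OF smooth_on_dt[OF f]]) auto
  ultimately show ?thesis using vector_derivative_unique_at by fastforce
qed

section \<open>The moving frame of a solution and its evolution\<close>

text \<open>Two orthonormal vectors and their cross product form a basis: a vector \<open>y\<close> orthogonal to
  all three satisfies \<open>y \<times> (a \<times> b) = 0\<close> by the triple product expansion, so it is also parallel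
  to \<open>a \<times> b\<close>.\<close>

lemma orthonormal_expansion:
  fixes a b x :: "real^3"
  assumes "a \<bullet> a = 1" "b \<bullet> b = 1" "a \<bullet> b = 0"
  shows "x = (x \<bullet> a) *\<^sub>R a + (x \<bullet> b) *\<^sub>R b + (x \<bullet> cross3 a b) *\<^sub>R cross3 a b"
proof -
  define c where "c = cross3 a b"
  have c: "c \<bullet> a = 0" "c \<bullet> b = 0" by (simp_all add: c_def dot_cross_self)
  have "c \<bullet> c = 1"
    using norm_cross_dot[of a b] assms by (simp add: c_def power_mult_distrib dot_square_norm[symmetric])
  define y where "y = x - (x \<bullet> a) *\<^sub>R a - (x \<bullet> b) *\<^sub>R b - (x \<bullet> c) *\<^sub>R c"
  have y: "y \<bullet> a = 0" "y \<bullet> b = 0" "y \<bullet> c = 0"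
    using c \<open>c \<bullet> c = 1\<close> assms inner_commute[of a b] inner_commute[of a c] inner_commute[of b c]
    by (simp_all add: y_def inner_diff_left)
  have "cross3 y c = 0"
    unfolding c_def Lagrange by (simp add: y)
  then have "cross3 c (cross3 y c) = 0" by simp
  then have "y = 0"
    unfolding Lagrange using \<open>c \<bullet> c = 1\<close> y by (simp add: inner_commute)
  then show ?thesis by (simp add: y_def c_def algebra_simps)
qed

lemma orthonormal_cross:
  fixes a b :: "real^3"
  assumes "a \<bullet> a = 1" "b \<bullet> b = 1" "a \<bullet> b = 0"
  shows "cross3 a b \<bullet> cross3 a b = 1"
  using norm_cross_dot[of a b] assms by (simp add: power_mult_distrib dot_square_norm[symmetric])

locale csf =
  fixes I :: "real set" and F :: "real \<Rightarrow> complex \<Rightarrow> real^3"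
  assumes open_I: "open I" and convex_I: "convex I" and flow: "curve_shortening_flow I F"
begin

text \<open>The frame \<open>(pos, tang, nor)\<close> is orthonormal and positively oriented. The orientation is the
  one given by the parametrisation, so \<open>cur\<close> is the geodesic curvature up to a sign. All
  quantities are functions of the pair of time and angle; \<open>spd\<close> is the length element.\<close>

definition pos :: "real \<times> real \<Rightarrow> real^3" where "pos = (\<lambda>(t, s). F t (cis s))"
definition spd :: "real \<times> real \<Rightarrow> real" where "spd x = norm (ds pos x)"
definition tang :: "real \<times> real \<Rightarrow> real^3" where "tang x = ds pos x /\<^sub>R spd x"
definition nor :: "real \<times> real \<Rightarrow> real^3" where "nor x = cross3 (pos x) (tang x)"
definition cur :: "real \<times> real \<Rightarrow> real" where "cur x = (ds tang x \<bullet> nor x) / spd x"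

abbreviation dom :: "(real \<times> real) set" where "dom \<equiv> I \<times> UNIV"

lemma open_dom: "open dom"
  by (simp add: open_I open_Times)

lemma smooth_pos: "smooth_on dom pos"
  using flow by (simp add: curve_shortening_flow_def pos_def)

lemma vector_derivative_ang: "t \<in> I \<Longrightarrow> vector_derivative (ang (F t)) (at s) = ds pos (t, s)"
  using has_vector_derivative_ds[OF smooth_pos, of t s UNIV]
  by (intro vector_derivative_at) (simp add: pos_def)

lemma embedding: "t \<in> I \<Longrightarrow> smooth_embedding (F t)"
  using flow by (simp add: curve_shortening_flow_def)

lemma spd_pos: "x \<in> dom \<Longrightarrow> 0 < spd x"
  using embedding vector_derivative_ang by (fastforce simp: spd_def smooth_embedding_def)

lemma pos_pos: "x \<in> dom \<Longrightarrow> pos x \<bullet> pos x = 1"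
  using embedding[of "fst x"] by (auto simp: pos_def smooth_embedding_def dot_square_norm image_subset_iff)

lemma smooth_spd: "smooth_on dom spd"
proof (rule smooth_on_cong[OF open_dom _ smooth_on_powr[OF open_dom _ smooth_on_inner[OF open_dom
      smooth_on_ds[OF smooth_pos] smooth_on_ds[OF smooth_pos]]]])
  fix x assume "x \<in> dom"
  then have "0 < norm (ds pos x)" using spd_pos spd_def by simp
  then show "0 < ds pos x \<bullet> ds pos x" "(ds pos x \<bullet> ds pos x) powr (1/2) = spd x"
    by (auto simp: spd_def norm_eq_sqrt_inner powr_half_sqrt)
qed

lemma smooth_spd_inverse: "smooth_on dom (\<lambda>x. inverse (spd x))"
  by (rule smooth_on_cong[OF open_dom _ smooth_on_powr[OF open_dom _ smooth_spd, of "-1"]])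
    (auto simp: spd_pos powr_minus less_imp_le abs_of_pos)

lemma smooth_tang: "smooth_on dom tang"
  unfolding tang_def[abs_def]
  by (intro smooth_on_scaleR open_dom smooth_spd_inverse smooth_on_ds smooth_pos)

lemma smooth_nor: "smooth_on dom nor"
  unfolding nor_def[abs_def] by (intro smooth_on_cross open_dom smooth_pos smooth_tang)

lemma smooth_cur: "smooth_on dom cur"
  unfolding cur_def[abs_def] divide_inverse
  by (intro smooth_on_mult smooth_on_inner open_dom smooth_on_ds smooth_nor smooth_tang smooth_spd_inverse)

lemmas smooth = open_dom smooth_pos smooth_spd smooth_spd_inverse smooth_tang smooth_nor smooth_cur
  smooth_on_dt smooth_on_ds smooth_on_inner smooth_on_scaleR smooth_on_mult smooth_on_add smooth_on_diff smooth_on_const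

lemma ds_bilinear:
  assumes "bounded_bilinear h" "smooth_on dom f" "smooth_on dom g" "x \<in> dom"
  shows "ds (\<lambda>x. h (f x) (g x)) x = h (f x) (ds g x) + h (ds f x) (g x)"
  unfolding ds_def by (rule frechet_derivative_bilinear[OF assms])

lemma dt_bilinear:
  assumes "bounded_bilinear h" "smooth_on dom f" "smooth_on dom g" "x \<in> dom"
  shows "dt (\<lambda>x. h (f x) (g x)) x = h (f x) (dt g x) + h (dt f x) (g x)"
  unfolding dt_def by (rule frechet_derivative_bilinear[OF assms])

lemmas ds_inner = ds_bilinear[OF bounded_bilinear_inner]
lemmas dt_inner = dt_bilinear[OF bounded_bilinear_inner]
lemmas ds_scaleR = ds_bilinear[OF bounded_bilinear_scaleR]
lemmas dt_scaleR = dt_bilinear[OF bounded_bilinear_scaleR]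
lemmas ds_mult = ds_bilinear[OF bounded_bilinear_mult]
lemmas dt_mult = dt_bilinear[OF bounded_bilinear_mult]

lemma ds_cong:
  assumes "smooth_on dom f" "x \<in> dom" "\<And>y. y \<in> dom \<Longrightarrow> f y = g y"
  shows "ds g x = ds f x"
  unfolding ds_def by (rule frechet_derivative_cong[OF open_dom assms])

lemma dt_cong:
  assumes "smooth_on dom f" "x \<in> dom" "\<And>y. y \<in> dom \<Longrightarrow> f y = g y"
  shows "dt g x = dt f x"
  unfolding dt_def by (rule frechet_derivative_cong[OF open_dom assms])

lemma derivative_inner_const:
  assumes "smooth_on dom f" "smooth_on dom g" "\<And>y. y \<in> dom \<Longrightarrow> f y \<bullet> g y = c" "x \<in> dom"
  shows "f x \<bullet> ds g x + ds f x \<bullet> g x = 0" "f x \<bullet> dt g x + dt f x \<bullet> g x = 0"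
  using ds_cong[OF smooth_on_const[OF open_dom, of c] assms(4), of "\<lambda>y. f y \<bullet> g y"]
    dt_cong[OF smooth_on_const[OF open_dom, of c] assms(4), of "\<lambda>y. f y \<bullet> g y"]
    ds_inner[OF assms(1,2,4)] dt_inner[OF assms(1,2,4)] assms(3)
  by (auto simp: ds_def dt_def)

lemma ds_pos: "x \<in> dom \<Longrightarrow> ds pos x = spd x *\<^sub>R tang x"
  using spd_pos[of x] by (simp add: tang_def)

lemma tang_tang: "x \<in> dom \<Longrightarrow> tang x \<bullet> tang x = 1"
  using spd_pos[of x] by (simp add: tang_def spd_def dot_square_norm power2_eq_square)

lemma pos_tang: assumes "x \<in> dom" shows "pos x \<bullet> tang x = 0" "tang x \<bullet> pos x = 0"
  using derivative_inner_const(1)[OF smooth_pos smooth_pos pos_pos assms] spd_pos[OF assms]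
  by (auto simp: ds_pos[OF assms] inner_commute)

lemma nor_nor: "x \<in> dom \<Longrightarrow> nor x \<bullet> nor x = 1"
  unfolding nor_def by (intro orthonormal_cross pos_pos tang_tang pos_tang)

lemma nor_pos: "nor x \<bullet> pos x = 0" "pos x \<bullet> nor x = 0"
  and nor_tang: "nor x \<bullet> tang x = 0" "tang x \<bullet> nor x = 0"
  by (simp_all add: nor_def dot_cross_self)

lemmas frame = pos_pos tang_tang nor_nor pos_tang nor_pos nor_tang

lemma expand: "x \<in> dom \<Longrightarrow> w = (w \<bullet> pos x) *\<^sub>R pos x + (w \<bullet> tang x) *\<^sub>R tang x + (w \<bullet> nor x) *\<^sub>R nor x"
  unfolding nor_def by (intro orthonormal_expansion pos_pos tang_tang pos_tang)

text \<open>The Frenet equations: derivatives of unit vectors are found from the derivatives of the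
  constant inner products between the vectors of the frame.\<close>

lemma ds_tang:
  assumes x: "x \<in> dom"
  shows "ds tang x = spd x *\<^sub>R (cur x *\<^sub>R nor x - pos x)"
proof -
  have "ds tang x \<bullet> pos x = - spd x"
    using derivative_inner_const(1)[OF smooth_tang smooth_pos pos_tang(2) x] by (simp add: ds_pos x frame)
  moreover have "ds tang x \<bullet> tang x = 0"
    using derivative_inner_const(1)[OF smooth_tang smooth_tang tang_tang x] by (simp add: inner_commute)
  moreover have "ds tang x \<bullet> nor x = spd x * cur x"
    using spd_pos[OF x] by (simp add: cur_def)
  ultimately show ?thesis
    by (subst expand[OF x, of "ds tang x"]) (simp add: algebra_simps)
qed

lemma ds_nor:
  assumes x: "x \<in> dom"
  shows "ds nor x = - (spd x * cur x) *\<^sub>R tang x"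
proof -
  have "ds nor x \<bullet> pos x = 0"
    using derivative_inner_const(1)[OF smooth_nor smooth_pos nor_pos(1) x] by (simp add: ds_pos x frame)
  moreover have "ds nor x \<bullet> nor x = 0"
    using derivative_inner_const(1)[OF smooth_nor smooth_nor nor_nor x] by (simp add: inner_commute)
  moreover have "ds nor x \<bullet> tang x = - (spd x * cur x)"
    using derivative_inner_const(1)[OF smooth_nor smooth_tang nor_tang(1) x]
    by (simp add: ds_tang x inner_diff_right frame)
  ultimately show ?thesis
    by (subst expand[OF x, of "ds nor x"]) simp
qed

lemma curvature_vector_frame:
  assumes t: "t \<in> I"
  shows "curvature_vector (ang (F t)) s = cur (t, s) *\<^sub>R nor (t, s)"
proof -
  have "unit_tangent (ang (F t)) = (\<lambda>s. tang (t, s))"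
    using t by (auto simp: unit_tangent_def vector_derivative_ang tang_def spd_def)
  moreover have "vector_derivative (\<lambda>s. tang (t, s)) (at s) = spd (t, s) *\<^sub>R (cur (t, s) *\<^sub>R nor (t, s) - pos (t, s))"
    using vector_derivative_at[OF has_vector_derivative_ds[OF smooth_tang, of t s UNIV]] t
    by (simp add: ds_tang)
  ultimately have "cov_deriv (ang (F t)) (unit_tangent (ang (F t))) s = spd (t, s) *\<^sub>R cur (t, s) *\<^sub>R nor (t, s)"
    using t frame(1)[of "(t, s)"] nor_pos(2)[of "(t, s)"]
    by (simp add: cov_deriv_def inner_diff_right pos_def scaleR_diff_right)
  then show ?thesis
    using t spd_pos[of "(t, s)"] by (simp add: curvature_vector_def vector_derivative_ang flip: spd_def)
qed

lemma dt_pos: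
  assumes "x \<in> dom"
  shows "dt pos x = cur x *\<^sub>R nor x"
proof -
  obtain t s where x: "x = (t, s)" "t \<in> I" using assms by auto
  have "((\<lambda>t. pos (t, s)) has_vector_derivative cur (t, s) *\<^sub>R nor (t, s)) (at t)"
    using flow x(2) unfolding curvature_vector_frame[OF x(2), symmetric]
    by (auto simp: curve_shortening_flow_def pos_def)
  with has_vector_derivative_dt[OF smooth_pos, of t s UNIV] x show ?thesis
    by (auto intro: vector_derivative_unique_at)
qed

lemma dt_ds: "smooth_on dom f \<Longrightarrow> x \<in> dom \<Longrightarrow> dt (ds f) x = ds (dt f) (x :: real \<times> real)"
  for f :: "_ \<Rightarrow> 'a::banach"
  using dt_ds_commute[OF _ open_I convex_I] by (cases x) auto

text \<open>Comparing \<open>\<partial>\<^sub>t \<partial>\<^sub>s pos = \<partial>\<^sub>t (spd tang)\<close> with \<open>\<partial>\<^sub>s \<partial>\<^sub>t pos = \<partial>\<^sub>s (cur nor)\<close>, the tangential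
  component gives the evolution of the length element and the normal one that of the tangent.\<close>

lemma
  assumes x: "x \<in> dom"
  shows dt_spd: "dt spd x = - (cur x)\<^sup>2 * spd x"
    and dt_tang: "dt tang x = (ds cur x / spd x) *\<^sub>R nor x"
proof -
  have "dt (ds pos) x = dt (\<lambda>x. spd x *\<^sub>R tang x) x"
    by (rule dt_cong[OF _ x]) (auto intro!: smooth simp: ds_pos)
  also have "\<dots> = spd x *\<^sub>R dt tang x + dt spd x *\<^sub>R tang x"
    by (rule dt_scaleR[OF smooth_spd smooth_tang x])
  finally have 1: "dt (ds pos) x = spd x *\<^sub>R dt tang x + dt spd x *\<^sub>R tang x" .
  have "ds (dt pos) x = ds (\<lambda>x. cur x *\<^sub>R nor x) x"
    by (rule ds_cong[OF _ x]) (auto intro!: smooth simp: dt_pos)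
  also have "\<dots> = cur x *\<^sub>R ds nor x + ds cur x *\<^sub>R nor x"
    by (rule ds_scaleR[OF smooth_cur smooth_nor x])
  finally have eq: "spd x *\<^sub>R dt tang x + dt spd x *\<^sub>R tang x
      = - (cur x * (spd x * cur x)) *\<^sub>R tang x + ds cur x *\<^sub>R nor x"
    using 1 dt_ds[OF smooth_pos x] by (simp add: ds_nor x)
  have t0: "dt tang x \<bullet> tang x = 0"
    using derivative_inner_const(2)[OF smooth_tang smooth_tang tang_tang x] by (simp add: inner_commute)
  have p0: "dt tang x \<bullet> pos x = 0"
    using derivative_inner_const(2)[OF smooth_tang smooth_pos pos_tang(2) x] by (simp add: dt_pos x frame)
  show "dt spd x = - (cur x)\<^sup>2 * spd x"
    using arg_cong[OF eq, of "\<lambda>w. w \<bullet> tang x"] t0 x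
    by (simp add: inner_add_left frame power2_eq_square algebra_simps)
  have "dt tang x \<bullet> nor x = ds cur x / spd x"
    using arg_cong[OF eq, of "\<lambda>w. w \<bullet> nor x"] x spd_pos[OF x]
    by (simp add: inner_add_left inner_diff_left frame field_simps)
  then show "dt tang x = (ds cur x / spd x) *\<^sub>R nor x"
    by (subst expand[OF x, of "dt tang x"]) (simp add: t0 p0)
qed

lemma dt_nor:
  assumes x: "x \<in> dom"
  shows "dt nor x = - cur x *\<^sub>R pos x - (ds cur x / spd x) *\<^sub>R tang x"
proof -
  have "dt nor x \<bullet> pos x = - cur x"
    using derivative_inner_const(2)[OF smooth_nor smooth_pos nor_pos(1) x] by (simp add: dt_pos x frame)
  moreover have "dt nor x \<bullet> nor x = 0"
    using derivative_inner_const(2)[OF smooth_nor smooth_nor nor_nor x] by (simp add: inner_commute)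
  moreover have "dt nor x \<bullet> tang x = - (ds cur x / spd x)"
    using derivative_inner_const(2)[OF smooth_nor smooth_tang nor_tang(1) x] by (simp add: dt_tang x frame)
  ultimately show ?thesis
    by (subst expand[OF x, of "dt nor x"]) simp
qed

text \<open>The derivative of the curvature with respect to arc length.\<close>

definition curs :: "real \<times> real \<Rightarrow> real" where "curs x = ds cur x * inverse (spd x)"

lemma smooth_curs: "smooth_on dom curs"
  unfolding curs_def[abs_def] by (intro smooth)

text \<open>The tangential component of \<open>\<partial>\<^sub>t \<partial>\<^sub>s nor = \<partial>\<^sub>s \<partial>\<^sub>t nor\<close>. For the curvature measure
  \<open>\<kappa> ds\<close> the reaction terms of the curvature equation \<open>\<kappa>\<^sub>t = \<kappa>\<^sub>s\<^sub>s + \<kappa>\<^sup>3 + \<kappa>\<close> collapse to a linear one,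
  since the cubic term compensates the shrinking of \<open>ds\<close>.\<close>

lemma dt_spd_cur:
  assumes x: "x \<in> dom"
  shows "dt (\<lambda>x. spd x * cur x) x = spd x * cur x + ds curs x"
proof -
  have s1: "smooth_on dom (\<lambda>x. - 1 *\<^sub>R ((spd x * cur x) *\<^sub>R tang x))"
    and s2: "smooth_on dom (\<lambda>x. - 1 *\<^sub>R (cur x *\<^sub>R pos x + curs x *\<^sub>R tang x))"
    by (intro smooth smooth_curs)+
  have "dt (ds nor) x = dt (\<lambda>x. - 1 *\<^sub>R ((spd x * cur x) *\<^sub>R tang x)) x"
    by (rule dt_cong[OF s1 x]) (simp add: ds_nor)
  also have "\<dots> = - 1 *\<^sub>R dt (\<lambda>x. (spd x * cur x) *\<^sub>R tang x) x"
    by (subst dt_scaleR[OF _ _ x]) (auto intro!: smooth simp: dt_def)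
  also have "dt (\<lambda>x. (spd x * cur x) *\<^sub>R tang x) x
      = (spd x * cur x) *\<^sub>R dt tang x + dt (\<lambda>x. spd x * cur x) x *\<^sub>R tang x"
    by (subst dt_scaleR[OF _ _ x]) (auto intro!: smooth)
  finally have 1: "dt (ds nor) x \<bullet> tang x = - dt (\<lambda>x. spd x * cur x) x"
    using x spd_pos[OF x] by (simp add: dt_tang frame inner_add_left inner_diff_left)
  have "ds (dt nor) x = ds (\<lambda>x. - 1 *\<^sub>R (cur x *\<^sub>R pos x + curs x *\<^sub>R tang x)) x"
    by (rule ds_cong[OF s2 x]) (simp add: dt_nor curs_def divide_inverse)
  also have "\<dots> = - 1 *\<^sub>R ds (\<lambda>x. cur x *\<^sub>R pos x + curs x *\<^sub>R tang x) x"
    by (subst ds_scaleR[OF _ _ x]) (auto intro!: smooth smooth_curs simp: ds_def)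
  also have "ds (\<lambda>x. cur x *\<^sub>R pos x + curs x *\<^sub>R tang x) x
      = ds (\<lambda>x. cur x *\<^sub>R pos x) x + ds (\<lambda>x. curs x *\<^sub>R tang x) x"
    unfolding ds_def using x
    by (intro frechet_derivative_eq has_derivative_add smooth_on_has_derivative[where S=dom])
      (auto intro!: smooth smooth_curs)
  also have "ds (\<lambda>x. cur x *\<^sub>R pos x) x = cur x *\<^sub>R ds pos x + ds cur x *\<^sub>R pos x"
    by (rule ds_scaleR[OF smooth_cur smooth_pos x])
  also have "ds (\<lambda>x. curs x *\<^sub>R tang x) x = curs x *\<^sub>R ds tang x + ds curs x *\<^sub>R tang x"
    by (rule ds_scaleR[OF smooth_curs smooth_tang x])
  finally have "ds (dt nor) x \<bullet> tang x = - 1 *\<^sub>R (cur x *\<^sub>R ds pos x + ds cur x *\<^sub>R pos x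
      + (curs x *\<^sub>R ds tang x + ds curs x *\<^sub>R tang x)) \<bullet> tang x" by simp
  then have "ds (dt nor) x \<bullet> tang x = - (spd x * cur x + ds curs x)"
    using x by (simp add: ds_pos ds_tang frame inner_add_left inner_diff_left)
  then show ?thesis using 1 dt_ds[OF smooth_nor x] by simp
qed

lemma dt_spd_cur2:
  assumes x: "x \<in> dom"
  shows "dt (\<lambda>x. spd x * (cur x)\<^sup>2) x = 2 * spd x * (cur x)\<^sup>2 + 2 * cur x * ds curs x + spd x * cur x ^ 4"
proof -
  have 1: "dt (\<lambda>x. spd x * (cur x)\<^sup>2) x = (spd x * cur x) * dt cur x + (spd x * cur x + ds curs x) * cur x"
    using dt_mult[OF smooth_on_mult[OF open_dom smooth_spd smooth_cur] smooth_cur x] dt_spd_cur[OF x]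
    by (simp add: power2_eq_square mult.assoc)
  have "spd x * dt cur x - (cur x)\<^sup>2 * spd x * cur x = spd x * cur x + ds curs x"
    using dt_mult[OF smooth_spd smooth_cur x] dt_spd_cur[OF x] by (simp add: dt_spd x)
  then have "spd x * dt cur x = (cur x)\<^sup>2 * spd x * cur x + spd x * cur x + ds curs x" by simp
  then have "spd x * cur x * dt cur x = cur x * ((cur x)\<^sup>2 * spd x * cur x + spd x * cur x + ds curs x)"
    by (metis mult.commute mult.left_commute)
  with 1 show ?thesis
    by (simp add: power2_eq_square power4_eq_xxxx algebra_simps)
qed

end

section \<open>Integral inequalities for a weighted interval\<close>

text \<open>The bounds \<open>2 x \<le> r D + L / r\<close> for all \<open>r\<close> are equivalent to \<open>x\<^sup>2 \<le> L D\<close>; the best choice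
  is \<open>r = sqrt (L / D)\<close>.\<close>

lemma Cauchy_Schwarz_AMGM:
  assumes "0 \<le> x" "0 < L" "0 \<le> D" "\<And>r. 0 < r \<Longrightarrow> 2 * x \<le> r * D + L / r"
  shows "x\<^sup>2 \<le> L * (D::real)"
proof (cases "D = 0")
  case False
  then have D: "0 < D" using assms by simp
  have "sqrt L / sqrt D * D = sqrt L * sqrt D" "L / (sqrt L / sqrt D) = sqrt L * sqrt D"
    using D assms(2) by (simp_all add: field_simps)
  then have "x \<le> sqrt L * sqrt D"
    using assms(4)[of "sqrt L / sqrt D"] D assms(2) by (simp add: mult.commute)
  then have "x\<^sup>2 \<le> (sqrt L * sqrt D)\<^sup>2" using assms(1) by (intro power_mono)
  then show ?thesis using D assms(2) by (simp add: power_mult_distrib)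
next
  case True
  have "x = 0"
  proof (rule ccontr)
    assume "x \<noteq> 0"
    then have "0 < x" using assms by simp
    then show False using assms(4)[of "L / x"] assms(2) True by simp
  qed
  then show ?thesis using True by simp
qed

text \<open>A function \<open>k\<close> on an interval with density \<open>v\<close>, total mass \<open>L\<close> and mean \<open>m\<close>. Keeping the
  density makes it unnecessary to reparametrise curves by arc length.\<close>

locale weighted_interval =
  fixes a b :: real and v k :: "real \<Rightarrow> real" and L m :: real
  assumes ab: "a < b" and v_cont: "continuous_on {a..b} v" and v_pos: "\<And>s. s \<in> {a..b} \<Longrightarrow> 0 < v s"
    and k_cont: "continuous_on {a..b} k"
  defines "L \<equiv> integral {a..b} v" and "m \<equiv> integral {a..b} (\<lambda>s. v s * k s) / L"
begin

lemma L_pos: "0 < L"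
  unfolding L_def using integral_less_real[of a b "\<lambda>_. 0" v] v_cont v_pos ab by (simp add: less_eq_real_def)

lemma integrable: "continuous_on {a..b} f \<Longrightarrow> (\<lambda>s. f s :: real) integrable_on {a..b}"
  by (rule integrable_continuous_real)

lemma mean: "integral {a..b} (\<lambda>s. v s * k s) = L * m"
  using L_pos by (simp add: m_def)

lemma variance:
  "integral {a..b} (\<lambda>s. v s * (k s - c)\<^sup>2) = integral {a..b} (\<lambda>s. v s * (k s)\<^sup>2) - 2 * c * L * m + c\<^sup>2 * L"
proof -
  have "integral {a..b} (\<lambda>s. v s * (k s - c)\<^sup>2)
      = integral {a..b} (\<lambda>s. v s * (k s)\<^sup>2 - (2 * c) * (v s * k s) + c\<^sup>2 * v s)"
    by (intro arg_cong[where f="integral _"] ext) (simp add: power2_eq_square algebra_simps)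
  also have "\<dots> = integral {a..b} (\<lambda>s. v s * (k s)\<^sup>2 - (2 * c) * (v s * k s)) + integral {a..b} (\<lambda>s. c\<^sup>2 * v s)"
    by (intro Henstock_Kurzweil_Integration.integral_add integrable continuous_intros v_cont k_cont)
  also have "integral {a..b} (\<lambda>s. v s * (k s)\<^sup>2 - (2 * c) * (v s * k s))
      = integral {a..b} (\<lambda>s. v s * (k s)\<^sup>2) - integral {a..b} (\<lambda>s. (2 * c) * (v s * k s))"
    by (intro Henstock_Kurzweil_Integration.integral_diff integrable continuous_intros v_cont k_cont)
  finally show ?thesis by (simp add: mean flip: L_def)
qed

lemma variance_mean:
  "L * integral {a..b} (\<lambda>s. v s * (k s - m)\<^sup>2)
    = L * integral {a..b} (\<lambda>s. v s * (k s)\<^sup>2) - (integral {a..b} (\<lambda>s. v s * k s))\<^sup>2"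
  unfolding variance mean by (simp add: power2_eq_square algebra_simps)

lemma variance_nonneg:
  "0 \<le> L * integral {a..b} (\<lambda>s. v s * (k s)\<^sup>2) - (integral {a..b} (\<lambda>s. v s * k s))\<^sup>2"
  unfolding variance_mean[symmetric] using L_pos v_pos
  by (intro mult_nonneg_nonneg integral_nonneg integrable continuous_intros v_cont k_cont) (auto simp: less_imp_le)

text \<open>The left hand side is \<open>L\<close> times the integral of \<open>(k\<^sup>2 - mean of k\<^sup>2)\<^sup>2\<close>. The mean minimises
  the squared distance, so replacing it by \<open>m\<^sup>2\<close> only increases the integral, and
  \<open>k\<^sup>2 - m\<^sup>2 = (k + m) (k - m)\<close>.\<close>

lemma variance_square_le:
  assumes "\<And>s. s \<in> {a..b} \<Longrightarrow> (k s + m)\<^sup>2 \<le> C"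
  shows "L * integral {a..b} (\<lambda>s. v s * k s ^ 4) - (integral {a..b} (\<lambda>s. v s * (k s)\<^sup>2))\<^sup>2
    \<le> C * (L * integral {a..b} (\<lambda>s. v s * (k s)\<^sup>2) - (integral {a..b} (\<lambda>s. v s * k s))\<^sup>2)"
proof -
  define B where "B = integral {a..b} (\<lambda>s. v s * (k s)\<^sup>2)"
  interpret sq: weighted_interval a b v "\<lambda>s. (k s)\<^sup>2" L "B / L"
    by unfold_locales (auto intro!: continuous_intros v_cont v_pos k_cont ab simp: L_def B_def)
  have "L * integral {a..b} (\<lambda>s. v s * k s ^ 4) - B\<^sup>2 \<le> L * integral {a..b} (\<lambda>s. v s * ((k s)\<^sup>2 - m\<^sup>2)\<^sup>2)"
  proof -
    have "L * integral {a..b} (\<lambda>s. v s * ((k s)\<^sup>2 - m\<^sup>2)\<^sup>2) - (L * integral {a..b} (\<lambda>s. v s * k s ^ 4) - B\<^sup>2)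
      = (B - m\<^sup>2 * L)\<^sup>2"
      using L_pos unfolding sq.variance B_def[symmetric] by (simp add: power2_eq_square power4_eq_xxxx algebra_simps)
    then show ?thesis by (smt (verit) zero_le_power2)
  qed
  also have "integral {a..b} (\<lambda>s. v s * ((k s)\<^sup>2 - m\<^sup>2)\<^sup>2) \<le> integral {a..b} (\<lambda>s. C * (v s * (k s - m)\<^sup>2))"
  proof (rule integral_le)
    fix s assume s: "s \<in> {a..b}"
    have "((k s)\<^sup>2 - m\<^sup>2)\<^sup>2 = (k s + m)\<^sup>2 * (k s - m)\<^sup>2"
      by (simp add: power2_eq_square algebra_simps)
    also have "\<dots> \<le> C * (k s - m)\<^sup>2" using assms[OF s] by (intro mult_right_mono) auto
    finally show "v s * ((k s)\<^sup>2 - m\<^sup>2)\<^sup>2 \<le> C * (v s * (k s - m)\<^sup>2)"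
      using mult_left_mono[OF _ less_imp_le[OF v_pos[OF s]], of _ "C * (k s - m)\<^sup>2"]
      by (simp add: mult.left_commute)
  qed (intro integrable continuous_intros v_cont k_cont)+
  finally show ?thesis
    using L_pos variance_mean by (simp add: B_def mult.left_commute)
qed

end

locale weighted_interval_C1 = weighted_interval +
  fixes k' :: "real \<Rightarrow> real"
  assumes k_der: "\<And>s. (k has_real_derivative k' s) (at s)"
    and k'_cont: "continuous_on {a..b} k'"
begin

lemma attains_mean: "\<exists>s\<in>{a..b}. k s = m"
proof (rule ccontr)
  assume "\<not> ?thesis"
  then have ne: "\<forall>s\<in>{a..b}. k s \<noteq> m" by blast
  have zero: "integral {a..b} (\<lambda>s. v s * (k s - m)) = 0"
  proof -
    have "integral {a..b} (\<lambda>s. v s * (k s - m)) = integral {a..b} (\<lambda>s. v s * k s - m * v s)"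
      by (simp add: algebra_simps)
    also have "\<dots> = integral {a..b} (\<lambda>s. v s * k s) - integral {a..b} (\<lambda>s. m * v s)"
      by (intro Henstock_Kurzweil_Integration.integral_diff integrable continuous_intros v_cont k_cont)
    finally show ?thesis by (simp add: mean flip: L_def)
  qed
  have cont: "continuous_on {a..b} (\<lambda>s. v s * (k s - m))"
    by (intro continuous_intros v_cont k_cont)
  have "(\<forall>s\<in>{a..b}. m < k s) \<or> (\<forall>s\<in>{a..b}. k s < m)"
  proof (rule ccontr)
    assume "\<not> ?thesis"
    then obtain x y where xy: "x \<in> {a..b}" "y \<in> {a..b}" "k x \<le> m" "m \<le> k y"
      by (meson linorder_not_less)
    have "connected (k ` {a..b})" by (intro connected_continuous_image k_cont) simp
    then have "m \<in> k ` {a..b}" using xy by (auto simp: connected_iff_interval)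
    then show False using ne by auto
  qed
  then show False
  proof
    assume "\<forall>s\<in>{a..b}. m < k s"
    then have "0 < integral {a..b} (\<lambda>s. v s * (k s - m))"
      using integral_less_real[of a b "\<lambda>_. 0" "\<lambda>s. v s * (k s - m)"] ab v_pos cont
      by auto
    then show False using zero by simp
  next
    assume "\<forall>s\<in>{a..b}. k s < m"
    then have "integral {a..b} (\<lambda>s. v s * (k s - m)) < 0"
      using integral_less_real[of a b "\<lambda>s. v s * (k s - m)" "\<lambda>_. 0"] ab v_pos cont
      by (auto simp: mult_less_0_iff)
    then show False using zero by simp
  qed
qed

lemma v_inverse_cont: "continuous_on {a..b} (\<lambda>s. inverse (v s))"
  using v_pos by (intro continuous_on_inverse v_cont) force

abbreviation energy :: real where "energy \<equiv> integral {a..b} (\<lambda>s. (k' s)\<^sup>2 * inverse (v s))"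

lemma energy_nonneg: "0 \<le> energy"
  using v_pos by (intro integral_nonneg integrable continuous_intros v_inverse_cont k'_cont) (auto simp: less_imp_le)

text \<open>As \<open>k\<close> attains its mean, \<open>\<bar>k - m\<bar>\<close> is at most the integral of
  \<open>\<bar>k'\<bar> = (\<bar>k'\<bar> / sqrt v) sqrt v\<close>, to which the Cauchy-Schwarz inequality applies.\<close>

lemma oscillation_le:
  assumes s: "s \<in> {a..b}"
  shows "(k s - m)\<^sup>2 \<le> L * energy"
proof -
  obtain r where r: "r \<in> {a..b}" "k r = m" using attains_mean by blast
  have "2 * \<bar>k s - m\<bar> \<le> q * energy + L / q" if q: "0 < q" for q
  proof -
    define h where "h s = q * ((k' s)\<^sup>2 * inverse (v s)) + v s / q" for s
    have h_cont: "continuous_on {a..b} h"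
      unfolding h_def using q by (intro continuous_intros v_cont k'_cont v_inverse_cont) auto
    have le: "norm (2 * k' s) \<le> h s" if "s \<in> {a..b}" for s
    proof -
      have "0 \<le> (q * \<bar>k' s\<bar> - v s)\<^sup>2 / (q * v s)" using q v_pos[OF that] by auto
      also have "\<dots> = h s - 2 * \<bar>k' s\<bar>"
        using q v_pos[OF that] by (simp add: h_def field_simps power2_eq_square)
      finally show ?thesis by (simp add: abs_mult)
    qed
    have *: "2 * \<bar>k y - k x\<bar> \<le> integral {a..b} h" if xy: "x \<in> {a..b}" "y \<in> {a..b}" "x \<le> y" for x y
    proof -
      have sub: "{x..y} \<subseteq> {a..b}" using xy by auto
      have "((\<lambda>s. 2 * k' s) has_integral 2 * k y - 2 * k x) {x..y}"
        using k_der xy by (intro fundamental_theorem_of_calculus)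
          (auto intro!: derivative_eq_intros has_field_derivative_at_within[OF k_der]
            simp: has_real_derivative_iff_has_vector_derivative[symmetric])
      then have "2 * \<bar>k y - k x\<bar> = norm (integral {x..y} (\<lambda>s. 2 * k' s))"
        by (subst integral_unique) (auto simp: abs_if)
      also have "\<dots> \<le> integral {x..y} h"
        using sub le by (intro integral_norm_bound_integral integrable_continuous_real
            continuous_on_subset[OF h_cont] continuous_intros continuous_on_subset[OF k'_cont]) auto
      also have "\<dots> \<le> integral {a..b} h"
        using sub le norm_ge_zero order_trans
        by (intro integral_subset_le integrable_continuous_real continuous_on_subset[OF h_cont]) blast+
      finally show ?thesis .
    qed
    have "2 * \<bar>k s - m\<bar> \<le> integral {a..b} h"
      using *[of s r] *[of r s] s r by (cases "s \<le> r") (auto simp: abs_minus_commute)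
    also have "integral {a..b} h = q * energy + L / q"
      unfolding h_def L_def using q
      by (subst Henstock_Kurzweil_Integration.integral_add)
        (auto intro!: integrable continuous_intros v_cont k'_cont v_inverse_cont)
    finally show ?thesis .
  qed
  then show ?thesis
    using Cauchy_Schwarz_AMGM[of "\<bar>k s - m\<bar>" L energy] L_pos energy_nonneg by simp
qed

text \<open>Near \<open>x\<close> the function is \<open>(f - f x) / g\<close>, which has a limit, times \<open>(f - f x) h\<close>, which
  tends to \<open>0\<close>; and \<open>0\<close> is its value at \<open>x\<close>.\<close>

lemma continuous_within_square_over_zero:
  fixes f g h :: "real \<Rightarrow> real"
  assumes "(f has_real_derivative f') (at x within A)" "(g has_real_derivative g') (at x within A)"
    and "g' \<noteq> 0" "g x = 0" "continuous (at x within A) h"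
  shows "continuous (at x within A) (\<lambda>u. (f u - f x)\<^sup>2 * (h u / g u))"
proof -
  have "((\<lambda>u. (f u - f x) / (u - x)) \<longlongrightarrow> f') (at x within A)" "((\<lambda>u. g u / (u - x)) \<longlongrightarrow> g') (at x within A)"
    using assms(1,2,4) by (simp_all add: has_field_derivative_iff)
  note quotients = this
  have diff: "((\<lambda>u. f u - f x) \<longlongrightarrow> f x - f x) (at x within A)"
    using DERIV_continuous[OF assms(1)] by (intro tendsto_intros) (simp add: continuous_within)
  have "(h \<longlongrightarrow> h x) (at x within A)"
    using assms(5) by (simp add: continuous_within)
  then have "((\<lambda>u. ((f u - f x) / (u - x)) / (g u / (u - x)) * (f u - f x) * h u)
      \<longlongrightarrow> f' / g' * (f x - f x) * h x) (at x within A)"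
    by (intro tendsto_mult tendsto_divide quotients diff assms(3))
  moreover have "\<forall>\<^sub>F u in at x within A. ((f u - f x) / (u - x)) / (g u / (u - x)) * (f u - f x) * h u
      = (f u - f x)\<^sup>2 * (h u / g u)"
    by (auto simp: eventually_at_filter power2_eq_square)
  ultimately have "((\<lambda>u. (f u - f x)\<^sup>2 * (h u / g u)) \<longlongrightarrow> f' / g' * (f x - f x) * h x) (at x within A)"
    by (rule Lim_transform_eventually)
  then show ?thesis by (simp add: continuous_within)
qed

text \<open>Measure arc length by an angle \<open>\<sigma>\<close> that runs from \<open>0\<close> to \<open>2\<pi>\<close>, with \<open>q = \<sigma>'\<close>. For a constant
  \<open>c\<close> and a phase \<open>y\<close>,
  \<open>k'\<^sup>2 / q - (k - c)\<^sup>2 q - ((k - c)\<^sup>2 cot (\<sigma> - y))' = (k' - (k - c) q cot (\<sigma> - y))\<^sup>2 / q \<ge> 0\<close>.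
  The exact derivative integrates to \<open>0\<close> by periodicity, provided that \<open>k = c\<close> at the poles of the
  cotangent. There are two poles, half a period apart, so \<open>y\<close> must be chosen such that \<open>k\<close> takes
  the same value \<open>c\<close> at both. Finally, the mean \<open>m\<close> does at least as well as \<open>c\<close>.\<close>

lemma Wirtinger:
  assumes per: "k a = k b"
  shows "(2 * pi / L)\<^sup>2 * integral {a..b} (\<lambda>s. v s * (k s - m)\<^sup>2) \<le> energy"
proof -
  define \<sigma> where "\<sigma> u = 2 * pi / L * integral {a..u} v" for u
  define q where "q u = 2 * pi / L * v u" for u
  have q_pos: "0 < q u" if "u \<in> {a..b}" for u using v_pos[OF that] L_pos by (simp add: q_def)
  have \<sigma>_der: "(\<sigma> has_real_derivative q u) (at u within {a..b})" if "u \<in> {a..b}" for u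
    unfolding \<sigma>_def q_def
    using integral_has_real_derivative[OF v_cont that] L_pos by (auto intro!: derivative_eq_intros)
  have \<sigma>_der': "(\<sigma> has_real_derivative q u) (at u)" if "u \<in> {a<..<b}" for u
    using \<sigma>_der[of u] that by (simp add: at_within_Icc_at)
  have \<sigma>_cont: "continuous_on {a..b} \<sigma>"
    using DERIV_continuous[OF \<sigma>_der] by (simp add: continuous_on_eq_continuous_within)
  have \<sigma>_mono: "\<sigma> x < \<sigma> y" if xy: "a \<le> x" "x < y" "y \<le> b" for x y
  proof (rule DERIV_pos_imp_increasing_open[OF xy(2)])
    show "\<exists>d. (\<sigma> has_real_derivative d) (at u) \<and> 0 < d" if "x < u" "u < y" for u
      using \<sigma>_der'[of u] q_pos[of u] that xy by auto
    show "continuous_on {x..y} \<sigma>" using xy by (auto intro: continuous_on_subset[OF \<sigma>_cont])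
  qed
  have \<sigma>_ab: "\<sigma> a = 0" "\<sigma> b = 2 * pi"
    using L_pos by (auto simp: \<sigma>_def L_def)
  have inj: "inj_on \<sigma> {a..b}"
    by (rule linorder_inj_onI) (use \<sigma>_mono in force)+
  have img: "\<sigma> ` {a..b} = {0..2*pi}"
  proof
    show "\<sigma> ` {a..b} \<subseteq> {0..2*pi}"
      using \<sigma>_mono[of a] \<sigma>_mono[of _ b] \<sigma>_ab by (force simp: le_less)
    show "{0..2*pi} \<subseteq> \<sigma> ` {a..b}"
      using IVT'[of \<sigma> a _ b] \<sigma>_ab \<sigma>_cont ab by (force simp: image_iff)
  qed
  define \<psi> where "\<psi> = inv_into {a..b} \<sigma>"
  have \<psi>: "\<psi> (\<sigma> u) = u" if "u \<in> {a..b}" for u using inj that by (simp add: \<psi>_def)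
  have \<psi>_cont: "continuous_on {0..2*pi} \<psi>"
    using continuous_on_inv[OF \<sigma>_cont compact_Icc, of \<psi>] \<psi> img by simp
  have \<psi>_in: "\<psi> y \<in> {a..b}" if "y \<in> {0..2*pi}" for y
    using that img inv_into_into[of y \<sigma> "{a..b}"] by (simp add: \<psi>_def)
  have \<psi>_ab: "\<psi> 0 = a" "\<psi> (2 * pi) = b" using \<psi>[of a] \<psi>[of b] \<sigma>_ab ab by auto
  \<comment> \<open>The difference \<open>H\<close> below changes sign between \<open>y = 0\<close> and \<open>y = \<pi>\<close>.\<close>
  obtain y where y: "0 \<le> y" "y \<le> pi" "k (\<psi> y) = k (\<psi> (y + pi))"
  proof -
    define H where "H y = k (\<psi> y) - k (\<psi> (y + pi))" for y
    have "continuous_on {0..pi} (\<lambda>y. k (\<psi> y))" "continuous_on {0..pi} (\<lambda>y. k (\<psi> (y + pi)))"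
      by (intro continuous_on_compose2[OF k_cont] continuous_on_compose2[OF \<psi>_cont] continuous_intros;
          use \<psi>_in in force)+
    then have "continuous_on {0..pi} H" unfolding H_def by (intro continuous_intros)
    then have "connected (H ` {0..pi})" by (intro connected_continuous_image) auto
    moreover have "H pi = - H 0" using \<psi>_ab per by (simp add: H_def)
    then have "H 0 \<le> 0 \<and> 0 \<le> H pi \<or> H pi \<le> 0 \<and> 0 \<le> H 0" by linarith
    moreover have "H 0 \<in> H ` {0..pi}" "H pi \<in> H ` {0..pi}" by auto
    ultimately have "0 \<in> H ` {0..pi}" unfolding connected_iff_interval by blast
    then show thesis using that by (auto simp: H_def)
  qed
  define c where "c = k (\<psi> y)"
  have zero: "k u = c \<and> u \<in> \<psi> ` {y - pi, y, y + pi, y + 2 * pi}"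
    if u: "u \<in> {a..b}" and sin0: "sin (\<sigma> u - y) = 0" for u
  proof -
    obtain i :: int where i: "\<sigma> u - y = of_int i * pi" using sin0 by (auto simp: sin_zero_iff_int2)
    have u2: "0 \<le> \<sigma> u" "\<sigma> u \<le> 2 * pi" using img u by auto
    then have "-1 * pi \<le> of_int i * pi" "of_int i * pi \<le> 2 * pi" using i y by linarith+
    then have "-1 \<le> (of_int i :: real)" "of_int i \<le> (2 :: real)" by (simp_all only: mult_le_cancel_right_pos pi_gt_zero)
    then have "i \<in> {-1, 0, 1, 2}" by auto
    moreover have "k u = c \<and> u \<in> \<psi> ` {y - pi, y, y + pi, y + 2 * pi}" if "i = -1"
    proof -
      have "y = pi" "\<sigma> u = 0" using i y u2 that by auto
      then have "u = a" using \<psi>[OF u] \<psi>_ab by simp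
      then show ?thesis using \<open>y = pi\<close> y(3) per \<psi>_ab by (auto simp: c_def)
    qed
    moreover have "k u = c \<and> u \<in> \<psi> ` {y - pi, y, y + pi, y + 2 * pi}" if "i = 2"
    proof -
      have "y = 0" "\<sigma> u = 2 * pi" using i y u2 that by auto
      then have "u = b" using \<psi>[OF u] \<psi>_ab by simp
      then show ?thesis using \<open>y = 0\<close> per \<psi>_ab by (auto simp: c_def)
    qed
    moreover have "k u = c \<and> u \<in> \<psi> ` {y - pi, y, y + pi, y + 2 * pi}" if "i = 0 \<or> i = 1"
    proof -
      have "\<sigma> u = y \<or> \<sigma> u = y + pi" using i that by auto
      then have "u = \<psi> y \<or> u = \<psi> (y + pi)" using \<psi>[OF u] by auto
      then show ?thesis using y(3) by (auto simp: c_def)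
    qed
    ultimately show ?thesis by auto
  qed
  \<comment> \<open>At the poles, division by zero makes both \<open>F\<close> and \<open>F'\<close> vanish.\<close>
  define F where "F u = (k u - c)\<^sup>2 * (cos (\<sigma> u - y) / sin (\<sigma> u - y))" for u
  define F' where "F' u = 2 * (k u - c) * k' u * (cos (\<sigma> u - y) / sin (\<sigma> u - y))
      - (k u - c)\<^sup>2 * q u / (sin (\<sigma> u - y))\<^sup>2" for u
  have F_der: "(F has_vector_derivative F' u) (at u)"
    if "u \<in> {a<..<b} - \<psi> ` {y - pi, y, y + pi, y + 2 * pi}" for u
  proof -
    have s0: "sin (\<sigma> u - y) \<noteq> 0" using zero[of u] that by auto
    have cot_der: "((\<lambda>u. cot (\<sigma> u - y)) has_real_derivative - inverse ((sin (\<sigma> u - y))\<^sup>2) * q u) (at u)"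
      using that s0 by (intro DERIV_chain2[OF DERIV_cot]) (auto intro!: derivative_eq_intros \<sigma>_der')
    have "((\<lambda>u. (k u - c)\<^sup>2) has_real_derivative 2 * (k u - c) * k' u) (at u)"
      by (auto intro!: derivative_eq_intros k_der)
    from DERIV_mult[OF this cot_der] have "((\<lambda>u. (k u - c)\<^sup>2 * cot (\<sigma> u - y)) has_real_derivative
        2 * (k u - c) * k' u * cot (\<sigma> u - y) + - inverse ((sin (\<sigma> u - y))\<^sup>2) * q u * (k u - c)\<^sup>2) (at u)" .
    then have "(F has_real_derivative F' u) (at u)"
      by (simp add: F_def[abs_def] F'_def cot_def divide_inverse mult_ac)
    then show ?thesis by (simp add: has_real_derivative_iff_has_vector_derivative)
  qed
  have F_cont: "continuous_on {a..b} F"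
    unfolding continuous_on_eq_continuous_within
  proof
    fix u assume u: "u \<in> {a..b}"
    have k_c: "continuous (at u within {a..b}) k" and \<sigma>_c: "continuous (at u within {a..b}) \<sigma>"
      using k_cont \<sigma>_cont u by (auto simp: continuous_on_eq_continuous_within)
    show "continuous (at u within {a..b}) F"
    proof (cases "sin (\<sigma> u - y) = 0")
      case True
      then have c: "c = k u" using zero u by blast
      have "cos (\<sigma> u - y) \<noteq> 0" using True sin_zero_abs_cos_one by fastforce
      then show ?thesis
        unfolding F_def c using True q_pos[OF u]
        by (intro continuous_within_square_over_zero[where g'="cos (\<sigma> u - y) * q u",
              OF has_field_derivative_at_within[OF k_der]])
          (auto intro!: derivative_eq_intros \<sigma>_der[OF u] continuous_intros \<sigma>_c)
    next
      case False
      then show ?thesis unfolding F_def by (intro continuous_intros k_c \<sigma>_c)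
    qed
  qed
  have "(F' has_integral F b - F a) {a..b}"
    using ab F_cont F_der
    by (intro fundamental_theorem_of_calculus_interior_strong[of "\<psi> ` {y - pi, y, y + pi, y + 2 * pi}"]) auto
  moreover have "F b = F a"
    using per by (simp add: F_def \<sigma>_ab sin_diff cos_diff)
  ultimately have int0: "(F' has_integral 0) {a..b}" by simp
  have diff: "((\<lambda>u. L / (2 * pi) * ((k' u)\<^sup>2 * inverse (v u)) - 2 * pi / L * (v u * (k u - c)\<^sup>2)) has_integral
     L / (2 * pi) * energy - 2 * pi / L * integral {a..b} (\<lambda>s. v s * (k s - c)\<^sup>2)) {a..b}"
    by (intro has_integral_diff has_integral_mult_right integrable_integral integrable
        continuous_intros v_cont k_cont k'_cont v_inverse_cont)
  have "0 \<le> L / (2 * pi) * energy - 2 * pi / L * integral {a..b} (\<lambda>s. v s * (k s - c)\<^sup>2)"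
  proof -
    have "F' u \<le> L / (2 * pi) * ((k' u)\<^sup>2 * inverse (v u)) - 2 * pi / L * (v u * (k u - c)\<^sup>2)"
      if u: "u \<in> {a..b}" for u
    proof -
      have rhs: "L / (2 * pi) * ((k' u)\<^sup>2 * inverse (v u)) - 2 * pi / L * (v u * (k u - c)\<^sup>2)
          = (k' u)\<^sup>2 / q u - (k u - c)\<^sup>2 * q u"
        using L_pos v_pos[OF u] by (simp add: q_def field_simps)
      show ?thesis
      proof (cases "sin (\<sigma> u - y) = 0")
        case True
        then show ?thesis using zero[OF u] q_pos[OF u] unfolding rhs by (simp add: F'_def)
      next
        case False
        define r w where "r = cos (\<sigma> u - y) / sin (\<sigma> u - y)" and "w = 1 / (sin (\<sigma> u - y))\<^sup>2"
        have "w - r\<^sup>2 = 1" using False by (simp add: r_def w_def field_simps cos_squared_eq)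
        then have w: "w = 1 + r\<^sup>2" by simp
        have F'_eq: "F' u = 2 * (k u - c) * k' u * r - (k u - c)\<^sup>2 * q u * w"
          by (simp add: F'_def r_def w_def)
        have "(k' u)\<^sup>2 / q u - (k u - c)\<^sup>2 * q u - F' u = (k' u - (k u - c) * q u * r)\<^sup>2 / q u"
          using q_pos[OF u] unfolding F'_eq w by (simp add: field_simps power2_eq_square)
        then have "0 \<le> (k' u)\<^sup>2 / q u - (k u - c)\<^sup>2 * q u - F' u"
          using q_pos[OF u] by simp
        then show ?thesis unfolding rhs by simp
      qed
    qed
    then show ?thesis by (rule has_integral_le[OF int0 diff])
  qed
  then have "(2 * pi / L)\<^sup>2 * integral {a..b} (\<lambda>s. v s * (k s - c)\<^sup>2) \<le> energy"
    using L_pos by (simp add: field_simps power2_eq_square)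
  moreover have "integral {a..b} (\<lambda>s. v s * (k s - m)\<^sup>2) \<le> integral {a..b} (\<lambda>s. v s * (k s - c)\<^sup>2)"
  proof -
    have "integral {a..b} (\<lambda>s. v s * (k s - c)\<^sup>2) - integral {a..b} (\<lambda>s. v s * (k s - m)\<^sup>2) = L * (c - m)\<^sup>2"
      unfolding variance by (simp add: power2_eq_square algebra_simps)
    then show ?thesis using L_pos by (smt (verit) mult_nonneg_nonneg zero_le_power2)
  qed
  ultimately show ?thesis
    by (meson mult_left_mono order_trans zero_le_power2)
qed

end

section \<open>Evolution of the integral quantities\<close>

context csf
begin

lemma ds_periodic:
  assumes f: "smooth_on dom f" "\<And>s. f (t, s + 2 * pi) = f (t, s)" and t: "t \<in> I"
  shows "ds f (t, s + 2 * pi) = ds f (t, s)"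
proof -
  have "((\<lambda>s. f (t, s)) \<circ> (\<lambda>s. s + 2 * pi) has_vector_derivative 1 *\<^sub>R ds f (t, s + 2 * pi)) (at s)"
    using t by (intro vector_diff_chain_at has_vector_derivative_ds[OF f(1)])
      (auto intro!: derivative_eq_intros)
  then have "((\<lambda>s. f (t, s)) has_vector_derivative ds f (t, s + 2 * pi)) (at s)"
    by (simp add: o_def f(2))
  then show ?thesis
    using vector_derivative_unique_at has_vector_derivative_ds[OF f(1)] t by blast
qed

lemma
  assumes t: "t \<in> I"
  shows pos_periodic: "pos (t, s + 2 * pi) = pos (t, s)"
    and cur_periodic: "cur (t, s + 2 * pi) = cur (t, s)"
    and curs_periodic: "curs (t, s + 2 * pi) = curs (t, s)"
proof -
  have 1: "pos (t, s + 2 * pi) = pos (t, s)" for s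
    by (simp add: pos_def cis.ctr)
  have 2: "spd (t, s + 2 * pi) = spd (t, s)" for s
    by (simp add: spd_def ds_periodic[OF smooth_pos 1 t])
  have 3: "tang (t, s + 2 * pi) = tang (t, s)" for s
    by (simp add: tang_def ds_periodic[OF smooth_pos 1 t] 2)
  have 4: "nor (t, s + 2 * pi) = nor (t, s)" for s by (simp add: nor_def 1 3)
  have 5: "cur (t, s + 2 * pi) = cur (t, s)" for s
    by (simp add: cur_def ds_periodic[OF smooth_tang 3 t] 2 4)
  have 6: "curs (t, s + 2 * pi) = curs (t, s)" for s
    by (simp add: curs_def ds_periodic[OF smooth_cur 5 t] 2)
  show "pos (t, s + 2 * pi) = pos (t, s)" "cur (t, s + 2 * pi) = cur (t, s)"
    "curs (t, s + 2 * pi) = curs (t, s)"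
    by (fact 1 5 6)+
qed

text \<open>The integral over the parameter circle. The integrands below carry the length element \<open>spd\<close>,
  so \<open>len\<close>, \<open>totcur\<close>, \<open>bend\<close> and \<open>quart\<close> are the integrals of \<open>1\<close>, \<open>\<kappa>\<close>, \<open>\<kappa>\<^sup>2\<close> and \<open>\<kappa>\<^sup>4\<close>
  with respect to arc length; \<open>diss\<close> is that of \<open>\<kappa>\<^sub>s\<^sup>2\<close>.\<close>

definition loop_int :: "(real \<times> real \<Rightarrow> real) \<Rightarrow> real \<Rightarrow> real" where
  "loop_int f t = integral {0..2 * pi} (\<lambda>s. f (t, s))"

definition len :: "real \<Rightarrow> real" where "len = loop_int spd"
definition totcur :: "real \<Rightarrow> real" where "totcur = loop_int (\<lambda>x. spd x * cur x)"
definition bend :: "real \<Rightarrow> real" where "bend = loop_int (\<lambda>x. spd x * (cur x)\<^sup>2)"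
definition diss :: "real \<Rightarrow> real" where "diss = loop_int (\<lambda>x. (ds cur x)\<^sup>2 * inverse (spd x))"
definition quart :: "real \<Rightarrow> real" where "quart = loop_int (\<lambda>x. spd x * cur x ^ 4)"
definition defect :: "real \<Rightarrow> real" where "defect t = len t * bend t - (totcur t)\<^sup>2"

lemma loop_int_cong: "t \<in> I \<Longrightarrow> (\<And>x. x \<in> dom \<Longrightarrow> f x = g x) \<Longrightarrow> loop_int f t = loop_int g t"
  unfolding loop_int_def by (intro arg_cong[where f="integral _"] ext) auto

lemma loop_int_add:
  "t \<in> I \<Longrightarrow> smooth_on dom f \<Longrightarrow> smooth_on dom g \<Longrightarrow> loop_int (\<lambda>x. f x + g x) t = loop_int f t + loop_int g t"
  unfolding loop_int_def
  by (intro Henstock_Kurzweil_Integration.integral_add integrable_continuous_real continuous_on_slice)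

lemma loop_int_cmult: "loop_int (\<lambda>x. c * f x) t = c * loop_int f t"
  by (simp add: loop_int_def)

lemma loop_int_ds:
  assumes f: "smooth_on dom f" "f (t, 2 * pi) = f (t, 0)" and t: "t \<in> I"
  shows "loop_int (ds f) t = 0"
proof -
  have "((\<lambda>s. ds f (t, s)) has_integral f (t, 2 * pi) - f (t, 0)) {0..2 * pi}"
    using t by (intro fundamental_theorem_of_calculus has_vector_derivative_ds[OF f(1)]) auto
  then show ?thesis using f(2) by (simp add: loop_int_def integral_unique)
qed

lemma loop_int_derivative:
  assumes f: "smooth_on dom f" and t: "t \<in> I"
  shows "(loop_int f has_real_derivative loop_int (dt f) t) (at t)"
  using has_vector_derivative_integral[OF f open_I convex_I t, of 0 "2 * pi"]
  by (simp add: loop_int_def[abs_def] has_real_derivative_iff_has_vector_derivative)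

lemma len_derivative:
  assumes t: "t \<in> I"
  shows "(len has_real_derivative - bend t) (at t)"
proof -
  have "loop_int (dt spd) t = loop_int (\<lambda>x. - 1 * (spd x * (cur x)\<^sup>2)) t"
    by (rule loop_int_cong[OF t]) (simp add: dt_spd)
  then show ?thesis
    using loop_int_derivative[OF smooth_spd t] by (simp only: len_def bend_def loop_int_cmult) simp
qed

lemma smooth_spd_cur: "smooth_on dom (\<lambda>x. spd x * cur x)"
  and smooth_spd_cur2: "smooth_on dom (\<lambda>x. spd x * (cur x)\<^sup>2)"
  and smooth_spd_cur4: "smooth_on dom (\<lambda>x. spd x * cur x ^ 4)"
  unfolding power2_eq_square power4_eq_xxxx by (intro smooth)+

text \<open>For a simple curve \<open>totcur\<close> is, up to orientation, \<open>2\<pi>\<close> minus the enclosed area by the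
  Gauss-Bonnet theorem, so this is the exponential law for the area.\<close>

lemma totcur_derivative:
  assumes t: "t \<in> I"
  shows "(totcur has_real_derivative totcur t) (at t)"
proof -
  have "loop_int (dt (\<lambda>x. spd x * cur x)) t = loop_int (\<lambda>x. spd x * cur x + ds curs x) t"
    by (rule loop_int_cong[OF t]) (rule dt_spd_cur)
  also have "\<dots> = totcur t + loop_int (ds curs) t"
    unfolding totcur_def by (intro loop_int_add t smooth_on_ds smooth_curs smooth_spd_cur)
  also have "loop_int (ds curs) t = 0"
    using curs_periodic[OF t, of 0] by (intro loop_int_ds t smooth_curs) simp
  finally show ?thesis
    using loop_int_derivative[OF smooth_spd_cur t] by (simp add: totcur_def)
qed

text \<open>The term \<open>- 2 diss\<close> arises from \<open>2 \<integral> \<kappa> \<kappa>\<^sub>s\<^sub>s ds\<close> by partial integration.\<close>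

lemma bend_derivative:
  assumes t: "t \<in> I"
  shows "(bend has_real_derivative 2 * bend t - 2 * diss t + quart t) (at t)"
proof -
  have s: "smooth_on dom (\<lambda>x. cur x * ds curs x)" "smooth_on dom (\<lambda>x. (ds cur x)\<^sup>2 * inverse (spd x))"
    "smooth_on dom (\<lambda>x. cur x * curs x)"
    unfolding power2_eq_square by (intro smooth smooth_curs)+
  have "0 = loop_int (ds (\<lambda>x. cur x * curs x)) t"
    using curs_periodic[OF t, of 0] cur_periodic[OF t, of 0] by (intro loop_int_ds[symmetric] t s) simp
  also have "\<dots> = loop_int (\<lambda>x. cur x * ds curs x + (ds cur x)\<^sup>2 * inverse (spd x)) t"
    by (rule loop_int_cong[OF t])
      (simp add: ds_mult[OF smooth_cur smooth_curs] power2_eq_square, simp add: curs_def)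
  also have "\<dots> = loop_int (\<lambda>x. cur x * ds curs x) t + diss t"
    unfolding diss_def by (intro loop_int_add t s)
  finally have parts: "loop_int (\<lambda>x. cur x * ds curs x) t = - diss t" by simp
  have "loop_int (dt (\<lambda>x. spd x * (cur x)\<^sup>2)) t
      = loop_int (\<lambda>x. (2 * (spd x * (cur x)\<^sup>2) + 2 * (cur x * ds curs x)) + spd x * cur x ^ 4) t"
    by (rule loop_int_cong[OF t]) (simp add: dt_spd_cur2)
  also have "\<dots> = loop_int (\<lambda>x. 2 * (spd x * (cur x)\<^sup>2) + 2 * (cur x * ds curs x)) t + quart t"
    unfolding quart_def by (intro loop_int_add t smooth s smooth_spd_cur2 smooth_spd_cur4)
  also have "loop_int (\<lambda>x. 2 * (spd x * (cur x)\<^sup>2) + 2 * (cur x * ds curs x)) t = 2 * bend t - 2 * diss t"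
    by (subst loop_int_add) (auto intro!: smooth s smooth_spd_cur2 t simp: loop_int_cmult parts bend_def)
  finally show ?thesis
    using loop_int_derivative[OF smooth_spd_cur2 t] by (simp add: bend_def)
qed

lemma defect_derivative:
  assumes t: "t \<in> I"
  shows "(defect has_real_derivative
    2 * defect t - 2 * (len t * diss t) + (len t * quart t - (bend t)\<^sup>2)) (at t)"
  unfolding defect_def[abs_def]
  by (auto intro!: derivative_eq_intros len_derivative[OF t] bend_derivative[OF t] totcur_derivative[OF t])
    (simp add: power2_eq_square algebra_simps)

definition meancur :: "real \<Rightarrow> real" where "meancur t = totcur t / len t"

text \<open>At a fixed time, the curvature as a function on the circle weighted by the length element.\<close>

lemma weighted_interval:
  assumes t: "t \<in> I"
  shows "weighted_interval_C1 0 (2 * pi) (\<lambda>s. spd (t, s)) (\<lambda>s. cur (t, s)) (\<lambda>s. ds cur (t, s))"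
proof
  show "((\<lambda>s. cur (t, s)) has_real_derivative ds cur (t, s)) (at s)" for s
    using has_vector_derivative_ds[OF smooth_cur] t
    by (simp add: has_real_derivative_iff_has_vector_derivative)
  show "0 < spd (t, s)" for s using t by (simp add: spd_pos)
qed (use t in \<open>auto intro!: continuous_on_slice smooth\<close>)

context
  fixes t assumes t: "t \<in> I"
begin

interpretation W: weighted_interval_C1 0 "2 * pi" "\<lambda>s. spd (t, s)" "\<lambda>s. cur (t, s)"
    "len t" "meancur t" "\<lambda>s. ds cur (t, s)"
  rewrites "integral {0..2*pi} (\<lambda>s. spd (t, s)) = len t"
    and "integral {0..2*pi} (\<lambda>s. spd (t, s) * cur (t, s)) = totcur t"
    and "integral {0..2*pi} (\<lambda>s. spd (t, s) * (cur (t, s))\<^sup>2) = bend t"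
    and "integral {0..2*pi} (\<lambda>s. spd (t, s) * (cur (t, s)) ^ 4) = quart t"
    and "integral {0..2*pi} (\<lambda>s. (ds cur (t, s))\<^sup>2 * inverse (spd (t, s))) = diss t"
  using weighted_interval[OF t]
  by (simp_all add: len_def totcur_def bend_def quart_def diss_def loop_int_def meancur_def)

lemmas len_pos = W.L_pos
lemmas diss_nonneg = W.energy_nonneg
lemmas defect_nonneg = W.variance_nonneg[folded defect_def]
lemmas variance_cur_square_le = W.variance_square_le[folded defect_def]
lemmas cur_oscillation_le = W.oscillation_le
lemmas cur_attains_mean = W.attains_mean
lemmas variance_cur = W.variance_mean[folded defect_def]

lemma defect_le_diss: "(2 * pi / len t)\<^sup>2 * defect t \<le> len t * diss t"
  using mult_left_mono[OF W.Wirtinger less_imp_le[OF W.L_pos]] cur_periodic[OF t, of 0]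
  by (simp add: variance_cur[symmetric] mult_ac)

end

end

section \<open>Length of convex curves of small total curvature\<close>

context csf
begin

text \<open>Any unit normal field is \<open>g nor\<close> with \<open>g\<close> continuous and nowhere zero, hence of constant sign.
  So the sign condition on the curvature with respect to it bounds \<open>cur\<close> from one side.\<close>

lemma cur_one_signed:
  assumes t: "t \<in> I" and nu: "unit_normal_field (F t) \<nu>"
    and nonneg: "\<And>s. 0 \<le> geodesic_curvature (ang (F t)) (ang \<nu>) s"
  shows "(\<forall>s. 0 \<le> cur (t, s)) \<or> (\<forall>s. cur (t, s) \<le> 0)"
proof -
  define g where "g s = ang \<nu> s \<bullet> nor (t, s)" for s
  have nu_perp: "norm (ang \<nu> s) = 1" "ang \<nu> s \<bullet> pos (t, s) = 0" "ang \<nu> s \<bullet> tang (t, s) = 0" for s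
  proof -
    have *: "norm (ang \<nu> s) = 1" "ang \<nu> s \<bullet> F t (cis s) = 0"
      "ang \<nu> s \<bullet> vector_derivative (ang (F t)) (at s) = 0"
      using nu by (auto simp: unit_normal_field_def)
    show "norm (ang \<nu> s) = 1" "ang \<nu> s \<bullet> pos (t, s) = 0"
      using * by (simp_all add: pos_def)
    show "ang \<nu> s \<bullet> tang (t, s) = 0"
      using *(3) spd_pos[of "(t, s)"] t by (simp add: vector_derivative_ang ds_pos)
  qed
  have nu_eq: "ang \<nu> s = g s *\<^sub>R nor (t, s)" for s
    using expand[of "(t, s)" "ang \<nu> s"] t nu_perp[of s] by (simp add: g_def)
  have nz: "g s \<noteq> 0" for s using nu_perp(1)[of s] nu_eq[of s] by auto
  have "continuous_on UNIV g"
    unfolding g_def using nu t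
    by (intro continuous_on_inner smooth_on_continuous_on continuous_on_slice[OF smooth_nor])
      (auto simp: unit_normal_field_def)
  then have conn: "connected (range g)" by (intro connected_continuous_image) auto
  have sign: "(\<forall>s. 0 < g s) \<or> (\<forall>s. g s < 0)"
  proof (rule ccontr)
    assume "\<not> ?thesis"
    then obtain x y where "g x \<le> 0" "0 \<le> g y" by (auto simp: not_less)
    then have "0 \<in> range g"
      using conn unfolding connected_iff_interval by blast
    then show False using nz by (metis rangeE)
  qed
  have cur: "cur (t, s) = geodesic_curvature (ang (F t)) (ang \<nu>) s * g s" for s
  proof -
    have "cur (t, s) *\<^sub>R nor (t, s) = geodesic_curvature (ang (F t)) (ang \<nu>) s *\<^sub>R ang \<nu> s"
      using curvature_vector_eq[OF embedding[OF t] nu, of s] curvature_vector_frame[OF t, of s] by simp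
    from arg_cong[OF this, of "\<lambda>w. w \<bullet> nor (t, s)"] show ?thesis
      using t by (simp add: frame g_def)
  qed
  from sign show ?thesis
  proof
    assume "\<forall>s. 0 < g s"
    then show ?thesis unfolding cur by (intro disjI1 allI mult_nonneg_nonneg nonneg less_imp_le) simp
  next
    assume "\<forall>s. g s < 0"
    then show ?thesis unfolding cur by (intro disjI2 allI mult_nonneg_nonpos nonneg less_imp_le) simp
  qed
qed

end

lemma inner_cross_cross:
  fixes a b x y :: "real^3"
  shows "cross3 x y \<bullet> cross3 a b = (x \<bullet> a) * (y \<bullet> b) - (x \<bullet> b) * (y \<bullet> a)"
  by (simp add: cross3_simps)

context csf
begin

text \<open>Since \<open>\<nu>\<^sub>s = - \<kappa> \<tau>\<close>, the normals trace a curve of length \<open>\<integral> \<bar>\<kappa>\<bar> ds\<close>, which is \<open>\<bar>totcur\<bar>\<close> when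
  \<open>\<kappa>\<close> has one sign; and \<open>\<nu> \<bullet> n = 1 - \<bar>\<nu> - n\<bar>\<^sup>2 / 2\<close> for unit vectors.\<close>

lemma nor_near_initial:
  assumes t: "t \<in> I" and sign: "(\<forall>s. 0 \<le> cur (t, s)) \<or> (\<forall>s. cur (t, s) \<le> 0)" and s: "s \<in> {0..2*pi}"
  shows "1 - (totcur t)\<^sup>2 / 2 \<le> nor (t, s) \<bullet> nor (t, 0)"
proof -
  have cont: "continuous_on A (\<lambda>s. ds nor (t, s))" "continuous_on A (\<lambda>s. spd (t, s))"
      "continuous_on A (\<lambda>s. cur (t, s))" for A
    using t by (auto intro!: continuous_on_slice smooth)
  have "((\<lambda>s. ds nor (t, s)) has_integral nor (t, s) - nor (t, 0)) {0..s}"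
    using t s by (intro fundamental_theorem_of_calculus has_vector_derivative_ds[OF smooth_nor]) auto
  then have "norm (nor (t, s) - nor (t, 0)) = norm (integral {0..s} (\<lambda>s. ds nor (t, s)))"
    by (simp add: integral_unique)
  also have "\<dots> \<le> integral {0..s} (\<lambda>s. spd (t, s) * \<bar>cur (t, s)\<bar>)"
  proof (intro integral_norm_bound_integral integrable_continuous_real continuous_intros cont)
    fix r
    show "norm (ds nor (t, r)) \<le> spd (t, r) * \<bar>cur (t, r)\<bar>"
      using t spd_pos[of "(t, r)"] tang_tang[of "(t, r)"] by (simp add: ds_nor abs_mult norm_eq_sqrt_inner)
  qed
  also have "\<dots> \<le> integral {0..2*pi} (\<lambda>s. spd (t, s) * \<bar>cur (t, s)\<bar>)"
    using s t spd_pos by (intro integral_subset_le integrable_continuous_real continuous_intros cont) (auto simp: less_imp_le)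
  also have "\<dots> = \<bar>totcur t\<bar>"
    using sign
  proof
    assume *: "\<forall>s. 0 \<le> cur (t, s)"
    then have "0 \<le> totcur t"
      unfolding totcur_def loop_int_def using t spd_pos
      by (intro integral_nonneg integrable_continuous_real continuous_intros cont) (auto simp: less_imp_le)
    then show ?thesis using * by (simp add: totcur_def loop_int_def)
  next
    assume *: "\<forall>s. cur (t, s) \<le> 0"
    then have eq: "integral {0..2*pi} (\<lambda>s. spd (t, s) * \<bar>cur (t, s)\<bar>) = - totcur t"
      by (simp add: totcur_def loop_int_def)
    have "0 \<le> integral {0..2*pi} (\<lambda>s. spd (t, s) * \<bar>cur (t, s)\<bar>)"
      using t spd_pos by (intro integral_nonneg integrable_continuous_real continuous_intros cont) (auto simp: less_imp_le)
    then show ?thesis using eq by simp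
  qed
  finally have "(norm (nor (t, s) - nor (t, 0)))\<^sup>2 \<le> (totcur t)\<^sup>2"
    using power_mono[of _ "\<bar>totcur t\<bar>" 2] by fastforce
  moreover have "(norm (nor (t, s) - nor (t, 0)))\<^sup>2 = 2 - 2 * (nor (t, s) \<bullet> nor (t, 0))"
    using t nor_nor[of "(t, s)"] nor_nor[of "(t, 0)"]
    by (simp add: power2_norm_eq_inner inner_diff_left inner_diff_right inner_commute)
  ultimately show ?thesis by simp
qed

text \<open>Let \<open>n\<close> be the normal at parameter \<open>0\<close>. The longitude of the curve about the axis \<open>n\<close> grows at
  the rate \<open>spd (\<nu> \<bullet> n) / (1 - (\<gamma> \<bullet> n)\<^sup>2)\<close>, which is at least \<open>c spd\<close> with \<open>c = 1 - totcur\<^sup>2 / 2\<close> by the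
  previous lemma. The total change of longitude is \<open>2\<pi>\<close> times the winding number about \<open>0\<close> of
  the stereographic projection of the curve from \<open>-n\<close>. That is a simple closed curve in the plane,
  so its winding number is at most \<open>1\<close>. Hence \<open>c L \<le> 2\<pi>\<close>.\<close>

lemma length_bound_of_convex:
  assumes t: "t \<in> I" and sign: "(\<forall>s. 0 \<le> cur (t, s)) \<or> (\<forall>s. cur (t, s) \<le> 0)"
    and small: "\<bar>totcur t\<bar> < 1"
  shows "len t * (1 - (totcur t)\<^sup>2 / 2) \<le> 2 * pi"
proof -
  define c where "c = 1 - (totcur t)\<^sup>2 / 2"
  have "(totcur t)\<^sup>2 < 1" using small by (simp add: abs_square_less_1)
  then have c: "0 < c" by (simp add: c_def)
  define a b n where "a = pos (t, 0)" and "b = tang (t, 0)" and "n = nor (t, 0)"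
  define X Y f where "X s = pos (t, s) \<bullet> a" and "Y s = pos (t, s) \<bullet> b" and "f s = pos (t, s) \<bullet> n" for s
  define X' Y' f' where "X' s = spd (t, s) * (tang (t, s) \<bullet> a)" and "Y' s = spd (t, s) * (tang (t, s) \<bullet> b)"
    and "f' s = spd (t, s) * (tang (t, s) \<bullet> n)" for s
  have tdom: "(t, s) \<in> dom" for s using t by simp
  note [simp] = t
  have exp: "w = (w \<bullet> a) *\<^sub>R a + (w \<bullet> b) *\<^sub>R b + (w \<bullet> n) *\<^sub>R n" for w
    unfolding a_def b_def n_def by (rule expand) (simp add: t)
  have frame0: "a \<bullet> a = 1" "b \<bullet> b = 1" "n \<bullet> n = 1" "a \<bullet> b = 0" "b \<bullet> a = 0" "a \<bullet> n = 0" "n \<bullet> a = 0"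
      "b \<bullet> n = 0" "n \<bullet> b = 0"
    unfolding a_def b_def n_def by (simp_all add: frame)
  have XYf: "(X s)\<^sup>2 + (Y s)\<^sup>2 = 1 - (f s)\<^sup>2" for s
  proof -
    have "1 = pos (t, s) \<bullet> ((pos (t, s) \<bullet> a) *\<^sub>R a + (pos (t, s) \<bullet> b) *\<^sub>R b + (pos (t, s) \<bullet> n) *\<^sub>R n)"
      unfolding exp[symmetric] by (simp add: frame)
    then show ?thesis by (simp add: X_def Y_def f_def inner_add_right power2_eq_square)
  qed
  have n_ge: "c \<le> nor (t, s) \<bullet> n" if "s \<in> {0..2*pi}" for s
    unfolding c_def n_def by (rule nor_near_initial[OF t sign that])
  \<comment> \<open>The curve avoids the axis: at \<open>\<plusminus>n\<close> the normal \<open>\<nu>\<close> would be orthogonal to \<open>n\<close>.\<close>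
  have XY_pos: "0 < (X s)\<^sup>2 + (Y s)\<^sup>2" if s: "s \<in> {0..2*pi}" for s
  proof (rule ccontr)
    assume "\<not> ?thesis"
    then have "X s = 0" "Y s = 0" by (auto simp: sum_power2_gt_zero_iff)
    then have "pos (t, s) = f s *\<^sub>R n" using exp[of "pos (t, s)"] by (simp add: X_def Y_def f_def)
    then have "f s * (nor (t, s) \<bullet> n) = 0"
      using frame(7)[of "(t, s)"] by (metis inner_scaleR_right nor_pos(1))
    moreover have "f s \<noteq> 0" using XYf[of s] \<open>X s = 0\<close> \<open>Y s = 0\<close> by auto
    ultimately show False using n_ge[OF s] c by simp
  qed
  then have f_less: "(f s)\<^sup>2 < 1" if "s \<in> {0..2*pi}" for s using XYf[of s] that by force
  then have f1: "0 < 1 + f s" if "s \<in> {0..2*pi}" for s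
    using that abs_square_less_1[of "f s"] by (auto simp: abs_less_iff)
  have pos_der: "((\<lambda>s. pos (t, s) \<bullet> e) has_real_derivative spd (t, s) * (tang (t, s) \<bullet> e)) (at s)" for e s
  proof -
    have "((\<lambda>s. pos (t, s) \<bullet> e) has_vector_derivative (spd (t, s) *\<^sub>R tang (t, s)) \<bullet> e) (at s)"
      using has_vector_derivative_ds[OF smooth_pos tdom, of s UNIV]
      by (intro bounded_linear.has_vector_derivative[OF bounded_linear_inner_left]) (simp add: ds_pos)
    then show ?thesis by (simp add: has_real_derivative_iff_has_vector_derivative)
  qed
  have der: "(X has_real_derivative X' s) (at s)" "(Y has_real_derivative Y' s) (at s)"
    "(f has_real_derivative f' s) (at s)" for s
    unfolding X_def[abs_def] Y_def[abs_def] f_def[abs_def] X'_def Y'_def f'_def by (rule pos_der)+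
  have cont: "continuous_on A X" "continuous_on A Y" "continuous_on A f" for A
    using der by (meson DERIV_isCont continuous_at_imp_continuous_on)+
  have cont': "continuous_on A X'" "continuous_on A Y'" "continuous_on A f'" for A
    unfolding X'_def[abs_def] Y'_def[abs_def] f'_def[abs_def] using t
    by (auto intro!: continuous_intros continuous_on_slice smooth)
  \<comment> \<open>\<open>q\<close> is the stereographic projection from \<open>-n\<close>, and \<open>X\<close>, \<open>Y\<close>, \<open>f\<close> are the coordinates of the
    curve in the frame at parameter \<open>0\<close>.\<close>
  define q q' where "q s = Complex (X s / (1 + f s)) (Y s / (1 + f s))"
    and "q' s = Complex ((X' s * (1 + f s) - X s * f' s) / (1 + f s)\<^sup>2)
                  ((Y' s * (1 + f s) - Y s * f' s) / (1 + f s)\<^sup>2)" for s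
  have q_der: "(q has_vector_derivative q' s) (at s)" if "s \<in> {0..2*pi}" for s
    using f1[OF that] unfolding q_def[abs_def] q'_def has_vector_derivative_complex_iff complex.sel
    by (auto intro!: derivative_eq_intros der simp: power2_eq_square)
  have q'_cont: "continuous_on {0..2*pi} q'"
    unfolding q'_def[abs_def] Complex_eq
    by (intro continuous_intros cont cont') (use f1 in force)+
  have q_inj: "pos (t, s) = pos (t, r)" if eq: "q s = q r" and "s \<in> {0..2*pi}" "r \<in> {0..2*pi}" for s r
  proof -
    have q: "X s / (1 + f s) = X r / (1 + f r)" "Y s / (1 + f s) = Y r / (1 + f r)"
      using eq unfolding q_def complex.inject by blast+
    have sq: "(X s / (1 + f s))\<^sup>2 + (Y s / (1 + f s))\<^sup>2 = 2 / (1 + f s) - 1" if "s \<in> {0..2*pi}" for s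
    proof -
      have "(X s / (1 + f s))\<^sup>2 + (Y s / (1 + f s))\<^sup>2 = (1 - (f s)\<^sup>2) / (1 + f s)\<^sup>2"
        using XYf[of s] by (simp add: power_divide flip: add_divide_distrib)
      also have "1 - (f s)\<^sup>2 = (2 - (1 + f s)) * (1 + f s)" by (simp add: power2_eq_square algebra_simps)
      also have "\<dots> / (1 + f s)\<^sup>2 = 2 / (1 + f s) - 1"
      proof -
        have "(2 - g) * g / g\<^sup>2 = 2 / g - 1" if "0 < g" for g :: real
          using that by (simp add: power2_eq_square field_simps)
        then show ?thesis using f1[OF that] .
      qed
      finally show ?thesis .
    qed
    have "2 / (1 + f s) = 2 / (1 + f r)" using sq[OF that(2)] sq[OF that(3)] q by simp
    then have "f s = f r" using f1[OF that(2)] f1[OF that(3)] by (simp add: field_simps)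
    moreover have "X s = X r" "Y s = Y r" using q f1[OF that(2)] f1[OF that(3)] \<open>f s = f r\<close> by auto
    moreover have coords: "pos (t, s) = X s *\<^sub>R a + Y s *\<^sub>R b + f s *\<^sub>R n" for s
      unfolding X_def Y_def f_def by (rule exp)
    ultimately show ?thesis by (metis coords)
  qed
  have rotation: "Im (q' s / q s) = spd (t, s) * (nor (t, s) \<bullet> n) / (1 - (f s)\<^sup>2)" if s: "s \<in> {0..2*pi}" for s
  proof -
    have XY': "X s * Y' s - Y s * X' s = spd (t, s) * (nor (t, s) \<bullet> n)"
      unfolding nor_def n_def inner_cross_cross a_def[symmetric] b_def[symmetric]
      by (simp add: X_def Y_def X'_def Y'_def algebra_simps)
    have "Im (q' s / q s) = (Im (q' s) * Re (q s) - Re (q' s) * Im (q s)) / ((Re (q s))\<^sup>2 + (Im (q s))\<^sup>2)"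
      by (simp add: Im_divide)
    also have "Im (q' s) * Re (q s) - Re (q' s) * Im (q s) = (X s * Y' s - Y s * X' s) / (1 + f s)\<^sup>2"
      using f1[OF s] by (simp add: q_def q'_def divide_simps) (simp add: power2_eq_square algebra_simps)
    also have "(Re (q s))\<^sup>2 + (Im (q s))\<^sup>2 = (1 - (f s)\<^sup>2) / (1 + f s)\<^sup>2"
      using XYf[of s] by (simp add: q_def power_divide flip: add_divide_distrib)
    finally show ?thesis using f1[OF s] XY' by simp
  qed
  define p where "p x = q (2 * pi * x)" for x
  have p_der: "(p has_vector_derivative (2 * pi) *\<^sub>R q' (2 * pi * x)) (at x)" if x: "x \<in> {0..1}" for x
  proof -
    have "2 * pi * x \<in> {0..2*pi}" using x by (simp add: mult_left_le)
    note q_at = q_der[OF this]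
    have lin: "((\<lambda>x. 2 * pi * x) has_vector_derivative 2 * pi) (at x)"
      unfolding has_real_derivative_iff_has_vector_derivative[symmetric]
      by (rule DERIV_cmult_Id)
    have "p = q \<circ> (\<lambda>x. 2 * pi * x)" by (rule ext) (simp only: o_apply p_def)
    then show ?thesis by (simp only: vector_diff_chain_at[OF lin q_at])
  qed
  have valid: "valid_path p"
  proof -
    have "continuous_on {0..1} (\<lambda>x. (2 * pi) *\<^sub>R q' (2 * pi * x))"
      by (intro continuous_intros continuous_on_compose2[OF q'_cont]) auto
    then have "p C1_differentiable_on {0..1}"
      unfolding C1_differentiable_on_def
      by (intro exI[of _ "\<lambda>x. (2 * pi) *\<^sub>R q' (2 * pi * x)"] conjI ballI p_der)
    then show ?thesis
      by (simp add: valid_path_def C1_differentiable_imp_piecewise)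
  qed
  have p0: "0 \<notin> path_image p"
  proof
    assume "0 \<in> path_image p"
    then obtain x where x: "x \<in> {0..1}" "q (2 * pi * x) = 0" by (auto simp: path_image_def p_def)
    then have s: "2 * pi * x \<in> {0..2*pi}" by auto
    then show False using XY_pos[OF s] f1[OF s] x(2) by (auto simp: q_def complex_eq_iff)
  qed
  have simple: "simple_path p"
    unfolding simple_path_def loop_free_def
  proof (intro conjI ballI impI)
    show "path p" by (rule valid_path_imp_path[OF valid])
    fix x y :: real assume xy: "x \<in> {0..1}" "y \<in> {0..1}" "p x = p y"
    then have "pos (t, 2 * pi * x) = pos (t, 2 * pi * y)" by (intro q_inj) (auto simp: p_def)
    then have "cis (2 * pi * x) = cis (2 * pi * y)"
      using embedding[OF t] by (auto simp: pos_def smooth_embedding_def inj_on_def)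
    then have "cis (2 * pi * x - 2 * pi * y) = 1" by (metis cis_divide cis_neq_zero divide_self)
    then obtain m :: int where m: "2 * pi * x - 2 * pi * y = of_int m * (2 * pi)"
      using cos_one_2pi_int[of "2 * pi * x - 2 * pi * y"] by (auto simp: complex_eq_iff)
    then have "2 * pi * (x - y) = 2 * pi * of_int m" by (simp add: algebra_simps)
    then have "x - y = of_int m" by simp
    moreover from this have "-1 \<le> (of_int m :: real)" "of_int m \<le> (1 :: real)" using xy by auto
    then have "m \<in> {-1, 0, 1}" by auto
    ultimately show "x = y \<or> x = 0 \<and> y = 1 \<or> x = 1 \<and> y = 0" using xy by auto
  qed
  have "pathfinish p = pathstart p"
    using pos_periodic[OF t, of 0] by (simp add: pathfinish_def pathstart_def p_def q_def X_def Y_def f_def)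
  then have "winding_number p 0 \<in> {-1, 0, 1}"
    by (rule simple_closed_path_winding_number_cases[OF simple _ p0])
  then have w: "Im (2 * pi * \<i> * winding_number p 0) \<le> 2 * pi" by auto
  have "((\<lambda>x. 1 / (p x - 0) * vector_derivative p (at x within {0..1})) has_integral
      2 * pi * \<i> * winding_number p 0) {0..1}"
    using has_contour_integral_winding_number[OF valid p0] by (simp add: has_contour_integral_def)
  then have *: "((\<lambda>x. Im (1 / (p x - 0) * vector_derivative p (at x within {0..1}))) has_integral
      Im (2 * pi * \<i> * winding_number p 0)) {0..1}"
    using has_integral_linear[OF _ bounded_linear_Im] by (force simp: o_def)
  define A where "A r = integral {0..r} (\<lambda>s. spd (t, s))" for r
  have lower: "((\<lambda>x. c * (2 * pi * spd (t, 2 * pi * x))) has_integral c * A (2 * pi * 1) - c * A (2 * pi * 0)) {0..1}"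
  proof (rule fundamental_theorem_of_calculus)
    fix x :: real assume x: "x \<in> {0..1}"
    have "(A has_real_derivative spd (t, 2 * pi * x)) (at (2 * pi * x) within {0..2*pi})"
      unfolding A_def using x
      by (intro integral_has_real_derivative continuous_on_slice[OF smooth_spd t]) auto
    moreover have "(\<lambda>x. 2 * pi * x) ` {0..1} \<subseteq> {0..2*pi}" by auto
    ultimately have "(A has_real_derivative spd (t, 2 * pi * x)) (at (2 * pi * x) within (\<lambda>x. 2 * pi * x) ` {0..1})"
      by (rule DERIV_subset)
    then have "(A \<circ> (\<lambda>x. 2 * pi * x) has_real_derivative spd (t, 2 * pi * x) * (2 * pi)) (at x within {0..1})"
      by (rule DERIV_image_chain) (auto intro!: derivative_eq_intros)
    then have "((\<lambda>x. A (2 * pi * x)) has_real_derivative spd (t, 2 * pi * x) * (2 * pi)) (at x within {0..1})"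
      by (simp add: o_def)
    then show "((\<lambda>x. c * A (2 * pi * x)) has_vector_derivative c * (2 * pi * spd (t, 2 * pi * x))) (at x within {0..1})"
      unfolding has_real_derivative_iff_has_vector_derivative[symmetric]
      by (auto intro!: derivative_eq_intros)
  qed simp
  have "c * A (2 * pi * 1) - c * A (2 * pi * 0) \<le> Im (2 * pi * \<i> * winding_number p 0)"
  proof (rule has_integral_le[OF lower *])
    fix x :: real assume x: "x \<in> {0..1}"
    define s where "s = 2 * pi * x"
    have s: "s \<in> {0..2*pi}" using x by (auto simp: s_def)
    have "vector_derivative p (at x within {0..1}) = (2 * pi) *\<^sub>R q' s"
      unfolding s_def using x by (intro vector_derivative_at_within_ivl[OF p_der]) auto
    then have "Im (1 / (p x - 0) * vector_derivative p (at x within {0..1})) = 2 * pi * Im (q' s / q s)"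
      by (simp add: p_def flip: s_def)
    also have "\<dots> = 2 * pi * (spd (t, s) * (nor (t, s) \<bullet> n) / (1 - (f s)\<^sup>2))"
      by (simp add: rotation[OF s])
    also have "\<dots> \<ge> 2 * pi * (spd (t, s) * c / 1)"
      using n_ge[OF s] f_less[OF s] spd_pos[of "(t, s)"] c
      by (intro mult_left_mono frac_le) auto
    finally show "c * (2 * pi * spd (t, 2 * pi * x))
        \<le> Im (1 / (p x - 0) * vector_derivative p (at x within {0..1}))"
      by (simp add: s_def mult_ac)
  qed
  then have "c * len t \<le> Im (2 * pi * \<i> * winding_number p 0)"
    by (simp add: A_def len_def loop_int_def)
  from order_trans[OF this w] show ?thesis by (simp add: c_def mult.commute)
qed

end

section \<open>The curvature of an ancient convex solution is constant on each curve\<close>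

context csf
begin

lemma totcur_exp:
  assumes "t \<in> I" "t0 \<in> I"
  shows "totcur t = totcur t0 * exp (t - t0)"
proof -
  have der: "((\<lambda>x. totcur x * exp (- x)) has_real_derivative 0) (at x within I)" if "x \<in> I" for x
    using DERIV_mult[OF totcur_derivative[OF that] DERIV_fun_exp[OF DERIV_minus[OF DERIV_ident]]]
    by (simp add: has_field_derivative_at_within)
  obtain c where c: "\<And>x. x \<in> I \<Longrightarrow> totcur x * exp (- x) = c"
    using has_field_derivative_zero_constant[OF convex_I der] by metis
  have "totcur t = (totcur t * exp (- t)) * exp t" by (simp add: exp_minus)
  also have "totcur t * exp (- t) = totcur t0 * exp (- t0)"
    unfolding c[OF assms(1)] c[OF assms(2)] ..
  finally show ?thesis by (simp add: exp_diff exp_minus divide_inverse)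
qed

lemma Icc_subset: "t0 \<in> I \<Longrightarrow> t1 \<in> I \<Longrightarrow> {t0..t1} \<subseteq> I"
  using closed_segment_subset[of t0 I t1] convex_I by (cases "t0 \<le> t1") (auto simp: closed_segment_eq_real_ivl)

text \<open>Gronwall: on a compact time interval \<open>\<kappa>\<close> is bounded, so the quartic term in the derivative of
  the defect is at most a multiple of the defect, and the diffusion term has the right sign.\<close>

lemma defect_zero_forward:
  assumes t: "t0 \<in> I" "t1 \<in> I" "t0 \<le> t1" and zero: "defect t0 = 0"
  shows "defect t1 = 0"
proof -
  have sub: "{t0..t1} \<subseteq> I" using t Icc_subset by blast
  have "compact (cur ` ({t0..t1} \<times> {0..2*pi}))"
    using sub by (intro compact_continuous_image compact_Times compact_Icc
        continuous_on_subset[OF smooth_on_continuous_on[OF smooth_cur]]) auto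
  then obtain M where M: "\<And>x. x \<in> {t0..t1} \<times> {0..2*pi} \<Longrightarrow> \<bar>cur x\<bar> \<le> M"
    by (metis bounded_iff compact_imp_bounded image_eqI real_norm_def)
  define C where "C = 2 + (2 * M)\<^sup>2"
  have le: "2 * defect t - 2 * (len t * diss t) + (len t * quart t - (bend t)\<^sup>2) \<le> C * defect t"
    if tt: "t \<in> {t0..t1}" for t
  proof -
    have tI: "t \<in> I" using tt sub by blast
    have "(cur (t, s) + meancur t)\<^sup>2 \<le> (2 * M)\<^sup>2" if s: "s \<in> {0..2*pi}" for s
    proof -
      obtain r where "r \<in> {0..2*pi}" "cur (t, r) = meancur t" using cur_attains_mean[OF tI] by blast
      then have "\<bar>meancur t\<bar> \<le> M" "\<bar>cur (t, s)\<bar> \<le> M" using M[of "(t, r)"] M[of "(t, s)"] tt s by auto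
      then have "\<bar>cur (t, s) + meancur t\<bar> \<le> 2 * M" by linarith
      then show ?thesis by (metis abs_ge_zero power2_abs power_mono)
    qed
    from variance_cur_square_le[OF tI this]
    have "len t * quart t - (bend t)\<^sup>2 \<le> (2 * M)\<^sup>2 * defect t" .
    then show ?thesis
      using mult_nonneg_nonneg[OF less_imp_le[OF len_pos[OF tI]] diss_nonneg[OF tI]]
      by (simp add: C_def distrib_right)
  qed
  have "defect t1 * exp (- C * t1) \<le> defect t0 * exp (- C * t0)"
  proof (rule DERIV_nonpos_imp_nonincreasing[OF t(3)])
    fix t assume tt: "t0 \<le> t" "t \<le> t1"
    define d where "d = 2 * defect t - 2 * (len t * diss t) + (len t * quart t - (bend t)\<^sup>2)"
    have tI: "t \<in> I" using tt sub by auto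
    have "((\<lambda>t. defect t * exp (- C * t)) has_real_derivative (d - C * defect t) * exp (- C * t)) (at t)"
      using defect_derivative[OF tI] unfolding d_def[symmetric]
      by (auto intro!: derivative_eq_intros simp: algebra_simps)
    moreover have "(d - C * defect t) * exp (- C * t) \<le> 0"
      using le[of t] tt by (intro mult_nonpos_nonneg) (auto simp: d_def)
    ultimately show "\<exists>y. ((\<lambda>t. defect t * exp (- C * t)) has_real_derivative y) (at t) \<and> y \<le> 0" by blast
  qed
  then have "defect t1 \<le> 0" using zero by (simp add: mult_le_0_iff)
  then show ?thesis using defect_nonneg[OF t(2)] by simp
qed

lemma cur_constant:
  assumes t: "t \<in> I" and zero: "defect t = 0"
  shows "cur (t, s) = meancur t"
proof -
  have cont: "continuous_on A (\<lambda>s. spd (t, s))" "continuous_on A (\<lambda>s. cur (t, s))" for A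
    using t by (auto intro!: continuous_on_slice smooth)
  have "integral {0..2 * pi} (\<lambda>s. spd (t, s) * (cur (t, s) - meancur t)\<^sup>2) = 0"
    using variance_cur[OF t] zero len_pos[OF t] by simp
  then have "\<forall>s\<in>{0..2*pi}. spd (t, s) * (cur (t, s) - meancur t)\<^sup>2 = 0"
    using t spd_pos by (subst (asm) integral_eq_0_iff) (auto intro!: continuous_intros cont simp: less_imp_le)
  then have *: "cur (t, s) = meancur t" if "s \<in> {0..2*pi}" for s
    using t spd_pos[of "(t, s)"] that by force
  obtain s' where s': "s' \<in> {0..2*pi}" "cur (t, s) = cur (t, s')"
  proof -
    have per: "cur (t, s + 2 * pi * of_int n) = cur (t, s)" for n s
    proof (induction n rule: int_induct[where k=0])
      case base then show ?case by simp
    next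
      case (step1 n)
      then show ?case using cur_periodic[OF t, of "s + 2 * pi * of_int n"] by (simp add: algebra_simps)
    next
      case (step2 n)
      then show ?case using cur_periodic[OF t, of "s + 2 * pi * of_int (n - 1)"] by (simp add: algebra_simps)
    qed
    define n where "n = \<lfloor>s / (2 * pi)\<rfloor>"
    have "of_int n \<le> s / (2 * pi)" "s / (2 * pi) < of_int n + 1" by (auto simp: n_def)
    then have "s + 2 * pi * of_int (- n) \<in> {0..2*pi}" by (auto simp: field_simps)
    with per[of s "- n"] show thesis by (intro that[of "s + 2 * pi * of_int (- n)"]) auto
  qed
  then show ?thesis using * by metis
qed

end

text \<open>Convexity and embeddedness enter the following argument through the length bound, which is
  a statement about early times because \<open>totcur\<close> decays towards \<open>-\<infinity>\<close>.\<close>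

locale ancient_csf = csf +
  assumes ancient: "\<And>s t. t \<in> I \<Longrightarrow> s \<le> t \<Longrightarrow> s \<in> I" and nonempty: "I \<noteq> {}"
    and length_bound: "\<And>t. t \<in> I \<Longrightarrow> \<bar>totcur t\<bar> < 1 \<Longrightarrow> len t * (1 - (totcur t)\<^sup>2 / 2) \<le> 2 * pi"
begin

text \<open>Write \<open>X = len diss\<close>. Since \<open>(\<kappa> + m)\<^sup>2 \<le> 2 (\<kappa> - m)\<^sup>2 + 8 m\<^sup>2 \<le> 2 X + 8 m\<^sup>2\<close> for the mean curvature \<open>m\<close>
  of the curve, the quartic term is at most \<open>(2 X + 8 m\<^sup>2) Q\<close>. Of the diffusion term \<open>- 2 X\<close> this
  leaves \<open>- 2 (1 - Q) X\<close>, and \<open>X \<ge> (2\<pi> / len)\<^sup>2 Q \<ge> (1 - totcur\<^sup>2) Q\<close> by the Wirtinger inequality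
  and the length bound.\<close>

lemma defect_derivative_le:
  assumes t: "t \<in> I" "\<bar>totcur t\<bar> < 1" "defect t \<le> 1"
  shows "2 * defect t - 2 * (len t * diss t) + (len t * quart t - (bend t)\<^sup>2)
    \<le> 2 * (defect t + (totcur t)\<^sup>2 + 4 * (meancur t)\<^sup>2) * defect t"
proof -
  define X where "X = len t * diss t"
  have "(cur (t, s) + meancur t)\<^sup>2 \<le> 2 * X + 8 * (meancur t)\<^sup>2" if "s \<in> {0..2*pi}" for s
  proof -
    have "0 \<le> (cur (t, s) - 3 * meancur t)\<^sup>2" by simp
    then have "(cur (t, s) + meancur t)\<^sup>2 \<le> 2 * (cur (t, s) - meancur t)\<^sup>2 + 8 * (meancur t)\<^sup>2"
      by (simp add: power2_eq_square algebra_simps)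
    with cur_oscillation_le[OF t(1) that] show ?thesis by (simp add: X_def)
  qed
  from variance_cur_square_le[OF t(1) this]
  have 1: "len t * quart t - (bend t)\<^sup>2 \<le> (2 * X + 8 * (meancur t)\<^sup>2) * defect t" .
  have D: "0 \<le> defect t" by (rule defect_nonneg[OF t(1)])
  have "(totcur t)\<^sup>2 < 1" using t(2) by (simp add: abs_square_less_1)
  have "(1 - (totcur t)\<^sup>2) * defect t \<le> X"
  proof -
    have "1 - (totcur t)\<^sup>2 \<le> (1 - (totcur t)\<^sup>2 / 2)\<^sup>2"
      using zero_le_power2[of "(totcur t)\<^sup>2"] by (simp add: power2_diff power_divide)
    also have "1 - (totcur t)\<^sup>2 / 2 \<le> 2 * pi / len t"
      using length_bound[OF t(1,2)] len_pos[OF t(1)] by (simp add: field_simps)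
    then have "(1 - (totcur t)\<^sup>2 / 2)\<^sup>2 \<le> (2 * pi / len t)\<^sup>2"
      using \<open>(totcur t)\<^sup>2 < 1\<close> by (intro power_mono) auto
    finally have "(1 - (totcur t)\<^sup>2) * defect t \<le> (2 * pi / len t)\<^sup>2 * defect t"
      using D by (intro mult_right_mono)
    with defect_le_diss[OF t(1)] show ?thesis by (simp add: X_def)
  qed
  then have "(1 - defect t) * ((1 - (totcur t)\<^sup>2) * defect t) \<le> (1 - defect t) * X"
    using t(3) by (intro mult_left_mono) auto
  moreover have "0 \<le> (totcur t)\<^sup>2 * (defect t)\<^sup>2" by simp
  ultimately have "defect t - X * (1 - defect t) \<le> (defect t + (totcur t)\<^sup>2) * defect t"
    by (simp add: power2_eq_square algebra_simps)
  then show ?thesis using 1 unfolding X_def[symmetric]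
    by (simp add: algebra_simps)
qed

text \<open>For simple curves the spherical isoperimetric inequality says that this sum is at least
  \<open>4 \<pi>\<^sup>2\<close>, with equality for circles.\<close>

definition isop :: "real \<Rightarrow> real" where "isop t = (len t)\<^sup>2 + (totcur t)\<^sup>2"

lemma isop_derivative: "t \<in> I \<Longrightarrow> (isop has_real_derivative - 2 * defect t) (at t)"
  unfolding isop_def[abs_def] defect_def
  by (auto intro!: derivative_eq_intros len_derivative totcur_derivative)
    (simp add: power2_eq_square algebra_simps)

lemma isop_le:
  assumes t: "t \<in> I" "\<bar>totcur t\<bar> < 1"
  shows "isop t \<le> 16 * pi\<^sup>2 + 1"
proof -
  have K: "(totcur t)\<^sup>2 < 1" using t(2) by (simp add: abs_square_less_1)
  have "len t * (1 / 2) \<le> len t * (1 - (totcur t)\<^sup>2 / 2)"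
    using len_pos[OF t(1)] K by (intro mult_left_mono) auto
  with length_bound[OF t] have "len t \<le> 4 * pi" by simp
  then have "(len t)\<^sup>2 \<le> (4 * pi)\<^sup>2" using len_pos[OF t(1)] by (intro power_mono) auto
  then show ?thesis using K by (simp add: isop_def power_mult_distrib)
qed

text \<open>Otherwise \<open>isop\<close>, whose derivative is \<open>- 2 defect\<close>, would be unbounded towards \<open>-\<infinity>\<close>.\<close>

lemma defect_small_somewhere:
  assumes t: "t \<in> I" and small: "\<bar>totcur t\<bar> < 1" and \<delta>: "0 < \<delta>"
  shows "\<exists>s\<le>t. defect s < \<delta>"
proof (rule ccontr)
  assume "\<not> ?thesis"
  then have D: "\<And>s. s \<le> t \<Longrightarrow> \<delta> \<le> defect s" by force
  define s where "s = t - (16 * pi\<^sup>2 + 1) / \<delta>"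
  have "s < t" using \<delta> by (auto simp: s_def intro!: divide_pos_pos add_nonneg_pos)
  have sI: "s \<in> I" using ancient[OF t] \<open>s < t\<close> by simp
  have "\<bar>totcur s\<bar> < 1"
  proof -
    have "exp (s - t) \<le> 1" using \<open>s < t\<close> by simp
    then have "\<bar>totcur t\<bar> * exp (s - t) \<le> \<bar>totcur t\<bar> * 1" by (intro mult_left_mono) auto
    then show ?thesis using small by (simp add: totcur_exp[OF sI t] abs_mult)
  qed
  obtain z where z: "s < z" "z < t" "isop t - isop s = (t - s) * (- 2 * defect z)"
    using MVT2[OF \<open>s < t\<close>, of isop "\<lambda>t. - 2 * defect t"] isop_derivative ancient[OF t] by blast
  have "(t - s) * \<delta> \<le> (t - s) * defect z" using \<open>s < t\<close> D z by (intro mult_left_mono) auto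
  moreover have "(t - s) * \<delta> = 16 * pi\<^sup>2 + 1" using \<delta> by (simp add: s_def)
  moreover have "0 < isop t" using len_pos[OF t] by (simp add: isop_def add_pos_nonneg)
  moreover have "isop s \<le> 16 * pi\<^sup>2 + 1" by (rule isop_le[OF sI \<open>\<bar>totcur s\<bar> < 1\<close>])
  moreover have "0 < 16 * pi\<^sup>2 + (1::real)" by (intro add_nonneg_pos) auto
  ultimately show False using z(3) by (simp add: algebra_simps)
qed

text \<open>As \<open>len\<close> is nonincreasing, \<open>m\<^sup>2 \<le> totcur\<^sup>2 / len(t0)\<^sup>2\<close> for the mean curvature at times
  before \<open>t0\<close>, so \<open>Q' \<le> (2 Q + 2 a totcur\<^sup>2) Q\<close> as long as \<open>Q \<le> 1\<close>. Because
  \<open>isop' = - 2 Q\<close> and \<open>(totcur\<^sup>2)' = 2 totcur\<^sup>2\<close>, the function \<open>P = Q exp (isop - a totcur\<^sup>2)\<close> is then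
  nonincreasing. The exponent is bounded, which compares \<open>Q\<close> at two times up to a constant \<open>C\<close>.
  Starting where \<open>Q C < 1\<close>, the condition \<open>Q \<le> 1\<close> cannot fail for a first time, so the
  comparison holds up to \<open>t0\<close>; and the starting value can be made as small as desired.\<close>

lemma defect_zero_early:
  assumes t0: "t0 \<in> I" and small: "\<bar>totcur t0\<bar> < 1"
  shows "defect t0 = 0"
proof -
  define a where "a = 1 + 4 / (len t0)\<^sup>2"
  define C where "C = exp (16 * pi\<^sup>2 + 1 + a)"
  have a: "0 \<le> a" by (simp add: a_def)
  have tI: "t \<in> I" if "t \<le> t0" for t using ancient[OF t0 that] .
  have K: "\<bar>totcur t\<bar> < 1" if "t \<le> t0" for t
  proof -
    have "exp (t - t0) \<le> 1" using that by simp
    then have "\<bar>totcur t0\<bar> * exp (t - t0) \<le> \<bar>totcur t0\<bar> * 1" by (intro mult_left_mono) auto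
    then show ?thesis using small by (simp add: totcur_exp[OF tI[OF that] t0] abs_mult)
  qed
  have len_ge: "len t0 \<le> len t" if "t \<le> t0" for t
  proof (rule DERIV_nonpos_imp_nonincreasing[OF that])
    fix s assume "t \<le> s" "s \<le> t0"
    then have s: "s \<in> I" using tI by simp
    have "0 \<le> bend s"
      unfolding bend_def loop_int_def using s spd_pos
      by (intro integral_nonneg integrable_continuous_real continuous_on_slice) (auto simp: less_imp_le intro: smooth_spd_cur2)
    then show "\<exists>y. (len has_real_derivative y) (at s) \<and> y \<le> 0" using len_derivative[OF s] by force
  qed
  have m: "4 * (meancur t)\<^sup>2 \<le> 4 / (len t0)\<^sup>2 * (totcur t)\<^sup>2" if "t \<le> t0" for t
  proof -
    have "(len t0)\<^sup>2 \<le> (len t)\<^sup>2" using len_ge[OF that] len_pos[OF t0] by (intro power_mono) auto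
    then have "(totcur t)\<^sup>2 / (len t)\<^sup>2 \<le> (totcur t)\<^sup>2 / (len t0)\<^sup>2"
      using len_pos[OF t0] len_pos[OF tI[OF that]] by (intro divide_left_mono) auto
    then show ?thesis by (simp add: meancur_def power_divide)
  qed
  define P where "P t = defect t * exp (isop t - a * (totcur t)\<^sup>2)" for t
  define d where "d t = 2 * defect t - 2 * (len t * diss t) + (len t * quart t - (bend t)\<^sup>2)" for t
  have P_der: "(P has_real_derivative
      (d t - 2 * (defect t)\<^sup>2 - 2 * a * (totcur t)\<^sup>2 * defect t) * exp (isop t - a * (totcur t)\<^sup>2)) (at t)"
    if "t \<le> t0" for t
    unfolding P_def[abs_def] d_def
    by (auto intro!: derivative_eq_intros defect_derivative isop_derivative totcur_derivative tI that)
      (simp add: power2_eq_square algebra_simps)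
  have P_nonpos: "(d t - 2 * (defect t)\<^sup>2 - 2 * a * (totcur t)\<^sup>2 * defect t) * exp (isop t - a * (totcur t)\<^sup>2) \<le> 0"
    if t: "t \<le> t0" "defect t \<le> 1" for t
  proof (intro mult_nonpos_nonneg)
    have "d t \<le> 2 * (defect t + (totcur t)\<^sup>2 + 4 * (meancur t)\<^sup>2) * defect t"
      unfolding d_def by (rule defect_derivative_le[OF tI[OF t(1)] K[OF t(1)] t(2)])
    also have "\<dots> \<le> 2 * (defect t + (totcur t)\<^sup>2 + 4 / (len t0)\<^sup>2 * (totcur t)\<^sup>2) * defect t"
      using m[OF t(1)] defect_nonneg[OF tI[OF t(1)]] by (intro mult_right_mono mult_left_mono add_mono) auto
    finally show "d t - 2 * (defect t)\<^sup>2 - 2 * a * (totcur t)\<^sup>2 * defect t \<le> 0"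
      by (simp add: a_def power2_eq_square algebra_simps)
  qed auto
  have step: "defect t \<le> defect t1 * C"
    if t1: "t1 \<le> t" and t: "t \<le> t0" and le1: "\<And>s. t1 < s \<Longrightarrow> s < t \<Longrightarrow> defect s \<le> 1" for t1 t
  proof -
    have "P t \<le> P t1"
    proof (cases "t1 = t")
      case False
      show ?thesis
      proof (rule DERIV_nonpos_imp_decreasing_open[of t1 t P])
        show "\<exists>y. (P has_real_derivative y) (at s) \<and> y \<le> 0" if "t1 < s" "s < t" for s
          using P_der[of s] P_nonpos[of s] le1[OF that] that t by auto
        show "continuous_on {t1..t} P"
          using DERIV_isCont[OF P_der] t by (auto intro!: continuous_at_imp_continuous_on)
      qed (use t1 in auto)
    qed simp
    have D: "0 \<le> defect t" "0 \<le> defect t1" using defect_nonneg tI t t1 by auto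
    have Kt: "(totcur t)\<^sup>2 < 1" using K[OF t] by (simp add: abs_square_less_1)
    then have "a * (totcur t)\<^sup>2 \<le> a * 1" using a by (intro mult_left_mono) auto
    then have "isop t - a * (totcur t)\<^sup>2 \<ge> - a"
      using zero_le_power2[of "len t"] zero_le_power2[of "totcur t"] unfolding isop_def by linarith
    then have "defect t * exp (- a) \<le> P t" unfolding P_def using D by (intro mult_left_mono) auto
    also note \<open>P t \<le> P t1\<close>
    also have "P t1 \<le> defect t1 * exp (16 * pi\<^sup>2 + 1)"
    proof -
      have "0 \<le> a * (totcur t1)\<^sup>2" using a by simp
      then have "isop t1 - a * (totcur t1)\<^sup>2 \<le> 16 * pi\<^sup>2 + 1"
        using isop_le[of t1] tI[of t1] K[of t1] t t1 by simp
      then show ?thesis unfolding P_def using D by (intro mult_left_mono) auto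
    qed
    finally have "defect t * exp (- a) * exp a \<le> defect t1 * exp (16 * pi\<^sup>2 + 1) * exp a"
      by (intro mult_right_mono) auto
    moreover have "exp (- a) * exp a = 1" by (simp add: exp_minus)
    ultimately show ?thesis by (simp add: C_def exp_add[of _ a] mult.assoc)
  qed
  have C: "0 < C" by (simp add: C_def)
  have bound: "defect t0 \<le> defect t1 * C" if t1: "t1 \<le> t0" and less: "defect t1 * C < 1" for t1
  proof -
    have "defect s < 1" if s: "t1 \<le> s" "s \<le> t0" for s
    proof (rule ccontr)
      assume *: "\<not> defect s < 1"
      define A where "A = {r \<in> {t1..t0}. 1 \<le> defect r}"
      have "continuous_on {t1..t0} defect"
        using DERIV_isCont[OF defect_derivative] tI by (auto intro!: continuous_at_imp_continuous_on)
      then have "closed ({t1..t0} \<inter> defect -` {1..})" by (intro continuous_closed_preimage) auto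
      moreover have A: "A = {t1..t0} \<inter> defect -` {1..}" by (auto simp: A_def)
      moreover have "bounded A"
        unfolding A by (rule bounded_subset[OF bounded_closed_interval]) auto
      ultimately have "compact A" by (simp add: compact_eq_bounded_closed)
      moreover have "A \<noteq> {}" using * s by (auto simp: A_def)
      ultimately obtain r where r: "r \<in> A" "\<And>q. q \<in> A \<Longrightarrow> r \<le> q" using compact_attains_inf by metis
      have "defect q \<le> 1" if "t1 < q" "q < r" for q
      proof -
        have "q \<notin> A" using r(2)[of q] that(2) by (meson not_less)
        moreover have "q \<in> {t1..t0}" using that r(1) by (simp add: A_def)
        ultimately have "\<not> 1 \<le> defect q" by (simp add: A_def)
        then show ?thesis by (rule less_imp_le[OF not_le_imp_less])
      qed
      then have "defect r \<le> defect t1 * C" using r(1) by (intro step) (auto simp: A_def)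
      then show False using less r(1) by (simp add: A_def)
    qed
    then show ?thesis using t1 by (intro step) (auto simp: less_imp_le)
  qed
  have "defect t0 \<le> \<epsilon>" if "0 < \<epsilon>" for \<epsilon>
  proof -
    obtain t1 where t1: "t1 \<le> t0" "defect t1 < min 1 \<epsilon> / C"
      using defect_small_somewhere[OF t0 small, of "min 1 \<epsilon> / C"] \<open>0 < \<epsilon>\<close> C by auto
    then have "defect t1 * C < min 1 \<epsilon>" using C by (simp add: field_simps)
    with bound[OF t1(1)] show ?thesis by simp
  qed
  then have "defect t0 \<le> 0" by (rule field_le_epsilon) simp
  then show ?thesis using defect_nonneg[OF t0] by simp
qed

lemma defect_zero:
  assumes t: "t \<in> I"
  shows "defect t = 0"
proof -
  define s where "s = t - ln (1 + \<bar>totcur t\<bar>)"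
  have s: "s \<le> t" "s \<in> I" using ancient[OF t] by (auto simp: s_def)
  have "totcur s = totcur t / (1 + \<bar>totcur t\<bar>)"
    unfolding totcur_exp[OF s(2) t] by (simp add: s_def exp_minus divide_inverse)
  then have "\<bar>totcur s\<bar> < 1" by (simp add: abs_divide)
  then show ?thesis using defect_zero_early[OF s(2)] defect_zero_forward[OF s(2) t s(1)] by blast
qed

end

section \<open>Solutions whose curvature is constant along each curve\<close>

lemma zero_derivative_constant:
  fixes f :: "real \<Rightarrow> 'a::real_normed_vector"
  assumes "convex S" "\<And>x. x \<in> S \<Longrightarrow> (f has_vector_derivative 0) (at x)" "x \<in> S" "y \<in> S"
  shows "f x = f y"
proof -
  have "\<And>x. x \<in> S \<Longrightarrow> (f has_derivative (\<lambda>h. 0)) (at x within S)"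
    using assms(2) by (auto simp: has_vector_derivative_def intro: has_derivative_at_withinI)
  then obtain c where "\<And>x. x \<in> S \<Longrightarrow> f x = c"
    using has_derivative_zero_constant[OF assms(1)] by metis
  then show ?thesis using assms by simp
qed

text \<open>The system \<open>e' = \<omega> \<tau>\<close>, \<open>\<tau>' = - \<omega> e\<close> rotates the orthonormal pair by the angle
  \<open>\<alpha> = \<integral> \<omega>\<close>. As \<open>e\<close> closes up after \<open>2\<pi>\<close>, the angle has then grown by a positive multiple of
  \<open>2\<pi>\<close>, so \<open>e\<close> has passed through the whole unit circle orthogonal to \<open>p\<close>.\<close>

lemma great_circle_parametrisation:
  fixes e \<tau> :: "real \<Rightarrow> real^3" and p z :: "real^3" and \<omega> :: "real \<Rightarrow> real"
  assumes e: "\<And>s. (e has_vector_derivative \<omega> s *\<^sub>R \<tau> s) (at s)"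
    and \<tau>: "\<And>s. (\<tau> has_vector_derivative - \<omega> s *\<^sub>R e s) (at s)"
    and \<omega>: "\<And>s. 0 < \<omega> s" "continuous_on UNIV \<omega>"
    and on: "e 0 \<bullet> e 0 = 1" "\<tau> 0 \<bullet> \<tau> 0 = 1" "e 0 \<bullet> \<tau> 0 = 0" "e 0 \<bullet> p = 0" "\<tau> 0 \<bullet> p = 0" "p \<noteq> 0"
    and closed: "e (2 * pi) = e 0"
    and z: "z \<bullet> z = 1" "z \<bullet> p = 0"
  shows "\<exists>s. e s = z"
proof -
  define \<alpha> where "\<alpha> s = integral {0..s} \<omega>" for s
  have \<alpha>_der: "(\<alpha> has_real_derivative \<omega> s) (at s within {0..2*pi})" if "s \<in> {0..2*pi}" for s
    unfolding \<alpha>_def using that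
    by (intro integral_has_real_derivative continuous_on_subset[OF \<omega>(2)]) auto
  have \<alpha>_cont: "continuous_on {0..2*pi} \<alpha>"
    using DERIV_continuous[OF \<alpha>_der] by (simp add: continuous_on_eq_continuous_within)
  have e_der: "(e has_vector_derivative \<omega> s *\<^sub>R \<tau> s) (at s within {0..2*pi})"
    and \<tau>_der: "(\<tau> has_vector_derivative - \<omega> s *\<^sub>R e s) (at s within {0..2*pi})" for s
    using e \<tau> has_vector_derivative_at_within by blast+
  have cos_der: "((\<lambda>s. cos (\<alpha> s)) has_real_derivative - sin (\<alpha> s) * \<omega> s) (at s within {0..2*pi})"
    and sin_der: "((\<lambda>s. sin (\<alpha> s)) has_real_derivative cos (\<alpha> s) * \<omega> s) (at s within {0..2*pi})"
    if "s \<in> {0..2*pi}" for s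
    by (auto intro!: derivative_eq_intros \<alpha>_der[OF that])
  have sol: "cos (\<alpha> s) *\<^sub>R e s - sin (\<alpha> s) *\<^sub>R \<tau> s = e 0 \<and> sin (\<alpha> s) *\<^sub>R e s + cos (\<alpha> s) *\<^sub>R \<tau> s = \<tau> 0"
    if s: "s \<in> {0..2*pi}" for s
  proof -
    have "((\<lambda>s. cos (\<alpha> s) *\<^sub>R e s - sin (\<alpha> s) *\<^sub>R \<tau> s) has_vector_derivative
        (cos (\<alpha> s) *\<^sub>R (\<omega> s *\<^sub>R \<tau> s) + (- sin (\<alpha> s) * \<omega> s) *\<^sub>R e s)
        - (sin (\<alpha> s) *\<^sub>R (- \<omega> s *\<^sub>R e s) + (cos (\<alpha> s) * \<omega> s) *\<^sub>R \<tau> s)) (at s within {0..2*pi})"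
      "((\<lambda>s. sin (\<alpha> s) *\<^sub>R e s + cos (\<alpha> s) *\<^sub>R \<tau> s) has_vector_derivative
        (sin (\<alpha> s) *\<^sub>R (\<omega> s *\<^sub>R \<tau> s) + (cos (\<alpha> s) * \<omega> s) *\<^sub>R e s)
        + (cos (\<alpha> s) *\<^sub>R (- \<omega> s *\<^sub>R e s) + (- sin (\<alpha> s) * \<omega> s) *\<^sub>R \<tau> s)) (at s within {0..2*pi})"
      if "s \<in> {0..2*pi}" for s
      by (intro has_vector_derivative_diff has_vector_derivative_add has_vector_derivative_scaleR
          cos_der[OF that] sin_der[OF that] e_der \<tau>_der)+
    then have zero: "((\<lambda>s. cos (\<alpha> s) *\<^sub>R e s - sin (\<alpha> s) *\<^sub>R \<tau> s) has_vector_derivative 0) (at s within {0..2*pi})"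
      "((\<lambda>s. sin (\<alpha> s) *\<^sub>R e s + cos (\<alpha> s) *\<^sub>R \<tau> s) has_vector_derivative 0) (at s within {0..2*pi})"
      if "s \<in> {0..2*pi}" for s
      using that by (simp_all add: mult.commute)
    have "cos (\<alpha> s) *\<^sub>R e s - sin (\<alpha> s) *\<^sub>R \<tau> s = cos (\<alpha> 0) *\<^sub>R e 0 - sin (\<alpha> 0) *\<^sub>R \<tau> 0"
      "sin (\<alpha> s) *\<^sub>R e s + cos (\<alpha> s) *\<^sub>R \<tau> s = sin (\<alpha> 0) *\<^sub>R e 0 + cos (\<alpha> 0) *\<^sub>R \<tau> 0"
      using has_vector_derivative_zero_constant[OF convex_closed_interval zero(1)]
        has_vector_derivative_zero_constant[OF convex_closed_interval zero(2)] s
      by (metis (no_types, lifting) atLeastAtMost_iff order_refl order_trans)+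
    then show ?thesis by (simp add: \<alpha>_def)
  qed
  have e_eq: "e s = cos (\<alpha> s) *\<^sub>R e 0 + sin (\<alpha> s) *\<^sub>R \<tau> 0" if "s \<in> {0..2*pi}" for s
  proof -
    have rotate: "c *\<^sub>R (c *\<^sub>R x - d *\<^sub>R y) + d *\<^sub>R (d *\<^sub>R x + c *\<^sub>R y) = (c\<^sup>2 + d\<^sup>2) *\<^sub>R x" for c d and x y :: "real^3"
      by (simp add: algebra_simps power2_eq_square)
    have "cos (\<alpha> s) *\<^sub>R e 0 + sin (\<alpha> s) *\<^sub>R \<tau> 0
        = cos (\<alpha> s) *\<^sub>R (cos (\<alpha> s) *\<^sub>R e s - sin (\<alpha> s) *\<^sub>R \<tau> s) + sin (\<alpha> s) *\<^sub>R (sin (\<alpha> s) *\<^sub>R e s + cos (\<alpha> s) *\<^sub>R \<tau> s)"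
      using sol[OF that] by simp
    also have "\<dots> = ((cos (\<alpha> s))\<^sup>2 + (sin (\<alpha> s))\<^sup>2) *\<^sub>R e s"
      by (rule rotate)
    finally show ?thesis by simp
  qed
  have "0 < \<alpha> (2 * pi)"
    unfolding \<alpha>_def
    using integral_less_real[of 0 "2*pi" "\<lambda>_. 0" \<omega>] \<omega>(1) continuous_on_subset[OF \<omega>(2), of "{0..2*pi}"] pi_gt_zero
    by (simp add: not_le)
  have "cos (\<alpha> (2 * pi)) = 1"
  proof -
    have "e 0 \<bullet> e 0 = (cos (\<alpha> (2 * pi)) *\<^sub>R e 0 + sin (\<alpha> (2 * pi)) *\<^sub>R \<tau> 0) \<bullet> e 0"
      using e_eq[of "2 * pi"] closed by simp
    then show ?thesis using on inner_commute[of "\<tau> 0" "e 0"] by (simp add: inner_add_left)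
  qed
  then obtain m :: int where m: "\<alpha> (2 * pi) = of_int m * (2 * pi)"
    using cos_one_2pi_int by auto
  with \<open>0 < \<alpha> (2 * pi)\<close> have "0 < m" by (simp add: zero_less_mult_iff)
  then have "1 \<le> (of_int m :: real)" by simp
  then have "2 * pi \<le> \<alpha> (2 * pi)" unfolding m by simp
  have "p = (p \<bullet> cross3 (e 0) (\<tau> 0)) *\<^sub>R cross3 (e 0) (\<tau> 0)"
    using orthonormal_expansion[of "e 0" "\<tau> 0" p] on by (simp add: inner_commute)
  then have "z \<bullet> p = (p \<bullet> cross3 (e 0) (\<tau> 0)) * (z \<bullet> cross3 (e 0) (\<tau> 0))"
    by (metis inner_scaleR_right)
  moreover have "p \<bullet> cross3 (e 0) (\<tau> 0) \<noteq> 0"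
    using \<open>p = _\<close> \<open>p \<noteq> 0\<close> by auto
  ultimately have "z \<bullet> cross3 (e 0) (\<tau> 0) = 0" using z by simp
  then have z_eq: "z = (z \<bullet> e 0) *\<^sub>R e 0 + (z \<bullet> \<tau> 0) *\<^sub>R \<tau> 0"
    using orthonormal_expansion[of "e 0" "\<tau> 0" z] on by simp
  have "1 = z \<bullet> ((z \<bullet> e 0) *\<^sub>R e 0 + (z \<bullet> \<tau> 0) *\<^sub>R \<tau> 0)"
    unfolding z_eq[symmetric] by (simp add: z)
  then have "(z \<bullet> e 0)\<^sup>2 + (z \<bullet> \<tau> 0)\<^sup>2 = 1"
    by (simp add: inner_add_right power2_eq_square)
  then obtain \<theta> where \<theta>: "0 \<le> \<theta>" "\<theta> < 2 * pi" "z \<bullet> e 0 = cos \<theta>" "z \<bullet> \<tau> 0 = sin \<theta>"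
    using sincos_total_2pi by metis
  have "\<alpha> 0 = 0" by (simp add: \<alpha>_def)
  then obtain s where "s \<in> {0..2*pi}" "\<alpha> s = \<theta>"
    using IVT'[of \<alpha> 0 \<theta> "2 * pi"] \<alpha>_cont \<theta> \<open>2 * pi \<le> \<alpha> (2 * pi)\<close> by auto
  then have "e s = z" using e_eq z_eq \<theta> by metis
  then show ?thesis ..
qed

context csf
begin

lemma spd_dt_cur:
  assumes x: "x \<in> dom"
  shows "spd x * dt cur x = spd x * (cur x ^ 3 + cur x) + ds curs x"
  using dt_mult[OF smooth_spd smooth_cur x] dt_spd_cur[OF x]
  by (simp add: dt_spd x power2_eq_square power3_eq_cube algebra_simps)

end

text \<open>Solutions of constant curvature \<open>k t\<close> at each time; \<open>t0\<close> is a reference time.\<close>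

locale circular_csf = csf +
  fixes k :: "real \<Rightarrow> real" and t0 :: real
  assumes cur_eq: "\<And>t s. t \<in> I \<Longrightarrow> cur (t, s) = k t" and t0: "t0 \<in> I"
begin

lemma ds_cur: assumes "x \<in> dom" shows "ds cur x = 0"
proof -
  obtain t s where x: "x = (t, s)" "t \<in> I" using assms by auto
  have "((\<lambda>s. k t) has_vector_derivative ds cur (t, s)) (at s)"
    using has_vector_derivative_ds[OF smooth_cur, of t s UNIV] x cur_eq[OF x(2)] by simp
  moreover have "((\<lambda>s. k t) has_vector_derivative 0) (at s)" by (rule has_vector_derivative_const)
  ultimately show ?thesis unfolding x(1) by (rule vector_derivative_unique_at)
qed

lemma dt_cur: assumes x: "x \<in> dom" shows "dt cur x = cur x ^ 3 + cur x"
proof -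
  have "ds curs x = ds (\<lambda>x. 0) x"
    by (rule ds_cong[OF smooth_on_const[OF open_dom] x]) (simp add: curs_def ds_cur)
  then have "ds curs x = 0" by (simp add: ds_def)
  then show ?thesis using spd_dt_cur[OF x] spd_pos[OF x] by simp
qed

lemma k_derivative:
  assumes t: "t \<in> I"
  shows "(k has_real_derivative k t ^ 3 + k t) (at t)"
proof -
  have "((\<lambda>t. cur (t, 0)) has_real_derivative k t ^ 3 + k t) (at t)"
    using has_vector_derivative_dt[OF smooth_cur, of t 0 UNIV] t
    by (simp add: dt_cur cur_eq has_real_derivative_iff_has_vector_derivative)
  then show ?thesis
    by (rule has_field_derivative_transform_within_open[OF _ open_I t]) (rule cur_eq)
qed

text \<open>The sine and cosine of the radius of a circle of geodesic curvature \<open>k\<close>, which is the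
  cotangent of the radius.\<close>

definition sinr :: "real \<Rightarrow> real" where "sinr t = inverse (sqrt (1 + (k t)\<^sup>2))"
definition cosr :: "real \<Rightarrow> real" where "cosr t = k t * sinr t"

lemma one_plus_k2_pos: "0 < 1 + (k t)\<^sup>2" by (simp add: add_pos_nonneg)

lemma sinr_pos: "0 < sinr t" using one_plus_k2_pos[of t] by (simp add: sinr_def)

lemma sinr2: "(sinr t)\<^sup>2 * (1 + (k t)\<^sup>2) = 1"
  using one_plus_k2_pos[of t] by (simp add: sinr_def power_inverse)

lemma cosr2: "(cosr t)\<^sup>2 + (sinr t)\<^sup>2 = 1"
  using sinr2[of t] by (simp add: cosr_def power_mult_distrib algebra_simps)

lemma sinr_derivative:
  assumes t: "t \<in> I"
  shows "(sinr has_real_derivative - (k t)\<^sup>2 * sinr t) (at t)"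
proof -
  define w where "w = sqrt (1 + (k t)\<^sup>2)"
  have w: "0 < w" "w\<^sup>2 = 1 + (k t)\<^sup>2" using one_plus_k2_pos[of t] by (simp_all add: w_def)
  have "((\<lambda>t. 1 + (k t)\<^sup>2) has_real_derivative 2 * k t * (k t ^ 3 + k t)) (at t)"
    using k_derivative[OF t] by (auto intro!: derivative_eq_intros)
  from DERIV_inverse'[OF DERIV_chain2[OF DERIV_real_sqrt[OF one_plus_k2_pos] this]] w(1)
  have "((\<lambda>t. inverse (sqrt (1 + (k t)\<^sup>2))) has_real_derivative
      - (inverse w * (inverse w / 2 * (2 * k t * (k t ^ 3 + k t))) * inverse w)) (at t)"
    by (simp add: w_def)
  also have "2 * k t * (k t ^ 3 + k t) = 2 * (k t)\<^sup>2 * w\<^sup>2"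
    unfolding w by (simp add: power2_eq_square power3_eq_cube algebra_simps)
  also have "- (inverse w * (inverse w / 2 * (2 * (k t)\<^sup>2 * w\<^sup>2)) * inverse w) = - (k t)\<^sup>2 * sinr t"
  proof -
    have "sinr t = inverse w" by (simp add: sinr_def w_def)
    then show ?thesis using w(1) by (simp add: power2_eq_square field_simps)
  qed
  finally show ?thesis by (simp add: sinr_def[abs_def])
qed

lemma cosr_derivative:
  assumes t: "t \<in> I"
  shows "(cosr has_real_derivative cosr t) (at t)"
  using DERIV_mult[OF k_derivative[OF t] sinr_derivative[OF t]]
  by (simp add: cosr_def[abs_def] power2_eq_square power3_eq_cube algebra_simps)

lemma cosr_exp:
  assumes "t \<in> I"
  shows "cosr t = cosr t0 * exp (- t0) * exp t"
proof -
  have "cosr t * exp (- t) = cosr t0 * exp (- t0)"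
  proof (rule zero_derivative_constant[where f="\<lambda>t. cosr t * exp (- t)", OF convex_I _ assms t0])
    fix t assume "t \<in> I"
    from DERIV_mult[OF cosr_derivative[OF this] DERIV_fun_exp[OF DERIV_minus[OF DERIV_ident]]]
    show "((\<lambda>t. cosr t * exp (- t)) has_vector_derivative 0) (at t)"
      by (simp add: has_real_derivative_iff_has_vector_derivative)
  qed
  moreover have "cosr t = (cosr t * exp (- t)) * exp t" by (simp add: exp_minus)
  ultimately show ?thesis by simp
qed

text \<open>The centre of the circle as seen from the point with parameter \<open>s\<close>, and the direction in
  which that point lies as seen from the centre.\<close>

definition ctr :: "real \<Rightarrow> real \<Rightarrow> real^3" where
  "ctr t s = sinr t *\<^sub>R (nor (t, s) + k t *\<^sub>R pos (t, s))"

definition dir :: "real \<Rightarrow> real \<Rightarrow> real^3" where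
  "dir t s = inverse (sinr t) *\<^sub>R (pos (t, s) - cosr t *\<^sub>R ctr t s)"

definition center :: "real^3" where "center = ctr t0 0"

text \<open>The vector \<open>\<nu> + k \<gamma>\<close> is constant along the curve by the Frenet equations, and its time
  derivative is \<open>k\<^sup>2\<close> times itself because \<open>k' = k\<^sup>3 + k\<close>; the factor \<open>sinr\<close> normalises it.\<close>

lemma ctr_eq:
  assumes t: "t \<in> I"
  shows "ctr t s = center"
proof -
  have space: "ctr t s = ctr t 0" if t: "t \<in> I" for t s :: real
  proof (rule zero_derivative_constant[where f="ctr t", OF convex_UNIV])
    fix s
    have "((\<lambda>s. sinr t *\<^sub>R (nor (t, s) + k t *\<^sub>R pos (t, s))) has_vector_derivative
        sinr t *\<^sub>R (ds nor (t, s) + k t *\<^sub>R ds pos (t, s))) (at s)"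
      using t by (intro bounded_linear.has_vector_derivative[OF bounded_linear_scaleR_right]
          has_vector_derivative_add has_vector_derivative_ds[OF smooth_nor] has_vector_derivative_ds[OF smooth_pos]) auto
    then show "(ctr t has_vector_derivative 0) (at s)"
      using t by (simp add: ctr_def[abs_def] ds_nor ds_pos cur_eq mult.commute)
  qed auto
  have "ctr t 0 = ctr t0 0"
  proof (rule zero_derivative_constant[where f="\<lambda>t. ctr t 0", OF convex_I _ t t0])
    fix t assume t: "t \<in> I"
    have "((\<lambda>t. nor (t, 0) + k t *\<^sub>R pos (t, 0)) has_vector_derivative
        dt nor (t, 0) + (k t *\<^sub>R dt pos (t, 0) + (k t ^ 3 + k t) *\<^sub>R pos (t, 0))) (at t)"
      using t by (intro has_vector_derivative_add has_vector_derivative_scaleR k_derivative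
          has_vector_derivative_dt[OF smooth_nor] has_vector_derivative_dt[OF smooth_pos]) auto
    also have "dt nor (t, 0) + (k t *\<^sub>R dt pos (t, 0) + (k t ^ 3 + k t) *\<^sub>R pos (t, 0))
        = (k t)\<^sup>2 *\<^sub>R (nor (t, 0) + k t *\<^sub>R pos (t, 0))"
      using t by (simp add: dt_nor dt_pos ds_cur cur_eq algebra_simps power2_eq_square power3_eq_cube)
    finally have "((\<lambda>t. sinr t *\<^sub>R (nor (t, 0) + k t *\<^sub>R pos (t, 0))) has_vector_derivative
        sinr t *\<^sub>R ((k t)\<^sup>2 *\<^sub>R (nor (t, 0) + k t *\<^sub>R pos (t, 0)))
        + (- (k t)\<^sup>2 * sinr t) *\<^sub>R (nor (t, 0) + k t *\<^sub>R pos (t, 0))) (at t)"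
      by (rule has_vector_derivative_scaleR[OF sinr_derivative[OF t]])
    then show "((\<lambda>t. ctr t 0) has_vector_derivative 0) (at t)"
      by (simp add: ctr_def mult.commute)
  qed
  then show ?thesis using space[OF t, of s] by (simp add: center_def)
qed

lemma center_unit: "center \<bullet> center = 1"
  using sinr2[of t0] t0 unfolding center_def ctr_def
  by (simp add: inner_add_left inner_add_right frame power2_eq_square algebra_simps)

lemma nor_eq: assumes t: "t \<in> I" shows "nor (t, s) = inverse (sinr t) *\<^sub>R center - k t *\<^sub>R pos (t, s)"
  using sinr_pos[of t] unfolding ctr_eq[OF t, of s, symmetric] ctr_def by simp

lemma pos_center: assumes t: "t \<in> I" shows "pos (t, s) \<bullet> center = cosr t"
  using t unfolding ctr_eq[OF t, of s, symmetric] ctr_def by (simp add: inner_add_right frame cosr_def)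

lemma tang_center: assumes t: "t \<in> I" shows "tang (t, s) \<bullet> center = 0"
  using t unfolding ctr_eq[OF t, of s, symmetric] ctr_def by (simp add: inner_add_right frame)

lemma pos_eq: assumes t: "t \<in> I" shows "pos (t, s) = cosr t *\<^sub>R center + sinr t *\<^sub>R dir t s"
  using sinr_pos[of t] by (simp add: dir_def ctr_eq[OF t])

lemma dir_center: assumes t: "t \<in> I" shows "dir t s \<bullet> center = 0"
  by (simp add: dir_def ctr_eq[OF t] inner_diff_left pos_center[OF t] center_unit)

lemma dir_unit: assumes t: "t \<in> I" shows "dir t s \<bullet> dir t s = 1"
proof -
  have "sinr t *\<^sub>R dir t s = pos (t, s) - cosr t *\<^sub>R center"
    by (simp only: pos_eq[OF t] add_diff_cancel_left')
  then have "(sinr t *\<^sub>R dir t s) \<bullet> (sinr t *\<^sub>R dir t s)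
      = (pos (t, s) - cosr t *\<^sub>R center) \<bullet> (pos (t, s) - cosr t *\<^sub>R center)" by simp
  also have "(sinr t *\<^sub>R dir t s) \<bullet> (sinr t *\<^sub>R dir t s) = (sinr t)\<^sup>2 * (dir t s \<bullet> dir t s)"
    by (simp add: power2_eq_square)
  also have "(pos (t, s) - cosr t *\<^sub>R center) \<bullet> (pos (t, s) - cosr t *\<^sub>R center) = 1 - (cosr t)\<^sup>2"
  proof -
    have "(x - c *\<^sub>R p) \<bullet> (x - c *\<^sub>R p) = x \<bullet> x - 2 * c * (x \<bullet> p) + c * c * (p \<bullet> p)" for x p :: "real^3" and c
      by (simp add: inner_diff_left inner_diff_right inner_commute)
    then show ?thesis
      using frame(1)[of "(t, s)"] t by (simp add: pos_center center_unit power2_eq_square)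
  qed
  also have "\<dots> = (sinr t)\<^sup>2 * 1" using cosr2[of t] by linarith
  finally show ?thesis using sinr_pos[of t] by (simp only: mult_cancel_left power_eq_0_iff) simp
qed

lemma dir_tang: assumes t: "t \<in> I" shows "dir t s \<bullet> tang (t, s) = 0"
  using t by (simp add: dir_def ctr_eq inner_diff_left frame tang_center inner_commute[of center])

text \<open>The velocity \<open>k \<nu>\<close> is a combination of the centre and the position, so \<open>\<gamma> - cosr p\<close>
  changes only by a factor, which is that of \<open>sinr\<close>.\<close>

lemma dir_eq:
  assumes t: "t \<in> I"
  shows "dir t s = dir t0 s"
proof (rule zero_derivative_constant[where f="\<lambda>t. dir t s", OF convex_I _ t t0])
  fix t assume t: "t \<in> I"
  have pc: "((\<lambda>t. pos (t, s) - cosr t *\<^sub>R center) has_vector_derivative dt pos (t, s) - cosr t *\<^sub>R center) (at t)"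
    using has_vector_derivative_scaleR[OF cosr_derivative[OF t] has_vector_derivative_const, of center] t
    by (intro has_vector_derivative_diff has_vector_derivative_dt[OF smooth_pos]) auto
  have "(k t)\<^sup>2 * cosr t = k t * inverse (sinr t) - cosr t"
  proof -
    have "cosr t * (1 + (k t)\<^sup>2) * sinr t = k t * ((sinr t)\<^sup>2 * (1 + (k t)\<^sup>2))"
      by (simp add: cosr_def power2_eq_square)
    then have "k t * inverse (sinr t) = cosr t * (1 + (k t)\<^sup>2)"
      using sinr_pos[of t] unfolding sinr2 by (simp add: field_simps)
    then show ?thesis by (simp add: algebra_simps)
  qed
  note k2c = this
  have "dt pos (t, s) - cosr t *\<^sub>R center
      = (k t * inverse (sinr t) - cosr t) *\<^sub>R center - (k t)\<^sup>2 *\<^sub>R pos (t, s)"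
    using t by (simp add: dt_pos cur_eq nor_eq scaleR_diff_right scaleR_diff_left power2_eq_square)
  also have "\<dots> = - (k t)\<^sup>2 *\<^sub>R (pos (t, s) - cosr t *\<^sub>R center)"
    unfolding k2c[symmetric] by (simp add: scaleR_diff_right)
  finally have "dt pos (t, s) - cosr t *\<^sub>R center = - (k t)\<^sup>2 *\<^sub>R (pos (t, s) - cosr t *\<^sub>R center)" .
  note pc' = pc[unfolded this]
  have *: "((\<lambda>t. inverse (sinr t)) has_real_derivative - (inverse (sinr t) * (- (k t)\<^sup>2 * sinr t) * inverse (sinr t))) (at t)"
    using sinr_pos[of t] by (intro DERIV_inverse' sinr_derivative[OF t]) simp
  have inv: "((\<lambda>t. inverse (sinr t)) has_real_derivative (k t)\<^sup>2 * inverse (sinr t)) (at t)"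
  proof -
    have "- (inverse (sinr t) * (- (k t)\<^sup>2 * sinr t) * inverse (sinr t)) = (k t)\<^sup>2 * inverse (sinr t)"
      using sinr_pos[of t] by (simp add: field_simps)
    with * show ?thesis by (rule DERIV_cong)
  qed
  have "((\<lambda>t. inverse (sinr t) *\<^sub>R (pos (t, s) - cosr t *\<^sub>R center)) has_vector_derivative 0) (at t)"
    using has_vector_derivative_scaleR[OF inv pc'] by (simp add: mult.commute)
  then show "((\<lambda>t. dir t s) has_vector_derivative 0) (at t)"
    by (rule has_vector_derivative_transform_within_open[OF _ open_I t]) (simp add: dir_def ctr_eq)
qed

abbreviation rot :: "real \<Rightarrow> real" where "rot s \<equiv> spd (t0, s) * inverse (sinr t0)"

lemma dir_derivative: "(dir t0 has_vector_derivative rot s *\<^sub>R tang (t0, s)) (at s)"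
proof -
  have "((\<lambda>s. inverse (sinr t0) *\<^sub>R (pos (t0, s) - cosr t0 *\<^sub>R center)) has_vector_derivative
      inverse (sinr t0) *\<^sub>R (ds pos (t0, s) - 0)) (at s)"
    using t0 by (intro bounded_linear.has_vector_derivative[OF bounded_linear_scaleR_right]
        has_vector_derivative_diff has_vector_derivative_const has_vector_derivative_ds[OF smooth_pos]) auto
  then show ?thesis using t0 by (simp add: dir_def[abs_def] ctr_eq ds_pos mult.commute)
qed

lemma tang_derivative: "((\<lambda>s. tang (t0, s)) has_vector_derivative - rot s *\<^sub>R dir t0 s) (at s)"
proof -
  have "k t0 *\<^sub>R nor (t0, s) - pos (t0, s) = - inverse (sinr t0) *\<^sub>R dir t0 s"
  proof -
    have a: "inverse (sinr t0) * inverse (sinr t0) = 1 + (k t0)\<^sup>2"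
      using sinr2[of t0] sinr_pos[of t0] by (simp add: field_simps power2_eq_square)
    have b: "inverse (sinr t0) * inverse (sinr t0) * cosr t0 = k t0 * inverse (sinr t0)"
      using sinr_pos[of t0] by (simp add: cosr_def)
    have "- inverse (sinr t0) *\<^sub>R dir t0 s
        = (inverse (sinr t0) * inverse (sinr t0) * cosr t0) *\<^sub>R center - (inverse (sinr t0) * inverse (sinr t0)) *\<^sub>R pos (t0, s)"
      using t0 by (simp add: dir_def ctr_eq algebra_simps)
    also have "\<dots> = k t0 *\<^sub>R nor (t0, s) - pos (t0, s)"
      unfolding b unfolding a nor_eq[OF t0] by (simp add: algebra_simps power2_eq_square)
    finally show ?thesis by simp
  qed
  then have "ds tang (t0, s) = - rot s *\<^sub>R dir t0 s"
    using t0 by (simp add: ds_tang cur_eq)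
  then show ?thesis
    using has_vector_derivative_ds[OF smooth_tang, of t0 s UNIV] t0 by simp
qed

lemma dir_surj:
  assumes z: "z \<bullet> z = 1" "z \<bullet> center = 0"
  shows "\<exists>s. dir t0 s = z"
proof (rule great_circle_parametrisation[OF dir_derivative tang_derivative])
  show "0 < rot s" for s using t0 spd_pos sinr_pos by simp
  show "continuous_on UNIV rot"
    by (intro continuous_intros continuous_on_slice[OF smooth_spd t0])
  show "dir t0 (2 * pi) = dir t0 0"
    using pos_periodic[OF t0, of 0] t0 by (simp add: dir_def ctr_eq)
  show "center \<noteq> 0" using center_unit by auto
qed (use t0 z in \<open>auto simp: dir_unit dir_tang dir_center tang_center frame\<close>)

end

section \<open>Shrinking circles as explicit solutions\<close>

lemma S1_cis:
  assumes "z \<in> S1"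
  obtains s where "z = cis s"
proof
  have "z \<noteq> 0" "sgn z = z" using assms by (auto simp: sgn_div_norm)
  then show "z = cis (Arg z)" by (simp add: cis_Arg)
qed

text \<open>The circle at height \<open>a\<close> above the great circle traced by \<open>e\<close>, with pole \<open>p\<close>.\<close>

lemma circle_curvature_vector:
  fixes e \<tau> :: "real \<Rightarrow> real^3" and p :: "real^3" and \<omega> :: "real \<Rightarrow> real"
  assumes e: "\<And>s. (e has_vector_derivative \<omega> s *\<^sub>R \<tau> s) (at s)"
    and \<tau>: "\<And>s. (\<tau> has_vector_derivative - \<omega> s *\<^sub>R e s) (at s)"
    and \<omega>: "\<And>s. 0 < \<omega> s"
    and on: "\<And>s. e s \<bullet> e s = 1" "\<And>s. \<tau> s \<bullet> \<tau> s = 1" "\<And>s. e s \<bullet> p = 0"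
    and ab: "a\<^sup>2 + b\<^sup>2 = 1" "0 < b"
  defines "c \<equiv> \<lambda>s. a *\<^sub>R p + b *\<^sub>R e s"
  shows "vector_derivative c (at s) = (b * \<omega> s) *\<^sub>R \<tau> s"
    and "curvature_vector c s = a *\<^sub>R p - (a\<^sup>2 / b) *\<^sub>R e s"
proof -
  have c: "(c has_vector_derivative (b * \<omega> s) *\<^sub>R \<tau> s) (at s)" for s
  proof -
    have "(c has_vector_derivative 0 + b *\<^sub>R (\<omega> s *\<^sub>R \<tau> s)) (at s)"
      unfolding c_def
      by (intro has_vector_derivative_add has_vector_derivative_const
          bounded_linear.has_vector_derivative[OF bounded_linear_scaleR_right] e)
    then show ?thesis by simp
  qed
  show vd: "vector_derivative c (at s) = (b * \<omega> s) *\<^sub>R \<tau> s" for s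
    by (rule vector_derivative_at[OF c])
  have n: "norm (vector_derivative c (at s)) = b * \<omega> s" for s
    using ab(2) \<omega>[of s] on(2)[of s] unfolding vd by (simp add: norm_eq_sqrt_inner)
  have ut: "unit_tangent c = \<tau>"
  proof
    show "unit_tangent c s = \<tau> s" for s
      using ab(2) \<omega>[of s] unfolding unit_tangent_def n unfolding vd by (simp add: field_simps)
  qed
  have ce: "c s \<bullet> e s = b"
    using on(1,3)[of s] by (simp add: c_def inner_add_left inner_add_right inner_commute)
  have "curvature_vector c s = (- \<omega> s *\<^sub>R e s - (c s \<bullet> (- \<omega> s *\<^sub>R e s)) *\<^sub>R c s) /\<^sub>R (b * \<omega> s)"
    unfolding curvature_vector_def cov_deriv_def n ut vector_derivative_at[OF \<tau>] ..
  also have "\<dots> = (- (inverse (b * \<omega> s) * \<omega> s)) *\<^sub>R (e s - b *\<^sub>R c s)"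
    by (simp add: ce algebra_simps)
  also have "inverse (b * \<omega> s) * \<omega> s = 1 / b"
    using ab(2) \<omega>[of s] by (simp add: field_simps)
  also have "e s - b *\<^sub>R c s = (1 - b\<^sup>2) *\<^sub>R e s - (a * b) *\<^sub>R p"
    by (simp add: c_def algebra_simps power2_eq_square)
  also have "1 - b\<^sup>2 = a\<^sup>2" using ab(1) by simp
  also have "(- (1 / b)) *\<^sub>R (a\<^sup>2 *\<^sub>R e s - (a * b) *\<^sub>R p) = a *\<^sub>R p - (a\<^sup>2 / b) *\<^sub>R e s"
    using ab(2) by (simp add: scaleR_diff_right)
  finally show "curvature_vector c s = a *\<^sub>R p - (a\<^sup>2 / b) *\<^sub>R e s" .
qed

text \<open>With \<open>a = C e\<^sup>t\<close> and \<open>b = sqrt (1 - a\<^sup>2)\<close> the velocity is \<open>a p - (a\<^sup>2 / b) e\<close>, because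
  \<open>a' = a\<close>; this is the curvature vector found above.\<close>

lemma shrinking_circle_flow:
  fixes e :: "complex \<Rightarrow> real^3" and \<tau> :: "real \<Rightarrow> real^3" and p :: "real^3" and \<omega> :: "real \<Rightarrow> real"
  assumes I: "open I" and lt: "\<And>t. t \<in> I \<Longrightarrow> \<bar>C * exp t\<bar> < 1"
    and e_smooth: "smooth_on UNIV (ang e)" and inj: "inj_on e S1"
    and e: "\<And>s. (ang e has_vector_derivative \<omega> s *\<^sub>R \<tau> s) (at s)"
    and \<tau>: "\<And>s. (\<tau> has_vector_derivative - \<omega> s *\<^sub>R ang e s) (at s)"
    and \<omega>: "\<And>s. 0 < \<omega> s"
    and on: "\<And>s. ang e s \<bullet> ang e s = 1" "\<And>s. \<tau> s \<bullet> \<tau> s = 1" "\<And>s. ang e s \<bullet> p = 0" "p \<bullet> p = 1"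
  shows "curve_shortening_flow I (\<lambda>t z. (C * exp t) *\<^sub>R p + sqrt (1 - (C * exp t)\<^sup>2) *\<^sub>R e z)"
proof -
  define a b where "a t = C * exp t" and "b t = sqrt (1 - (a t)\<^sup>2)" for t
  have a1: "0 < 1 - (a t)\<^sup>2" if "t \<in> I" for t using lt[OF that] by (simp add: a_def abs_square_less_1)
  have ab: "(a t)\<^sup>2 + (b t)\<^sup>2 = 1" "0 < b t" if "t \<in> I" for t using a1[OF that] by (simp_all add: b_def)
  have a_smooth: "smooth_on UNIV a" unfolding a_def[abs_def] by (rule smooth_on_exp)
  have a_smooth': "smooth_on I a"
    using smooth_on_compose_linear[OF bounded_linear_ident I _ a_smooth] by simp
  have b_smooth: "smooth_on I b"
  proof (rule smooth_on_cong[OF I])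
    show "smooth_on I (\<lambda>t. (1 - a t * a t) powr (1/2))"
      using a1 by (intro smooth_on_powr smooth_on_diff smooth_on_mult smooth_on_const I a_smooth')
        (auto simp: power2_eq_square)
    show "(1 - a t * a t) powr (1/2) = b t" if "t \<in> I" for t
      using a1[OF that] by (simp add: b_def powr_half_sqrt power2_eq_square)
  qed
  have dom: "open (I \<times> (UNIV :: real set))" by (simp add: I open_Times)
  have fst: "smooth_on (I \<times> (UNIV::real set)) (\<lambda>x. g (fst x))" if "smooth_on I g" for g :: "real \<Rightarrow> real"
    by (rule smooth_on_compose_linear[OF bounded_linear_fst dom _ that]) auto
  have snd: "smooth_on (I \<times> (UNIV::real set)) (\<lambda>x. ang e (snd x))"
    by (rule smooth_on_compose_linear[OF bounded_linear_snd dom _ e_smooth]) auto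
  have "smooth_on (I \<times> UNIV) (\<lambda>x. a (fst x) *\<^sub>R p + b (fst x) *\<^sub>R ang e (snd x))"
    by (intro smooth_on_add smooth_on_scaleR dom fst snd smooth_on_const a_smooth' b_smooth)
  then have smooth: "smooth_on (I \<times> UNIV) (\<lambda>(t, s). a t *\<^sub>R p + b t *\<^sub>R ang e s)"
    unfolding case_prod_unfold .
  have embedding: "smooth_embedding (\<lambda>z. a t *\<^sub>R p + b t *\<^sub>R e z)" if t: "t \<in> I" for t
    unfolding smooth_embedding_def
  proof (intro conjI allI)
    show "(\<lambda>z. a t *\<^sub>R p + b t *\<^sub>R e z) ` S1 \<subseteq> S2"
    proof (rule image_subsetI)
      fix z :: complex assume "z \<in> S1"
      then obtain s where s: "z = cis s" by (rule S1_cis)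
      have "(a t *\<^sub>R p + b t *\<^sub>R ang e s) \<bullet> (a t *\<^sub>R p + b t *\<^sub>R ang e s) = 1"
      proof -
        have "(c *\<^sub>R p + d *\<^sub>R x) \<bullet> (c *\<^sub>R p + d *\<^sub>R x) = c\<^sup>2 * (p \<bullet> p) + 2 * c * d * (x \<bullet> p) + d\<^sup>2 * (x \<bullet> x)"
          for c d and x :: "real^3"
          by (simp add: inner_add_left inner_add_right inner_commute power2_eq_square algebra_simps)
        then show ?thesis by (simp add: on ab(1)[OF t])
      qed
      then show "a t *\<^sub>R p + b t *\<^sub>R e z \<in> S2" unfolding s by (simp only: mem_sphere_0 norm_eq_1)
    qed
    show "smooth_on UNIV (\<lambda>s. a t *\<^sub>R p + b t *\<^sub>R ang e s)"
      by (intro smooth_on_add smooth_on_scaleR smooth_on_const e_smooth) auto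
    show "inj_on (\<lambda>z. a t *\<^sub>R p + b t *\<^sub>R e z) S1"
      using inj ab(2)[OF t] by (auto simp: inj_on_def)
    show "vector_derivative (\<lambda>s. a t *\<^sub>R p + b t *\<^sub>R ang e s) (at s) \<noteq> 0" for s
      using circle_curvature_vector(1)[OF e \<tau> \<omega> on(1-3) ab[OF t]] ab(2)[OF t] \<omega>[of s] on(2)[of s]
      by auto
  qed
  have evolution: "((\<lambda>t. a t *\<^sub>R p + b t *\<^sub>R ang e s) has_vector_derivative
      curvature_vector (\<lambda>s. a t *\<^sub>R p + b t *\<^sub>R ang e s) s) (at t)" if t: "t \<in> I" for t s
  proof -
    have a_der: "(a has_real_derivative a t) (at t)"
      unfolding a_def[abs_def] by (auto intro!: derivative_eq_intros)
    then have "((\<lambda>t. 1 - (a t)\<^sup>2) has_real_derivative - 2 * (a t)\<^sup>2) (at t)"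
      by (auto intro!: derivative_eq_intros simp: power2_eq_square)
    from DERIV_chain2[OF DERIV_real_sqrt[OF a1[OF t]] this]
    have "(b has_real_derivative inverse (b t) / 2 * (- 2 * (a t)\<^sup>2)) (at t)"
      unfolding b_def[abs_def] .
    then have b_der: "(b has_real_derivative - ((a t)\<^sup>2 / b t)) (at t)"
      by (rule DERIV_cong) (simp add: field_simps)
    have "((\<lambda>t. a t *\<^sub>R p + b t *\<^sub>R ang e s) has_vector_derivative
        (a t *\<^sub>R 0 + a t *\<^sub>R p) + (b t *\<^sub>R 0 + (- ((a t)\<^sup>2 / b t)) *\<^sub>R ang e s)) (at t)"
      by (intro has_vector_derivative_add has_vector_derivative_scaleR has_vector_derivative_const a_der b_der)
    then show ?thesis
      using circle_curvature_vector(2)[OF e \<tau> \<omega> on(1-3) ab[OF t]] by simp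
  qed
  have "curve_shortening_flow I (\<lambda>t z. a t *\<^sub>R p + b t *\<^sub>R e z)"
    unfolding curve_shortening_flow_def by (intro conjI ballI allI smooth embedding evolution)
  then show ?thesis unfolding a_def b_def .
qed

context circular_csf
begin

text \<open>The explicit formula that holds on \<open>I\<close> makes sense, and solves the flow, as long as the height
  \<open>\<bar>C\<bar> e\<^sup>t\<close> of the circle stays below \<open>1\<close>.\<close>

lemma circle_extension:
  assumes J: "open J" and lt: "\<And>t. t \<in> J \<Longrightarrow> \<bar>cosr t0 * exp (- t0) * exp t\<bar> < 1"
  shows "\<exists>G. curve_shortening_flow J G \<and> (\<forall>t\<in>I. \<forall>z\<in>S1. G t z = F t z)"
proof -
  define C where "C = cosr t0 * exp (- t0)"
  define e where "e z = inverse (sinr t0) *\<^sub>R (F t0 z - cosr t0 *\<^sub>R center)" for z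
  have e_ang: "ang e s = dir t0 s" for s
    by (simp add: e_def dir_def ctr_eq[OF t0] pos_def)
  have "curve_shortening_flow J (\<lambda>t z. (C * exp t) *\<^sub>R center + sqrt (1 - (C * exp t)\<^sup>2) *\<^sub>R e z)"
  proof (rule shrinking_circle_flow[where \<omega>=rot and \<tau>="\<lambda>s. tang (t0, s)", OF J])
    show "\<bar>C * exp t\<bar> < 1" if "t \<in> J" for t using lt[OF that] by (simp add: C_def)
    have "smooth_on UNIV (ang (F t0))" using embedding[OF t0] by (simp add: smooth_embedding_def)
    then show "smooth_on UNIV (ang e)"
      unfolding e_def by (intro smooth_on_scaleR smooth_on_diff smooth_on_const open_UNIV)
    show "inj_on e S1"
      using embedding[OF t0] sinr_pos[of t0] by (auto simp: smooth_embedding_def inj_on_def e_def)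
    show "(ang e has_vector_derivative rot s *\<^sub>R tang (t0, s)) (at s)" for s
      using dir_derivative[of s] by (simp add: e_ang[abs_def])
    show "((\<lambda>s. tang (t0, s)) has_vector_derivative - rot s *\<^sub>R ang e s) (at s)" for s
      using tang_derivative[of s] by (simp add: e_ang)
    show "0 < rot s" for s using spd_pos[of "(t0, s)"] sinr_pos[of t0] t0 by simp
  qed (use t0 in \<open>auto simp: e_ang dir_unit dir_center tang_tang center_unit\<close>)
  moreover have "(C * exp t) *\<^sub>R center + sqrt (1 - (C * exp t)\<^sup>2) *\<^sub>R e z = F t z"
    if t: "t \<in> I" and z: "z \<in> S1" for t z
  proof -
    from z obtain s where s: "z = cis s" by (rule S1_cis)
    have c: "C * exp t = cosr t" using cosr_exp[OF t] by (simp add: C_def)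
    have "sqrt (1 - (cosr t)\<^sup>2) = sinr t"
      using cosr2[of t] sinr_pos[of t] by (intro real_sqrt_unique) auto
    then show ?thesis
      using pos_eq[OF t, of s] dir_eq[OF t, of s] by (simp add: c s e_ang) (simp add: pos_def)
  qed
  ultimately show ?thesis by blast
qed

lemma image_eq:
  assumes t: "t \<in> I"
  shows "F t ` S1 = {x\<in>S2. x \<bullet> center = cosr t}"
proof
  show "F t ` S1 \<subseteq> {x\<in>S2. x \<bullet> center = cosr t}"
  proof clarify
    fix z :: complex assume z: "z \<in> S1"
    from z obtain s where s: "z = cis s" by (rule S1_cis)
    show "F t z \<in> S2 \<and> F t z \<bullet> center = cosr t"
      using pos_center[OF t, of s] embedding[OF t] z s by (auto simp: pos_def smooth_embedding_def image_subset_iff)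
  qed
  show "{x\<in>S2. x \<bullet> center = cosr t} \<subseteq> F t ` S1"
  proof clarify
    fix x :: "real^3" assume x: "x \<in> S2" "x \<bullet> center = cosr t"
    define z where "z = inverse (sinr t) *\<^sub>R (x - cosr t *\<^sub>R center)"
    have xx: "x \<bullet> x = 1" using x by (simp add: dot_square_norm)
    have "(x - cosr t *\<^sub>R center) \<bullet> (x - cosr t *\<^sub>R center) = x \<bullet> x - 2 * cosr t * (x \<bullet> center) + cosr t * cosr t * (center \<bullet> center)"
      by (simp add: inner_diff_left inner_diff_right inner_commute)
    also have "\<dots> = (sinr t)\<^sup>2"
      unfolding xx x(2) center_unit using cosr2[of t] by (simp add: power2_eq_square)
    finally have "z \<bullet> z = 1"
      using sinr_pos[of t] unfolding z_def inner_scaleR_left inner_scaleR_right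
      by (simp add: power2_eq_square field_simps)
    moreover have "z \<bullet> center = 0"
      by (simp add: z_def inner_diff_left x(2) center_unit)
    ultimately obtain s where s: "dir t0 s = z" using dir_surj by blast
    have "pos (t, s) = x"
      using sinr_pos[of t] unfolding pos_eq[OF t] dir_eq[OF t] s z_def by simp
    then show "x \<in> F t ` S1" by (auto simp: pos_def)
  qed
qed

end

section \<open>Limits of shrinking circles\<close>

text \<open>The nearest point \<open>y\<close> on the equator of \<open>p\<close> to a point \<open>x\<close> at height \<open>c\<close>.\<close>

lemma latitude_distance:
  fixes x y p :: "real^3"
  assumes "x \<bullet> x = 1" "p \<bullet> p = 1" "x \<bullet> p = c" "c\<^sup>2 < 1"
  defines "y \<equiv> inverse (sqrt (1 - c\<^sup>2)) *\<^sub>R (x - c *\<^sub>R p)"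
  shows "y \<bullet> y = 1" "p \<bullet> y = 0" "x \<bullet> y = sqrt (1 - c\<^sup>2)"
proof -
  define r where "r = sqrt (1 - c\<^sup>2)"
  have r: "0 < r" "r * r = 1 - c\<^sup>2" using assms(4) by (simp_all add: r_def)
  have d: "(x - c *\<^sub>R p) \<bullet> (x - c *\<^sub>R p) = r * r" "x \<bullet> (x - c *\<^sub>R p) = r * r" "p \<bullet> (x - c *\<^sub>R p) = 0"
    using assms(1-3) unfolding r(2)
    by (simp_all add: inner_diff_left inner_diff_right inner_commute power2_eq_square)
  show "y \<bullet> y = 1" "p \<bullet> y = 0" "x \<bullet> y = sqrt (1 - c\<^sup>2)"
    using r(1) unfolding y_def inner_scaleR_left inner_scaleR_right r_def[symmetric] d
    by (simp_all add: field_simps)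
qed

lemma latitude_converge_equator:
  fixes p :: "real^3"
  assumes p: "p \<bullet> p = 1" and c0: "(c \<longlongrightarrow> 0) \<F>"
    and A: "\<forall>\<^sub>F t in \<F>. A t = {x\<in>S2. x \<bullet> p = c t}"
  shows "sets_converge A {x\<in>S2. p \<bullet> x = 0} \<F>"
  unfolding sets_converge_def
proof (intro allI impI)
  fix \<epsilon> :: real assume \<epsilon>: "0 < \<epsilon>"
  have "((\<lambda>t. (c t)\<^sup>2) \<longlongrightarrow> 0\<^sup>2) \<F>" by (intro tendsto_intros c0)
  then have small: "\<forall>\<^sub>F t in \<F>. (c t)\<^sup>2 < 1" by (rule order_tendstoD) simp
  have "((\<lambda>t. arccos (sqrt (1 - (c t)\<^sup>2))) \<longlongrightarrow> arccos (sqrt (1 - 0\<^sup>2))) \<F>"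
  proof (rule continuous_on_tendsto_compose[OF continuous_on_arccos'])
    show "((\<lambda>t. sqrt (1 - (c t)\<^sup>2)) \<longlongrightarrow> sqrt (1 - 0\<^sup>2)) \<F>" by (intro tendsto_intros c0)
    show "\<forall>\<^sub>F t in \<F>. sqrt (1 - (c t)\<^sup>2) \<in> {-1..1}"
      using small by eventually_elim (auto intro: order_trans[of _ 0])
  qed simp
  then have "\<forall>\<^sub>F t in \<F>. arccos (sqrt (1 - (c t)\<^sup>2)) < \<epsilon>"
    using \<epsilon> by (intro order_tendstoD(2)) auto
  then show "\<forall>\<^sub>F t in \<F>. (\<forall>x\<in>A t. \<exists>y\<in>{x\<in>S2. p \<bullet> x = 0}. sphere_dist x y < \<epsilon>) \<and>
      (\<forall>y\<in>{x\<in>S2. p \<bullet> x = 0}. \<exists>x\<in>A t. sphere_dist x y < \<epsilon>)"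
    using small A
  proof eventually_elim
    case (elim t)
    define r where "r = sqrt (1 - (c t)\<^sup>2)"
    have r: "r * r = 1 - (c t)\<^sup>2" using elim(2) by (simp add: r_def)
    show ?case
    proof (intro conjI ballI)
      fix x assume "x \<in> A t"
      then have "x \<bullet> x = 1" "x \<bullet> p = c t" by (auto simp: elim(3) dot_square_norm)
      note y = latitude_distance[OF this(1) p this(2) elim(2)]
      show "\<exists>y\<in>{x\<in>S2. p \<bullet> x = 0}. sphere_dist x y < \<epsilon>"
        using y elim(1) by (intro bexI[of _ "inverse (sqrt (1 - (c t)\<^sup>2)) *\<^sub>R (x - c t *\<^sub>R p)"])
          (auto simp: sphere_dist_def norm_eq_1)
    next
      fix y assume y: "y \<in> {x\<in>S2. p \<bullet> x = 0}"
      then have yy: "y \<bullet> y = 1" "p \<bullet> y = 0" "y \<bullet> p = 0" by (auto simp: dot_square_norm inner_commute)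
      define x where "x = c t *\<^sub>R p + r *\<^sub>R y"
      have "x \<bullet> x = 1" "x \<bullet> p = c t" "x \<bullet> y = r"
        unfolding x_def using yy p r by (simp_all add: inner_add_left inner_add_right power2_eq_square)
      then have "x \<in> A t" "sphere_dist x y < \<epsilon>"
        using elim(1) by (auto simp: elim(3) sphere_dist_def norm_eq_1 r_def)
      then show "\<exists>x\<in>A t. sphere_dist x y < \<epsilon>" ..
    qed
  qed
qed

lemma latitude_converge_pole:
  fixes p :: "real^3"
  assumes c1: "(c \<longlongrightarrow> 1) \<F>"
    and A: "\<forall>\<^sub>F t in \<F>. A t = {x\<in>S2. x \<bullet> p = c t} \<and> A t \<noteq> {} \<and> \<bar>c t\<bar> \<le> 1"
  shows "sets_converge A {p} \<F>"
  unfolding sets_converge_def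
proof (intro allI impI)
  fix \<epsilon> :: real assume \<epsilon>: "0 < \<epsilon>"
  have "((\<lambda>t. arccos (c t)) \<longlongrightarrow> arccos 1) \<F>"
    by (rule continuous_on_tendsto_compose[OF continuous_on_arccos' c1])
      (use A in \<open>auto elim!: eventually_mono\<close>)
  then have "\<forall>\<^sub>F t in \<F>. arccos (c t) < \<epsilon>"
    using \<epsilon> by (intro order_tendstoD(2)) auto
  then show "\<forall>\<^sub>F t in \<F>. (\<forall>x\<in>A t. \<exists>y\<in>{p}. sphere_dist x y < \<epsilon>) \<and> (\<forall>y\<in>{p}. \<exists>x\<in>A t. sphere_dist x y < \<epsilon>)"
    using A by eventually_elim (auto simp: sphere_dist_def)
qed

section \<open>Classification\<close>

lemma open_before: "open (before T)"
proof (cases T)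
  case (real r)
  then have "before T = {..<r}" by auto
  then show ?thesis by simp
qed auto

lemma convex_before: "convex (before T)"
proof (cases T)
  case (real r)
  then have "before T = {..<r}" by auto
  then show ?thesis by simp
qed auto

text \<open>All of the classification except the value of \<open>C\<close>, which is decided by maximality: if
  \<open>C e\<^sup>t\<close> stayed below \<open>1\<close> on a longer interval, the explicit circles would extend the solution.
  The centre is replaced by its antipode if necessary to make \<open>C\<close> nonnegative.\<close>

lemma ancient_solution_circles:
  assumes anc: "ancient_solution T F" and conv: "convex_flow (before T) F"
  obtains p :: "real^3" and C :: real where "p \<bullet> p = 1" "0 \<le> C"
    "\<And>t. t \<in> before T \<Longrightarrow> F t ` S1 = {x\<in>S2. x \<bullet> p = C * exp t}"
    "\<And>t. t \<in> before T \<Longrightarrow> C * exp t < 1"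
    "\<And>T'. T < T' \<Longrightarrow> \<exists>t\<in>before T'. 1 \<le> C * exp t"
proof -
  have flow: "curve_shortening_flow (before T) F" and T: "T = 0 \<or> T = \<infinity>"
    and maximal: "\<And>T' G. T < T' \<Longrightarrow> curve_shortening_flow (before T') G \<Longrightarrow>
      \<not> (\<forall>t\<in>before T. \<forall>z\<in>S1. G t z = F t z)"
    using anc by (auto simp: ancient_solution_def)
  interpret csf "before T" F
    by unfold_locales (rule open_before convex_before flow)+
  have sign: "(\<forall>s. 0 \<le> cur (t, s)) \<or> (\<forall>s. cur (t, s) \<le> 0)" if t: "t \<in> before T" for t
  proof -
    from conv obtain \<nu> where "interior_normal_family (before T) F \<nu>"
      "\<forall>t\<in>before T. \<forall>s. geodesic_curvature (ang (F t)) (ang (\<nu> t)) s \<ge> 0"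
      by (auto simp: convex_flow_def)
    then show ?thesis
      using t by (intro cur_one_signed[OF t, of "\<nu> t"]) (auto simp: interior_normal_family_def)
  qed
  have t0: "-1 \<in> before T" using T by auto
  interpret ancient_csf "before T" F
  proof
    show "s \<in> before T" if "t \<in> before T" "s \<le> t" for s t
      using that le_less_trans[of "ereal s" "ereal t" T] by simp
    show "before T \<noteq> {}" using t0 by blast
    show "len t * (1 - (totcur t)\<^sup>2 / 2) \<le> 2 * pi" if "t \<in> before T" "\<bar>totcur t\<bar> < 1" for t
      by (rule length_bound_of_convex[OF that(1) sign[OF that(1)] that(2)])
  qed
  interpret circular_csf "before T" F meancur "-1"
    by unfold_locales (use cur_constant defect_zero t0 in auto)
  define C where "C = cosr (-1) * exp 1"
  have c: "cosr t = C * exp t" if "t \<in> before T" for t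
    using cosr_exp[OF that] by (simp add: C_def)
  have c1: "\<bar>C * exp t\<bar> < 1" if "t \<in> before T" for t
  proof -
    have "0 < (sinr t)\<^sup>2" using sinr_pos[of t] by simp
    then have "(cosr t)\<^sup>2 < 1" using cosr2[of t] by linarith
    then show ?thesis by (simp add: c[OF that] abs_square_less_1)
  qed
  have ext: "\<exists>t\<in>before T'. 1 \<le> \<bar>C * exp t\<bar>" if "T < T'" for T'
  proof (rule ccontr)
    assume "\<not> ?thesis"
    then have "\<And>t. t \<in> before T' \<Longrightarrow> \<bar>cosr (-1) * exp (- (-1)) * exp t\<bar> < 1"
      by (force simp: C_def)
    from circle_extension[OF open_before this] maximal[OF that] show False by blast
  qed
  define q where "q = (if 0 \<le> C then center else - center)"
  have "x \<bullet> q = \<bar>C\<bar> * exp t \<longleftrightarrow> x \<bullet> center = C * exp t" for x t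
    by (auto simp: q_def)
  then have "F t ` S1 = {x\<in>S2. x \<bullet> q = \<bar>C\<bar> * exp t}" if "t \<in> before T" for t
    using image_eq[OF that] c[OF that] by simp
  then show thesis
    using c1 ext center_unit by (intro that[of q "\<bar>C\<bar>"]) (auto simp: abs_mult q_def)
qed

theorem theorem1p1:
  fixes F :: "real \<Rightarrow> complex \<Rightarrow> real^3" and T :: ereal
  assumes "ancient_solution T F"
    and "convex_flow (before T) F"
  shows "(T = \<infinity> \<and> (\<exists>E. is_equator E \<and> (\<forall>t. F t ` S1 = E))) \<or>
    (T = 0 \<and>
      (\<exists>p\<in>S2. \<exists>r. strict_antimono_on {..<0} r \<and>
        (\<forall>t<0. 0 < r t \<and> r t < pi \<and> F t ` S1 = geodesic_circle p (r t))) \<and>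
      (\<exists>E. is_equator E \<and> sets_converge (\<lambda>t. F t ` S1) E at_bot) \<and>
      (\<exists>q\<in>S2. sets_converge (\<lambda>t. F t ` S1) {q} (at_left 0)))"
proof -
  obtain p C where p: "p \<bullet> p = 1" and C: "0 \<le> C"
    and image: "\<And>t. t \<in> before T \<Longrightarrow> F t ` S1 = {x\<in>S2. x \<bullet> p = C * exp t}"
    and less1: "\<And>t. t \<in> before T \<Longrightarrow> C * exp t < 1"
    and maximal: "\<And>T'. T < T' \<Longrightarrow> \<exists>t\<in>before T'. 1 \<le> C * exp t"
    by (rule ancient_solution_circles[OF assms]) blast
  have pS: "p \<in> S2" using p by (simp add: norm_eq_1)
  have equator: "is_equator {x\<in>S2. p \<bullet> x = 0}" using pS by (auto simp: is_equator_def)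
  have "T = 0 \<or> T = \<infinity>" using assms(1) by (simp add: ancient_solution_def)
  then show ?thesis
  proof
    assume T: "T = \<infinity>"
    have "C = 0"
    proof (rule ccontr)
      assume "C \<noteq> 0"
      then have "C * exp (- ln C) = 1" using C by (simp add: exp_minus)
      with less1[of "- ln C"] T show False by simp
    qed
    then have "F t ` S1 = {x\<in>S2. p \<bullet> x = 0}" for t using image[of t] T by (simp add: inner_commute)
    then show ?thesis using T equator by blast
  next
    assume T: "T = 0"
    then have before: "t \<in> before T \<longleftrightarrow> t < 0" for t by (simp add: zero_ereal_def)
    have "C = 1"
    proof (rule antisym)
      show "C \<le> 1"
      proof (rule ccontr)
        assume *: "\<not> C \<le> 1"
        then have "C * exp (- ln C) = 1" by (simp add: exp_minus)
        moreover have "0 < ln C" using * by (intro ln_gt_zero) simp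
        ultimately show False using less1[of "- ln C"] before by simp
      qed
      show "1 \<le> C"
      proof (rule ccontr)
        assume *: "\<not> 1 \<le> C"
        define T' where "T' = (if C = 0 then 1 else - ln C)"
        have "0 < T'" using * C by (auto simp: T'_def)
        then obtain t where t: "t < T'" "1 \<le> C * exp t"
          using maximal[of "ereal T'"] T by (auto simp: zero_ereal_def)
        then have "C \<noteq> 0" by auto
        have "C * exp t < C * exp T'" using t(1) C \<open>C \<noteq> 0\<close> by simp
        also have "\<dots> = 1" using C \<open>C \<noteq> 0\<close> by (simp add: T'_def exp_minus)
        finally show False using t(2) by simp
      qed
    qed
    then have image: "F t ` S1 = {x\<in>S2. x \<bullet> p = exp t}" if "t < 0" for t
      using image[of t] that before by simp
    define r where "r t = arccos (exp t)" for t :: real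
    have "strict_antimono_on {..<0} r"
      by (intro monotone_onI) (auto simp: r_def intro!: arccos_less_arccos order_trans[of "-1" 0 "exp _"])
    moreover have "0 < r t \<and> r t < pi \<and> F t ` S1 = geodesic_circle p (r t)" if t: "t < 0" for t
    proof -
      have et: "0 < exp t" "exp t < 1" using t by auto
      have "x \<bullet> p = exp t \<longleftrightarrow> sphere_dist x p = r t" if "x \<in> S2" for x
      proof -
        have "\<bar>x \<bullet> p\<bar> \<le> 1" using Cauchy_Schwarz_ineq2[of x p] that pS by simp
        then show ?thesis using et by (simp add: sphere_dist_def r_def arccos_eq_iff)
      qed
      then have "F t ` S1 = geodesic_circle p (r t)"
        using image[OF t] by (auto simp: geodesic_circle_def)
      moreover have "-1 < exp t" using et by linarith
      ultimately show ?thesis using et(2) arccos_lt_bounded[of "exp t"] by (simp add: r_def)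
    qed
    moreover have "sets_converge (\<lambda>t. F t ` S1) {x\<in>S2. p \<bullet> x = 0} at_bot"
      by (rule latitude_converge_equator[OF p exp_at_bot])
        (unfold eventually_at_bot_dense, use image in blast)
    moreover have "sets_converge (\<lambda>t. F t ` S1) {p} (at_left 0)"
    proof (rule latitude_converge_pole)
      show "(exp \<longlongrightarrow> (1 :: real)) (at_left 0)"
        using tendsto_exp[OF tendsto_ident_at, of 0 "{..<0::real}"] by simp
      have "(1 :: complex) \<in> S1" by simp
      then have "F t ` S1 \<noteq> {}" for t by blast
      then show "\<forall>\<^sub>F t in at_left 0. F t ` S1 = {x\<in>S2. x \<bullet> p = exp t} \<and> F t ` S1 \<noteq> {} \<and> \<bar>exp t\<bar> \<le> 1"
        using image by (auto simp: eventually_at_filter intro!: always_eventually)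
    qed
    ultimately show ?thesis using T pS equator by blast
  qed
qed

end
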